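(* Let $p$ be a prime with $3 \leq p \leq 13$. If $x, y \in \mathbb{Z}$ satisfy $x^2 - 2 = y^p$, then $y = -1$. *)

theory Defs
  imports "HOL-Computational_Algebra.Primes"
begin

end

theory Submission
  imports Defs "HOL-Computational_Algebra.Computational_Algebra" "HOL-Analysis.Analysis"
    "Jordan_Normal_Form.Char_Poly"
begin

text \<open>
  In \<open>\<int>[\<surd>2]\<close> the equation gives \<open>\<plusminus>x + \<surd>2 = (1 + \<surd>2)\<^sup>r (a + b\<surd>2)\<^sup>p\<close> with \<open>0 \<le> r \<le> (p - 1)/2\<close>,
  and \<open>r = 0\<close> is impossible. Let \<open>\<eta>\<^sup>p = 1 + \<surd>2\<close>, \<open>\<eta>' = -1/\<eta>\<close> and \<open>\<tau> = \<eta> + \<eta>'\<close>, a root of \<open>L\<^sub>p - 2\<close> where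
  \<open>L\<^sub>p\<close> is the Lucas polynomial. Dividing \<open>\<eta>\<^sup>r(a + b\<surd>2) - \<eta>'\<^sup>r(a - b\<surd>2)\<close> by \<open>\<eta> - \<eta>'\<close> yields a unit of
  \<open>\<int>[\<tau>]\<close> that depends linearly on \<open>a\<close> and \<open>b\<close>.

  The field \<open>\<rat>(\<tau>)\<close> has one real and \<open>(p - 1)/2\<close> pairs of complex embeddings, so this unit satisfies a
  multiplicative relation with any \<open>(p - 1)/2\<close> given units. For suitable explicit units and a small auxiliary
  prime \<open>q\<close>, the first-order terms of the \<open>q\<close>-adic logarithms of all units involved are linearly independent
  modulo \<open>q\<close>, except when \<open>r = 1\<close> and \<open>q\<close> divides \<open>b\<close>; independence makes the relation
  infinitely divisible by \<open>q\<close>, which is absurd. In the exceptional case Skolem's \<open>q\<close>-adic argument gives \<open>b = 0\<close>.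
  Neither fundamental units nor the class group are needed: it is never used that the explicit units generate the
  full unit group.
\<close>

hide_const (open) Module.smult

section \<open>The ring \<open>\<int>[\<surd>2]\<close>\<close>

text \<open>The class \<open>r = 1\<close> contains the genuine solution \<open>a = 1\<close>,
  \<open>b = 0\<close>, that is \<open>x' = 1\<close>, \<open>y = -1\<close>, so no congruence can
  dispose of it entirely: its pairs with q | b need unbounded q-adic precision, while every other
  residue class falls to a finite check. Passing from \<eta> to \<tau> is what makes the number of
  auxiliary units small: the field of \<eta> has degree 2p and unit rank p, that of \<tau> has
  degree p and rank (p - 1)/2. The range of r comes from conjugation in Z[sqrt 2], which exchanges r
  and p - r up to the sign of x. The case r = 0 fails because b divides the coefficient of sqrt 2 in
  (a + b sqrt 2)^p, and for b = 1 or b = -1 that coefficient has absolute value at least 2. The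
  logarithms are elementary: all units are raised to a common exponent E that brings them to the
  form 1 + q t modulo q^2, and t modulo q is additive. A relation whose exponents are all divisible
  by q can be divided by q, because for odd q there is no q-torsion among the elements congruent to
  1 modulo q.\<close>

datatype zsqrt2 = ZS (zre: int) (zim: int)

instantiation zsqrt2 :: comm_ring_1
begin
definition "0 = ZS 0 0"
definition "1 = ZS 1 0"
definition "a + b = ZS (zre a + zre b) (zim a + zim b)"
definition "a - b = ZS (zre a - zre b) (zim a - zim b)"
definition "- a = ZS (- zre a) (- zim a)"
definition "a * b = ZS (zre a * zre b + 2 * zim a * zim b) (zre a * zim b + zim a * zre b)"
instance
  by standard (auto simp: zero_zsqrt2_def one_zsqrt2_def plus_zsqrt2_def minus_zsqrt2_def
      uminus_zsqrt2_def times_zsqrt2_def algebra_simps intro: zsqrt2.expand)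
end

lemmas zsqrt2_defs = zero_zsqrt2_def one_zsqrt2_def plus_zsqrt2_def minus_zsqrt2_def
  uminus_zsqrt2_def times_zsqrt2_def

lemma zsqrt2_sel [simp]:
  "zre 0 = 0" "zim 0 = 0" "zre 1 = 1" "zim 1 = 0"
  "zre (a + b) = zre a + zre b" "zim (a + b) = zim a + zim b"
  "zre (a - b) = zre a - zre b" "zim (a - b) = zim a - zim b"
  "zre (- a) = - zre a" "zim (- a) = - zim a"
  "zre (a * b) = zre a * zre b + 2 * zim a * zim b" "zim (a * b) = zre a * zim b + zim a * zre b"
  by (auto simp: zsqrt2_defs)

definition zconj :: "zsqrt2 \<Rightarrow> zsqrt2" where "zconj a = ZS (zre a) (- zim a)"

definition znorm :: "zsqrt2 \<Rightarrow> int" where "znorm a = (zre a)\<^sup>2 - 2 * (zim a)\<^sup>2"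

lemma zconj_sel [simp]: "zre (zconj a) = zre a" "zim (zconj a) = - zim a"
  by (auto simp: zconj_def)

lemma zconj_mult: "zconj (a * b) = zconj a * zconj b"
  by (auto intro: zsqrt2.expand)

lemma zconj_one [simp]: "zconj 1 = 1"
  by (auto intro: zsqrt2.expand)

lemma zconj_power: "zconj (a ^ n) = zconj a ^ n"
  by (induction n) (auto simp: zconj_mult)

lemma znorm_mult: "znorm (a * b) = znorm a * znorm b"
  by (simp add: znorm_def power2_eq_square algebra_simps)

lemma znorm_one [simp]: "znorm 1 = 1"
  by (simp add: znorm_def)

lemma znorm_power: "znorm (a ^ n) = znorm a ^ n"
  by (induction n) (auto simp: znorm_mult)

lemma znorm_zconj [simp]: "znorm (zconj a) = znorm a"
  by (simp add: znorm_def)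

lemma mult_zconj: "a * zconj a = ZS (znorm a) 0"
  by (auto intro!: zsqrt2.expand simp: znorm_def power2_eq_square)

lemma znorm_dvd: "a dvd b \<Longrightarrow> znorm a dvd znorm b"
  by (auto simp: znorm_mult elim!: dvdE)

lemma znorm_eq_0_iff [simp]: "znorm a = 0 \<longleftrightarrow> a = 0"
proof
  assume "znorm a = 0"
  hence eq: "(zre a)\<^sup>2 = 2 * (zim a)\<^sup>2" by (simp add: znorm_def)
  have "zim a = 0"
  proof (rule ccontr)
    assume "zim a \<noteq> 0"
    with eq have "zre a \<noteq> 0" by auto
    \<comment> \<open>Irrationality of sqrt 2: the 2-adic valuation is even on one side of
      \<open>eq\<close> and odd on the other.\<close>
    have "multiplicity 2 ((zre a)\<^sup>2) = 2 * multiplicity (2::int) (zre a)"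
      using \<open>zre a \<noteq> 0\<close> by (intro prime_elem_multiplicity_power_distrib) auto
    moreover have "multiplicity 2 (2 * (zim a)\<^sup>2) = 1 + 2 * multiplicity (2::int) (zim a)"
      using \<open>zim a \<noteq> 0\<close>
      by (subst prime_elem_multiplicity_mult_distrib) (auto simp: prime_elem_multiplicity_power_distrib)
    ultimately show False unfolding eq by presburger
  qed
  thus "a = 0" using eq by (auto intro: zsqrt2.expand)
qed (simp add: znorm_def)

lemma zsqrt2_unit_inverse: "\<bar>znorm a\<bar> = 1 \<Longrightarrow> \<exists>b. a * b = 1"
proof -
  assume "\<bar>znorm a\<bar> = 1"
  hence "znorm a * znorm a = 1" by (metis abs_mult_self_eq mult_1)
  hence "a * (zconj a * ZS (znorm a) 0) = 1"
    unfolding mult.assoc[symmetric] mult_zconj by (auto intro: zsqrt2.expand)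
  thus ?thesis by blast
qed

section \<open>Euclidean division and Bezout identities in Z[sqrt 2]\<close>

lemma nearest_int_division:
  fixes a n :: int
  assumes "n \<noteq> 0"
  obtains k where "2 * \<bar>a - k * n\<bar> \<le> \<bar>n\<bar>"
proof -
  define N where "N = \<bar>n\<bar>"
  have N: "N > 0" using assms by (simp add: N_def)
  define k where "k = (2 * a + N) div (2 * N)"
  define m where "m = (2 * a + N) mod (2 * N)"
  have "2 * a + N = (2 * N) * k + m" unfolding k_def m_def by simp
  moreover have "0 \<le> m" "m < 2 * N" using N by (auto simp: m_def)
  ultimately have "2 * \<bar>a - k * N\<bar> \<le> N" by (simp add: algebra_simps abs_if)
  moreover have "k * N = (k * sgn n) * n" by (simp add: N_def abs_sgn mult.commute mult.left_commute)
  ultimately have "2 * \<bar>a - (k * sgn n) * n\<bar> \<le> \<bar>n\<bar>" unfolding N_def by metis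
  thus thesis by (rule that)
qed

lemma zsqrt2_division:
  assumes "w \<noteq> 0"
  obtains c where "\<bar>znorm (z - c * w)\<bar> < \<bar>znorm w\<bar>"
proof -
  let ?n = "znorm w"
  have n0: "?n \<noteq> 0" using assms by simp
  define v where "v = z * zconj w"
  obtain k1 where k1: "2 * \<bar>zre v - k1 * ?n\<bar> \<le> \<bar>?n\<bar>" using nearest_int_division[OF n0] .
  obtain k2 where k2: "2 * \<bar>zim v - k2 * ?n\<bar> \<le> \<bar>?n\<bar>" using nearest_int_division[OF n0] .
  let ?c = "ZS k1 k2"
  define e where "e = zre v - k1 * ?n"
  define d where "d = zim v - k2 * ?n"
  have "(z - ?c * w) * zconj w = v - ?c * (w * zconj w)" by (simp add: v_def algebra_simps)
  also have "\<dots> = ZS e d" unfolding mult_zconj by (auto intro!: zsqrt2.expand simp: e_def d_def)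
  finally have "znorm (z - ?c * w) * ?n = e\<^sup>2 - 2 * d\<^sup>2"
    using znorm_mult[of "z - ?c * w" "zconj w"] by (simp add: znorm_def)
  hence "\<bar>znorm (z - ?c * w)\<bar> * \<bar>?n\<bar> = \<bar>e\<^sup>2 - 2 * d\<^sup>2\<bar>" by (metis abs_mult)
  \<comment> \<open>Both \<open>e\<close> and \<open>d\<close> are at most half of \<open>?n\<close>
    in absolute value, so \<open>e\<^sup>2 - 2 * d\<^sup>2\<close> lies between -1/2 and 1/4 of
    \<open>?n\<^sup>2\<close>. This is why the ring is norm-Euclidean.\<close>
  moreover have "4 * \<bar>e\<^sup>2 - 2 * d\<^sup>2\<bar> < 4 * (\<bar>?n\<bar> * \<bar>?n\<bar>)"
  proof -
    have sq: "4 * x\<^sup>2 \<le> ?n\<^sup>2" if "2 * \<bar>x\<bar> \<le> \<bar>?n\<bar>" for x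
      using power_mono[OF that, of 2] by (simp add: power_mult_distrib)
    have "- (4 * N) < 4 * (E - 2 * D) \<and> 4 * (E - 2 * D) < 4 * N"
      if "4 * E \<le> N" "4 * D \<le> N" "N > 0" "E \<ge> 0" "D \<ge> 0" for E D N :: int using that by simp
    from this[of "e\<^sup>2" "?n\<^sup>2" "d\<^sup>2"]
    have "- (4 * ?n\<^sup>2) < 4 * (e\<^sup>2 - 2 * d\<^sup>2) \<and> 4 * (e\<^sup>2 - 2 * d\<^sup>2) < 4 * ?n\<^sup>2"
      using sq[of e] sq[of d] k1 k2 n0 by (simp add: e_def d_def)
    moreover have "\<bar>?n\<bar> * \<bar>?n\<bar> = ?n\<^sup>2" by (simp add: power2_eq_square)
    ultimately have "- (4 * (\<bar>?n\<bar> * \<bar>?n\<bar>)) < 4 * (e\<^sup>2 - 2 * d\<^sup>2)"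
      "4 * (e\<^sup>2 - 2 * d\<^sup>2) < 4 * (\<bar>?n\<bar> * \<bar>?n\<bar>)" by simp_all
    thus ?thesis by (simp add: abs_less_iff)
  qed
  ultimately have "\<bar>znorm (z - ?c * w)\<bar> * \<bar>?n\<bar> < \<bar>?n\<bar> * \<bar>?n\<bar>" by simp
  hence "\<bar>znorm (z - ?c * w)\<bar> < \<bar>?n\<bar>" by (rule mult_right_less_imp_less) simp
  thus thesis by (rule that)
qed

lemma zsqrt2_bezout:
  obtains g s t where "g = s * z + t * (w :: zsqrt2)" "g dvd z" "g dvd w"
proof -
  have "\<exists>g s t. g = s * z + t * w \<and> g dvd z \<and> g dvd w"
  proof (induction "nat \<bar>znorm w\<bar>" arbitrary: z w rule: less_induct)
    case less
    show ?case
    proof (cases "w = 0")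
      case True
      thus ?thesis by (intro exI[of _ z] exI[of _ 1] exI[of _ 0]) auto
    next
      case False
      obtain c where c: "\<bar>znorm (z - c * w)\<bar> < \<bar>znorm w\<bar>" using zsqrt2_division[OF False] .
      hence "nat \<bar>znorm (z - c * w)\<bar> < nat \<bar>znorm w\<bar>" by linarith
      from less.hyps[OF this, of w]
      obtain g s t where g: "g = s * w + t * (z - c * w)" "g dvd w" "g dvd z - c * w" by blast
      have "g dvd (z - c * w) + c * w" using g(2,3) by (intro dvd_add dvd_mult) auto
      hence "g dvd z" by simp
      moreover have "g = t * z + (s - t * c) * w" using g(1) by (simp add: algebra_simps)
      ultimately show ?thesis using g(2) by blast
    qed
  qed
  thus thesis using that by blast
qed

section \<open>Units of Z[sqrt 2], and p-th powers up to units\<close>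

abbreviation fund_unit :: zsqrt2 where "fund_unit \<equiv> ZS 1 1"
abbreviation fund_unit_inv :: zsqrt2 where "fund_unit_inv \<equiv> ZS (-1) 1"

lemma fund_unit_inverse [simp]: "fund_unit * fund_unit_inv = 1" "fund_unit_inv * fund_unit = 1"
  by (auto intro: zsqrt2.expand)

text \<open>Descent on the coefficient b of sqrt 2: for b nonzero, norm 1 or -1 gives |b| <= |a| <
  2|b|. Multiplication by \<open>fund_unit\<close> or by its inverse turns b into a + b or a - b,
  and one of the two is smaller than b in absolute value. The second alternative expresses a
  negative exponent without inverses.\<close>

lemma zsqrt2_units:
  assumes "\<bar>znorm t\<bar> = 1"
  shows "\<exists>n s. (s = 1 \<or> s = -1) \<and> (t = s * fund_unit ^ n \<or> t * fund_unit ^ n = s)"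
  using assms
proof (induction "nat \<bar>zim t\<bar>" arbitrary: t rule: less_induct)
  case less
  define a b where "a = zre t" and "b = zim t"
  have t: "t = ZS a b" by (simp add: a_def b_def)
  have ab: "a\<^sup>2 = 2 * b\<^sup>2 + 1 \<or> a\<^sup>2 = 2 * b\<^sup>2 - 1"
    using less.prems by (auto simp: znorm_def t abs_if split: if_splits)
  show ?case
  proof (cases "b = 0")
    case True
    have "a\<^sup>2 \<ge> 0" by simp
    moreover have "a\<^sup>2 = 1 \<or> a\<^sup>2 = -1" using ab True by simp
    ultimately have "a\<^sup>2 = 1" by linarith
    hence "a = 1 \<or> a = -1" by (simp add: power2_eq_1_iff)
    hence "t = 1 \<or> t = -1" using True by (auto simp: t intro!: zsqrt2.expand)
    thus ?thesis by (intro exI[of _ 0] exI[of _ t]) auto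
  next
    case False
    have b2: "b\<^sup>2 \<ge> 1" using False by (simp add: int_one_le_iff_zero_less)
    have "\<bar>b\<bar>\<^sup>2 \<le> \<bar>a\<bar>\<^sup>2" using ab b2 by auto
    hence le: "\<bar>b\<bar> \<le> \<bar>a\<bar>" by (rule power2_le_imp_le) simp
    have "\<bar>a\<bar>\<^sup>2 < (2 * \<bar>b\<bar>)\<^sup>2" using ab b2 by (auto simp: power_mult_distrib)
    hence lt: "\<bar>a\<bar> < 2 * \<bar>b\<bar>" by (rule power2_less_imp_less) simp
    have cancel: "(u * fund_unit) * fund_unit_inv = u" "(u * fund_unit_inv) * fund_unit = u" for u
      by (simp_all add: mult.assoc)
    consider "\<bar>a - b\<bar> < \<bar>b\<bar>" | "\<bar>a + b\<bar> < \<bar>b\<bar>" using le lt by (auto simp: abs_if split: if_splits)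
    thus ?thesis
    proof cases
      case 1
      define t' where "t' = t * fund_unit_inv"
      have tt: "t = t' * fund_unit" by (simp add: t'_def cancel)
      have "zim t' = a - b" by (simp add: t'_def t)
      hence "nat \<bar>zim t'\<bar> < nat \<bar>zim t\<bar>" using 1 by (simp add: b_def[symmetric])
      moreover have "\<bar>znorm t'\<bar> = 1" using less.prems unfolding t'_def znorm_mult by (simp add: znorm_def abs_mult)
      ultimately obtain n s where s: "s = 1 \<or> s = -1" "t' = s * fund_unit ^ n \<or> t' * fund_unit ^ n = s"
        using less.hyps by blast
      show ?thesis
      proof (cases "t' = s * fund_unit ^ n")
        case True
        hence "t = s * fund_unit ^ Suc n" by (simp add: tt mult.assoc mult.commute)
        thus ?thesis using s(1) by blast
      next
        case F: False
        show ?thesis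
        proof (cases n)
          case 0
          thus ?thesis using F s by simp
        next
          case (Suc k)
          hence "t * fund_unit ^ k = s" using F s(2) by (simp add: tt mult.assoc)
          thus ?thesis using s(1) by blast
        qed
      qed
    next
      case 2
      define t' where "t' = t * fund_unit"
      have "zim t' = a + b" by (simp add: t'_def t)
      hence "nat \<bar>zim t'\<bar> < nat \<bar>zim t\<bar>" using 2 by (simp add: b_def[symmetric])
      moreover have "\<bar>znorm t'\<bar> = 1" using less.prems unfolding t'_def znorm_mult by (simp add: znorm_def abs_mult)
      ultimately obtain n s where s: "s = 1 \<or> s = -1" "t' = s * fund_unit ^ n \<or> t' * fund_unit ^ n = s"
        using less.hyps by blast
      show ?thesis
      proof (cases "t' * fund_unit ^ n = s")
        case True
        hence "t * fund_unit ^ Suc n = s" by (simp add: t'_def mult.assoc)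
        thus ?thesis using s(1) by blast
      next
        case F: False
        show ?thesis
        proof (cases n)
          case 0
          thus ?thesis using F s by simp
        next
          case (Suc k)
          have "t = t' * fund_unit_inv" by (simp add: t'_def cancel)
          also have "t' = (s * fund_unit ^ k) * fund_unit" using F s(2) Suc by (simp add: mult.assoc mult.commute)
          finally have "t = s * fund_unit ^ k" by (simp add: cancel)
          thus ?thesis using s(1) by blast
        qed
      qed
    qed
  qed
qed

lemma ZS_dvd_iff: "ZS c 0 dvd ZS a b \<longleftrightarrow> c dvd a \<and> c dvd b"
proof
  assume "ZS c 0 dvd ZS a b"
  then obtain w where w: "ZS a b = ZS c 0 * w" by (rule dvdE)
  have "a = c * zre w" "b = c * zim w" using arg_cong[OF w, of zre] arg_cong[OF w, of zim] by simp_all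
  thus "c dvd a \<and> c dvd b" by simp
next
  assume "c dvd a \<and> c dvd b"
  then obtain k l where "a = c * k" "b = c * l" by (auto elim!: dvdE)
  hence "ZS a b = ZS c 0 * ZS k l" by (auto intro: zsqrt2.expand)
  thus "ZS c 0 dvd ZS a b" by simp
qed

lemma ZS_power: "ZS c 0 ^ n = ZS (c ^ n) 0"
  by (induction n) (auto intro: zsqrt2.expand simp: one_zsqrt2_def times_zsqrt2_def)

lemma dvd_power_add_mult:
  fixes a u v :: "'a :: comm_ring_1"
  assumes "a dvd u" "a dvd v ^ n"
  shows "a dvd (u + v) ^ n"
proof -
  have "u dvd (u + v) ^ n - v ^ n"
    using power_diff_sumr2[of "u + v" n v] by simp
  hence "a dvd (u + v) ^ n - v ^ n + v ^ n" using assms by (intro dvd_add) (auto intro: dvd_trans)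
  thus ?thesis by simp
qed

text \<open>
  With \<open>\<alpha> = gcd(x + \<surd>2, y)\<close> one has \<open>x + \<surd>2 | \<alpha>\<^sup>p\<close>, and comparing norms shows
  that the quotient is a unit.
\<close>

lemma square_minus_two_eq_power:
  fixes x y :: int
  assumes p: "odd p" "p > 1" and eq: "x\<^sup>2 - 2 = y ^ p"
  obtains r a b x' where "r \<le> (p - 1) div 2" "x' = x \<or> x' = - x" "ZS x' 1 = fund_unit ^ r * ZS a b ^ p"
proof -
  have oddx: "odd x"
  proof
    assume "even x"
    hence 4: "4 dvd x\<^sup>2" by (auto elim!: evenE simp: power2_eq_square)
    have "even (x\<^sup>2 - 2)" using \<open>even x\<close> by simp
    hence "even y" using eq by simp
    hence "2 ^ 2 dvd y ^ p" using p(2) by (intro dvd_power_le) auto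
    hence "4 dvd x\<^sup>2 - 2" unfolding eq by simp
    from dvd_diff[OF 4 this] show False by simp
  qed
  have oddyp: "odd (y ^ p)" unfolding eq[symmetric] using oddx by simp
  hence y0: "y ^ p \<noteq> 0" by (metis even_zero)
  define A where "A = ZS x 1"
  have nA: "znorm A = y ^ p" by (simp add: A_def znorm_def eq)
  have AA: "A * zconj A = ZS y 0 ^ p" by (simp add: mult_zconj nA ZS_power)
  \<comment> \<open>The conjugates are coprime: a common divisor divides their difference 2 sqrt 2,
    whose norm is -8, and also \<open>A\<close>, whose norm y^p is odd.\<close>
  obtain s t where st: "s * A + t * zconj A = 1"
  proof -
    obtain g s t where g: "g = s * A + t * zconj A" "g dvd A" "g dvd zconj A" using zsqrt2_bezout .
    have "g dvd A - zconj A" using g(2,3) by (rule dvd_diff)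
    hence "znorm g dvd znorm (A - zconj A)" by (rule znorm_dvd)
    hence "znorm g dvd 8" by (simp add: znorm_def A_def)
    moreover have "znorm g dvd y ^ p" using znorm_dvd[OF g(2)] by (simp add: nA)
    moreover have "coprime (8::int) (y ^ p)"
    proof -
      have "coprime (2 ^ 3) (y ^ p)" using oddyp by (simp del: power_numeral)
      thus ?thesis by simp
    qed
    ultimately have "\<bar>znorm g\<bar> = 1" using coprime_common_divisor_int by blast
    then obtain h where "g * h = 1" using zsqrt2_unit_inverse by blast
    hence "(h * s) * A + (h * t) * zconj A = 1" unfolding g(1) by (simp add: algebra_simps)
    thus thesis using that by blast
  qed
  obtain \<alpha> u v where al: "\<alpha> = u * A + v * ZS y 0" "\<alpha> dvd A" "\<alpha> dvd ZS y 0" using zsqrt2_bezout .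
  \<comment> \<open>Modulo \<open>A\<close> only the power of v y survives, and y^p is
    \<open>A\<close> times its conjugate.\<close>
  have "A dvd (u * A + v * ZS y 0) ^ p"
    by (rule dvd_power_add_mult) (auto simp: power_mult_distrib AA[symmetric])
  then obtain t1 where t1: "\<alpha> ^ p = A * t1" unfolding al(1)[symmetric] by (rule dvdE)
  have conj_dvd: "zconj b dvd zconj c" if "b dvd c" for b c
    using that by (auto elim!: dvdE simp: zconj_mult)
  have "zconj \<alpha> dvd ZS y 0" using conj_dvd[OF al(3)] by (simp add: zconj_def)
  obtain c where c: "ZS y 0 = \<alpha> * c" using al(3) by (rule dvdE)
  obtain \<beta> where be: "A = \<alpha> * \<beta>" using al(2) by (rule dvdE)
  \<comment> \<open>The conjugate of \<alpha> divides both terms of the Bezout identity times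
    \<open>c\<close>: the first is a multiple of y, the second of the conjugate of \<open>A\<close>.
    Hence it divides \<open>c\<close>, and the norm of \<alpha> divides \<alpha> c = y.\<close>
  have "zconj \<alpha> dvd (s * A + t * zconj A) * c"
  proof -
    have "(s * A + t * zconj A) * c = s * \<beta> * ZS y 0 + t * zconj A * c"
      by (simp add: be c algebra_simps)
    moreover have "zconj \<alpha> dvd s * \<beta> * ZS y 0" using \<open>zconj \<alpha> dvd ZS y 0\<close> by simp
    moreover have "zconj \<alpha> dvd t * zconj A * c" using conj_dvd[OF al(2)] by simp
    ultimately show ?thesis by simp
  qed
  hence "zconj \<alpha> dvd c" by (simp add: st)
  hence "\<alpha> * zconj \<alpha> dvd \<alpha> * c" by (rule mult_dvd_mono[OF dvd_refl])
  hence "znorm \<alpha> dvd y" unfolding mult_zconj c[symmetric] ZS_dvd_iff by simp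
  hence "znorm \<alpha> ^ p dvd y ^ p" by (rule dvd_power_same)
  moreover have "znorm \<alpha> ^ p = y ^ p * znorm t1"
    using arg_cong[OF t1, of znorm] by (simp add: znorm_mult znorm_power nA)
  ultimately have "y ^ p * znorm t1 dvd y ^ p * 1" by simp
  hence "znorm t1 dvd 1" using y0 by (metis dvd_mult_cancel_left)
  hence "\<bar>znorm t1\<bar> = 1" by simp
  then obtain n s where s: "s = 1 \<or> s = -1" "t1 = s * fund_unit ^ n \<or> t1 * fund_unit ^ n = s"
    using zsqrt2_units by blast
  have sp: "s ^ p = s" "s * s = 1" using s(1) p(1) by auto
  have inv_pow: "fund_unit ^ k * fund_unit_inv ^ k = 1" for k
    by (simp flip: power_mult_distrib)
  have "\<exists>j \<beta>. j < p \<and> A = fund_unit ^ j * \<beta> ^ p"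
    using s(2)
  proof
    assume "t1 * fund_unit ^ n = s"
    define j k where "j = n mod p" and "k = n div p"
    have n: "n = j + k * p" by (simp add: j_def k_def)
    have "A = A * (s * s)" by (simp add: sp)
    also have "\<dots> = s * (A * (t1 * fund_unit ^ n))" using \<open>t1 * _ = s\<close> by (simp add: ac_simps)
    also have "\<dots> = s ^ p * (\<alpha> ^ p * fund_unit ^ n)" by (simp add: t1 sp mult.assoc)
    also have "\<dots> = fund_unit ^ j * (s * \<alpha> * fund_unit ^ k) ^ p"
      by (simp add: n power_add power_mult power_mult_distrib ac_simps)
    finally show ?thesis using p(2) by (intro exI[of _ j]) (auto simp: j_def)
  next
    assume t1s: "t1 = s * fund_unit ^ n"
    \<comment> \<open>Here \<open>A\<close> is s \<alpha>^p times the power -n of the fundamental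
      unit; \<open>p - 1\<close> plays the role of -1, so \<open>j\<close> is the residue of -n
      modulo p.\<close>
    define j where "j = (n * (p - 1)) mod p"
    have "n + n * (p - 1) = n * p" using p(2) by (cases p) auto
    hence "(n + j) mod p = 0" unfolding j_def by (simp add: mod_add_right_eq)
    then obtain k where k: "n + j = k * p" by (metis mod_0_imp_dvd dvdE mult.commute)
    have "A = A * ((s * s) * (fund_unit ^ (k * p) * fund_unit_inv ^ (k * p)))" by (simp add: sp inv_pow)
    also have "\<dots> = s * (A * (s * fund_unit ^ n)) * fund_unit ^ j * fund_unit_inv ^ (k * p)"
      unfolding k[symmetric] power_add by (simp add: ac_simps)
    also have "\<dots> = s ^ p * \<alpha> ^ p * fund_unit ^ j * fund_unit_inv ^ (k * p)"
      by (simp add: t1 t1s sp)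
    also have "\<dots> = fund_unit ^ j * (s * \<alpha> * fund_unit_inv ^ k) ^ p"
      by (simp add: power_mult power_mult_distrib ac_simps)
    finally show ?thesis using p(2) by (intro exI[of _ j]) (auto simp: j_def)
  qed
  then obtain j \<beta> where j: "j < p" "A = fund_unit ^ j * \<beta> ^ p" by blast
  show thesis
  proof (cases "j \<le> (p - 1) div 2")
    case True
    have "ZS x 1 = fund_unit ^ j * ZS (zre \<beta>) (zim \<beta>) ^ p" using j(2) by (simp add: A_def)
    thus thesis using that True by blast
  next
    case False
    \<comment> \<open>Conjugation sends the fundamental unit to minus its inverse and x + sqrt 2 to
      -(-x + sqrt 2). It therefore turns the exponent j into -j, which is p - j modulo p-th powers;
      signs are p-th powers because p is odd.\<close>
    define r where "r = p - j"
    have r: "r \<le> (p - 1) div 2" using False p(1) by (auto simp: r_def elim!: oddE)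
    have m1: "(-1) ^ k * (-1) ^ k = (1::zsqrt2)" for k by (simp flip: power_mult_distrib)
    have cj: "zconj fund_unit = (-1) * fund_unit_inv" by (auto intro: zsqrt2.expand)
    have pj: "fund_unit_inv ^ j = fund_unit ^ r * fund_unit_inv ^ p"
    proof -
      have "fund_unit_inv ^ p = fund_unit_inv ^ r * fund_unit_inv ^ j"
        using j(1) by (simp add: r_def flip: power_add)
      thus ?thesis using inv_pow[of r] by (simp flip: mult.assoc)
    qed
    have gen: "c ^ p * ((e * i ^ p) * b ^ p) = e * (c * i * b) ^ p" for c e i b :: zsqrt2
      by (simp add: power_mult_distrib ac_simps)
    have "ZS (- x) 1 = (-1) * zconj A" by (auto simp: A_def intro: zsqrt2.expand)
    also have "zconj A = ((-1) * fund_unit_inv) ^ j * zconj \<beta> ^ p"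
      by (simp only: j(2) zconj_mult zconj_power cj)
    also have "(-1) * (((-1) * fund_unit_inv) ^ j * zconj \<beta> ^ p) =
        ((-1) * (-1) ^ j) ^ p * (fund_unit_inv ^ j * zconj \<beta> ^ p)"
    proof -
      have "((-1) * (-1) ^ j) ^ p = ((-1) * (-1) ^ j :: zsqrt2)"
        using p(1) by (cases "even j") auto
      thus ?thesis unfolding power_mult_distrib[of "-1" fund_unit_inv j] by (simp add: ac_simps)
    qed
    also have "\<dots> = fund_unit ^ r * (((-1) * (-1) ^ j) * fund_unit_inv * zconj \<beta>) ^ p"
      unfolding pj by (rule gen)
    finally obtain \<gamma> where "ZS (- x) 1 = fund_unit ^ r * \<gamma> ^ p" by blast
    hence "ZS (- x) 1 = fund_unit ^ r * ZS (zre \<gamma>) (zim \<gamma>) ^ p" by simp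
    thus thesis using that r by blast
  qed
qed

section \<open>Congruences modulo a monic polynomial and an integer\<close>

text \<open>Congruence modulo the ideal generated by \<open>T\<close> and \<open>M\<close>. The
  modulus 0 gives equality in Z[X]/(T), and powers of q give its q-adic approximations, so the
  quotient ring itself is never constructed.\<close>

definition pcong :: "int poly \<Rightarrow> int \<Rightarrow> int poly \<Rightarrow> int poly \<Rightarrow> bool" where
  "pcong T M f g \<longleftrightarrow> (\<exists>h k. f - g = T * h + smult M k)"

lemma pcong_refl [simp, intro]: "pcong T M f f"
  unfolding pcong_def by (rule exI[of _ 0], rule exI[of _ 0]) simp

lemma pcong_sym: "pcong T M f g \<Longrightarrow> pcong T M g f"
proof -
  assume "pcong T M f g"
  then obtain h k where "f - g = T * h + smult M k" unfolding pcong_def by blast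
  hence "g - f = T * (-h) + smult M (-k)" by (simp add: algebra_simps)
  thus ?thesis unfolding pcong_def by blast
qed

lemma pcong_add: "pcong T M f g \<Longrightarrow> pcong T M f' g' \<Longrightarrow> pcong T M (f + f') (g + g')"
proof -
  assume "pcong T M f g" "pcong T M f' g'"
  then obtain h k h' k' where "f - g = T * h + smult M k" "f' - g' = T * h' + smult M k'"
    unfolding pcong_def by blast
  hence "(f + f') - (g + g') = T * (h + h') + smult M (k + k')"
    by (simp add: algebra_simps smult_add_right)
  thus ?thesis unfolding pcong_def by blast
qed

lemma pcong_uminus: "pcong T M f g \<Longrightarrow> pcong T M (- f) (- g)"
  using pcong_sym[of T M f g] unfolding pcong_def by (simp add: algebra_simps)

lemma pcong_diff: "pcong T M f g \<Longrightarrow> pcong T M f' g' \<Longrightarrow> pcong T M (f - f') (g - g')"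
  using pcong_add[of T M f g "-f'" "-g'"] pcong_uminus by simp

lemma pcong_trans [trans]: "pcong T M f g \<Longrightarrow> pcong T M g h \<Longrightarrow> pcong T M f h"
  using pcong_add[of T M f g g h] unfolding pcong_def by (simp add: algebra_simps)

lemma pcong_mult_left: "pcong T M f g \<Longrightarrow> pcong T M (c * f) (c * g)"
proof -
  assume "pcong T M f g"
  then obtain h k where "f - g = T * h + smult M k" unfolding pcong_def by blast
  hence "c * (f - g) = c * (T * h + smult M k)" by simp
  hence "c * f - c * g = T * (c * h) + smult M (c * k)" by (simp add: algebra_simps)
  thus ?thesis unfolding pcong_def by blast
qed

lemma pcong_mult: "pcong T M f g \<Longrightarrow> pcong T M f' g' \<Longrightarrow> pcong T M (f * f') (g * g')"
  using pcong_trans[of T M "f * f'" "f * g'" "g * g'"] pcong_mult_left[of T M f' g' f]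
    pcong_mult_left[of T M f g g'] by (simp add: mult.commute)

lemma pcong_power: "pcong T M f g \<Longrightarrow> pcong T M (f ^ n) (g ^ n)"
  by (induction n) (auto intro: pcong_mult)

lemma pcong_sum: "(\<And>i. i \<in> A \<Longrightarrow> pcong T M (f i) (g i)) \<Longrightarrow> pcong T M (sum f A) (sum g A)"
  by (induction A rule: infinite_finite_induct) (auto intro: pcong_add)

lemma pcong_prod: "(\<And>i. i \<in> A \<Longrightarrow> pcong T M (f i) (g i)) \<Longrightarrow> pcong T M (prod f A) (prod g A)"
  by (induction A rule: infinite_finite_induct) (auto intro: pcong_mult)

lemma pcong_dvd_modulus: "pcong T M f g \<Longrightarrow> N dvd M \<Longrightarrow> pcong T N f g"
  unfolding pcong_def by (elim exE dvdE) (metis smult_smult)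

lemma pcong_smult: "pcong T M f g \<Longrightarrow> pcong T (c * M) (smult c f) (smult c g)"
proof -
  assume "pcong T M f g"
  then obtain h k where "f - g = T * h + smult M k" unfolding pcong_def by blast
  hence "smult c (f - g) = T * smult c h + smult (c * M) k"
    by (simp add: smult_add_right)
  hence "smult c f - smult c g = T * smult c h + smult (c * M) k"
    by (simp only: smult_diff_right)
  thus ?thesis unfolding pcong_def by blast
qed

lemma pcong_smult_same: "pcong T M f g \<Longrightarrow> pcong T M (smult c f) (smult c g)"
  using pcong_smult[of T M f g c] pcong_dvd_modulus by fastforce

lemma pcong_diff_iff: "pcong T M (f - g) 0 \<longleftrightarrow> pcong T M f g"
  by (simp add: pcong_def)

lemma pcong_mult_self [simp]: "pcong T M (T * f) 0"
  unfolding pcong_def by (rule exI[of _ f], rule exI[of _ 0]) simp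

lemma pcong_smult_self [simp]: "pcong T M (smult M f) 0"
  unfolding pcong_def by (rule exI[of _ 0], rule exI[of _ f]) simp

lemma pcong_smult_dvd: "M dvd c \<Longrightarrow> pcong T M (smult c f) 0"
  using pcong_smult_self[of T c f] pcong_dvd_modulus by blast

lemma pcong_0_iff_dvd: "pcong T 0 f g \<longleftrightarrow> T dvd f - g"
  by (auto simp: pcong_def dvd_def)

lemma monic_division:
  fixes T f :: "int poly"
  assumes "lead_coeff T = 1"
  obtains h r where "f = T * h + r" "r = 0 \<or> degree r < degree T"
proof -
  obtain h r where hr: "pseudo_divmod f T = (h, r)" by (cases "pseudo_divmod f T")
  have T0: "T \<noteq> 0" using assms by (metis coeff_0 zero_neq_one)
  have "f = T * h + r" using pseudo_divmod(1)[OF T0 hr] unfolding assms by simp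
  thus thesis using that pseudo_divmod(2)[OF T0 hr] by blast
qed

lemma monic_dvd_small_degree:
  fixes T f :: "int poly"
  assumes "lead_coeff T = 1" "T dvd f" "degree f < degree T"
  shows "f = 0"
proof (rule ccontr)
  assume "f \<noteq> 0"
  from dvd_imp_degree_le[OF assms(2) this] assms(3) show False by simp
qed

text \<open>For monic \<open>T\<close> the powers of X below \<open>degree T\<close> form a basis of
  Z[X]/(T), so a congruence between reduced representatives can be read off coefficientwise.\<close>

lemma pcong_coeff:
  assumes T: "lead_coeff T = 1" and f: "degree f < degree T" and c: "pcong T M f 0"
  shows "M dvd coeff f i"
proof -
  obtain h k where hk: "f = T * h + smult M k" using c by (auto simp: pcong_def)
  obtain h' r where r: "k = T * h' + r" "r = 0 \<or> degree r < degree T"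
    using monic_division[OF T] .
  have dr: "degree r < degree T" using r(2) f by (cases "r = 0") auto
  have eq: "f - smult M r = T * (h + smult M h')" using hk r(1) by (simp add: algebra_simps smult_add_right)
  have "degree (f - smult M r) < degree T"
    by (rule le_less_trans[OF degree_diff_le_max]) (use f dr degree_smult_le[of M r] in auto)
  hence "f - smult M r = 0" by (rule monic_dvd_small_degree[OF T, rotated]) (simp add: eq)
  thus ?thesis by simp
qed

text \<open>Z[X]/(T) is torsion-free for monic \<open>T\<close>, so a factor common to the element
  and the modulus can be removed.\<close>

lemma pcong_smult_cancel:
  assumes T: "lead_coeff T = 1" and c: "c \<noteq> 0" and *: "pcong T (c * M) (smult c f) 0"
  shows "pcong T M f 0"
proof -
  obtain h k where hk: "smult c f = T * h + smult (c * M) k" using * by (auto simp: pcong_def)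
  hence "smult c (f - smult M k) = T * h" by (simp add: smult_diff_right)
  hence "T dvd smult c (f - smult M k)" by simp
  hence "T dvd f - smult M k" using dvd_monic[OF T _ c] by blast
  then obtain h' where "f - smult M k = T * h'" by (rule dvdE)
  hence "f - 0 = T * h' + smult M k" by (simp add: algebra_simps)
  thus ?thesis unfolding pcong_def by blast
qed

text \<open>Every coefficient of the reduced difference is divisible by all powers of
  \<open>q\<close>, hence zero: the exponent |c| suffices for a coefficient c, because n <
  q^n.\<close>

lemma pcong_all_powers:
  assumes T: "lead_coeff T = 1" and q: "(q::int) > 1" and *: "\<And>j. pcong T (q ^ j) f g"
    and deg: "degree T > 0"
  shows "pcong T 0 f g"
proof -
  obtain h r where r: "f - g = T * h + r" "r = 0 \<or> degree r < degree T"
    using monic_division[OF T] .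
  have dr: "degree r < degree T" using r(2) deg by (cases "r = 0") auto
  have "r = 0"
  proof (rule poly_eqI)
    fix i
    have "q ^ j dvd coeff r i" for j
    proof (rule pcong_coeff[OF T dr])
      have "r = (f - g) - T * h" using r(1) by simp
      thus "pcong T (q ^ j) r 0"
        using pcong_diff[OF pcong_diff_iff[THEN iffD2, OF *[of j]] pcong_mult_self[of T "q ^ j" h]] by simp
    qed
    hence "q ^ (nat \<bar>coeff r i\<bar>) dvd coeff r i" .
    moreover have "\<bar>coeff r i\<bar> < q ^ (nat \<bar>coeff r i\<bar>)"
    proof -
      have "int n < q ^ n" for n
      proof -
        have "n < 2 ^ n" by (rule less_exp)
        hence "int n < 2 ^ n" by (metis of_nat_less_iff of_nat_numeral of_nat_power)
        also have "\<dots> \<le> q ^ n" using q by (intro power_mono) auto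
        finally show ?thesis .
      qed
      from this[of "nat \<bar>coeff r i\<bar>"] show ?thesis by simp
    qed
    ultimately show "coeff r i = coeff 0 i"
      using dvd_imp_le_int[of "coeff r i" "q ^ nat \<bar>coeff r i\<bar>"] q by (cases "coeff r i = 0") auto
  qed
  thus ?thesis using r(1) by (simp add: pcong_0_iff_dvd)
qed

section \<open>Binomial expansions, integer exponents and first-order terms\<close>

lemma binomial_three_terms:
  fixes y :: "'a :: comm_ring_1"
  obtains R where "(1 + y) ^ n = 1 + of_nat n * y + of_nat (n choose 2) * y ^ 2 + y ^ 3 * R"
proof -
  have "\<exists>R. (1 + y) ^ n = 1 + of_nat n * y + of_nat (n choose 2) * y ^ 2 + y ^ 3 * R"
  proof (induction n)
    case 0
    show ?case by (rule exI[of _ 0]) (simp add: numeral_2_eq_2)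
  next
    case (Suc n)
    then obtain R where R: "(1 + y) ^ n = 1 + of_nat n * y + of_nat (n choose 2) * y ^ 2 + y ^ 3 * R" by blast
    have c: "Suc n choose 2 = n + (n choose 2)" by (simp add: numeral_2_eq_2)
    show ?case unfolding power_Suc R c
      by (rule exI[of _ "R + of_nat (n choose 2) + y * R"])
         (simp add: algebra_simps power2_eq_square power3_eq_cube)
  qed
  thus ?thesis using that by blast
qed

lemma prime_dvd_choose_two:
  assumes "prime q" "odd q"
  shows "q dvd (q choose 2)"
proof -
  obtain k where k: "q = 2 * k + 1" using assms(2) by (rule oddE)
  have "q choose 2 = q * k" by (simp add: choose_two k)
  thus ?thesis by simp
qed

text \<open>The second argument stands for the inverse of the first, so this is an integer power
  written with natural exponents, at least one of which is 0.\<close>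

definition ipow :: "int poly \<Rightarrow> int poly \<Rightarrow> int \<Rightarrow> int poly" where
  "ipow f g n = f ^ nat n * g ^ nat (- n)"

lemma ipow_repr:
  assumes fg: "pcong T 0 (f * g) 1"
  shows "pcong T 0 (f ^ a * g ^ b) (ipow f g (int a - int b))"
proof -
  have one: "pcong T 0 ((f * g) ^ c) 1" for c using pcong_power[OF fg, of c] by simp
  show ?thesis
  proof (cases "a \<ge> b")
    case True
    then obtain c where c: "a = c + b" by (metis le_add_diff_inverse2)
    have "f ^ a * g ^ b = f ^ c * (f * g) ^ b" by (simp add: c power_add power_mult_distrib ac_simps)
    thus ?thesis using pcong_mult_left[OF one[of b], of "f ^ c"] by (simp add: ipow_def c)
  next
    case False
    then obtain c where c: "b = c + a" by (metis le_add_diff_inverse2 nat_le_linear)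
    have "f ^ a * g ^ b = g ^ c * (f * g) ^ a" by (simp add: c power_add power_mult_distrib ac_simps)
    thus ?thesis using pcong_mult_left[OF one[of a], of "g ^ c"] by (simp add: ipow_def c)
  qed
qed

lemma ipow_of_nat [simp]: "ipow f g (int n) = f ^ n" by (simp add: ipow_def)

lemma ipow_power:
  assumes fg: "pcong T 0 (f * g) 1"
  shows "pcong T 0 (ipow f g n ^ c) (ipow f g (int c * n))"
proof -
  have "ipow f g n ^ c = f ^ (c * nat n) * g ^ (c * nat (- n))"
    by (simp add: ipow_def power_mult_distrib power_mult[symmetric] mult.commute)
  moreover have "int (c * nat n) - int (c * nat (- n)) = int c * n"
    by (cases "n \<ge> 0") auto
  ultimately show ?thesis using ipow_repr[OF fg, of "c * nat n" "c * nat (- n)"] by simp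
qed

lemma ipow_uminus: "ipow f g (- n) = ipow g f n"
  by (simp add: ipow_def mult.commute)

lemma ipow_swap: "pcong T 0 (f * g) 1 \<Longrightarrow> pcong T 0 (ipow f g n * ipow g f n) 1"
proof -
  assume fg: "pcong T 0 (f * g) 1"
  have "ipow f g n * ipow g f n = f ^ (nat n + nat (- n)) * g ^ (nat n + nat (-n))"
    by (simp add: ipow_def power_add ac_simps)
  also have "\<dots> = (f * g) ^ (nat n + nat (-n))" by (simp add: power_mult_distrib)
  finally show ?thesis using pcong_power[OF fg, of "nat n + nat (-n)"] by simp
qed

text \<open>As \<open>M\<close> divides \<open>c * c\<close>, the product of the two first-order
  terms vanishes. So \<open>s\<close> behaves as a logarithm of 1 + c s.\<close>

lemma pcong_linear_mult:
  assumes "pcong T M a (1 + smult c s)" "pcong T M b (1 + smult c t)" "M dvd c * c"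
  shows "pcong T M (a * b) (1 + smult c (s + t))"
proof -
  have "pcong T M (a * b) ((1 + smult c s) * (1 + smult c t))" using assms(1,2) by (rule pcong_mult)
  also have "(1 + smult c s) * (1 + smult c t) = 1 + smult c (s + t) + smult (c * c) (s * t)"
    by (simp add: algebra_simps smult_add_right)
  also have "pcong T M \<dots> (1 + smult c (s + t) + 0)"
    by (intro pcong_add pcong_refl pcong_smult_dvd assms(3))
  finally show ?thesis by simp
qed

lemma pcong_linear_power:
  assumes "pcong T M a (1 + smult c s)" "M dvd c * c"
  shows "pcong T M (a ^ n) (1 + smult c (smult (int n) s))"
proof (induction n)
  case (Suc n)
  have "pcong T M (a * a ^ n) (1 + smult c (s + smult (int n) s))"
    by (rule pcong_linear_mult[OF assms(1) Suc assms(2)])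
  moreover have "s + smult (int n) s = smult (int (Suc n)) s"
    by (simp add: smult_add_left)
  ultimately show ?case by simp
qed simp

lemma pcong_linear_inverse:
  assumes "pcong T M a (1 + smult c s)" "M dvd c * c" "pcong T 0 (a * b) 1"
  shows "pcong T M b (1 + smult c (- s))"
proof -
  have ab: "pcong T M (a * b) 1" using assms(3) pcong_dvd_modulus by blast
  have "pcong T M (a * (1 + smult c (- s))) (1 + smult c (s + - s))"
    by (rule pcong_linear_mult[OF assms(1) pcong_refl assms(2)])
  hence "pcong T M (b * (a * (1 + smult c (- s)))) b" using pcong_mult_left[of T M _ 1 b] by simp
  moreover have "pcong T M ((a * b) * (1 + smult c (- s))) (1 * (1 + smult c (- s)))"
    by (intro pcong_mult ab pcong_refl)
  ultimately show ?thesis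
    using pcong_trans[OF pcong_sym[of T M "b * (a * (1 + smult c (- s)))" b]] by (simp add: mult.assoc mult.left_commute)
qed

lemma pcong_linear_ipow:
  assumes "pcong T M f (1 + smult c t)" "M dvd c * c" "pcong T 0 (f * g) 1"
  shows "pcong T M (ipow f g n) (1 + smult c (smult n t))"
proof -
  note inv = pcong_linear_inverse[OF assms]
  have "pcong T M (f ^ nat n * g ^ nat (- n)) (1 + smult c (smult (int (nat n)) t + smult (int (nat (- n))) (- t)))"
    by (intro pcong_linear_mult pcong_linear_power assms inv)
  moreover have "smult (int (nat n)) t + smult (int (nat (- n))) (- t) = smult n t"
    by (cases "n \<ge> 0") auto
  ultimately show ?thesis by (simp add: ipow_def)
qed

lemma pcong_linear_prod:
  assumes "finite A" "\<And>i. i \<in> A \<Longrightarrow> pcong T M (f i) (1 + smult c (t i))" "M dvd c * c"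
  shows "pcong T M (prod f A) (1 + smult c (sum t A))"
  using assms(1,2) by (induction A rule: finite_induct) (auto intro: pcong_linear_mult assms(3))

text \<open>In the expansion of (1 + q^j Y)^q the quadratic term is divisible by q^(2j + 1), since
  an odd prime q divides \<open>q choose 2\<close>, and the later terms by q^(3j). For j >= 1 both
  exponents are at least j + 2: a q-th power multiplies the logarithm by q and gains one step of
  precision.\<close>

lemma pcong_power_prime:
  assumes q: "prime q" "odd q" and j: "j \<ge> 1"
    and X: "pcong T (int q ^ (j + 1)) X (1 + smult (int q ^ j) h)"
  shows "pcong T (int q ^ (j + 2)) (X ^ q) (1 + smult (int q ^ (j + 1)) h)"
proof -
  obtain u k where uk: "X - (1 + smult (int q ^ j) h) = T * u + smult (int q ^ (j + 1)) k"
    using X unfolding pcong_def by blast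
  \<comment> \<open>The error of the hypothesis is absorbed into \<open>Y\<close>, so that X = 1 +
    q^j Y holds modulo \<open>T\<close> alone.\<close>
  define Y where "Y = h + smult (int q) k"
  define c where "c = int q ^ j"
  have "pcong T (int q ^ (j + 2)) X (1 + smult c Y)"
    unfolding pcong_def
    by (rule exI[of _ u], rule exI[of _ 0])
       (use uk in \<open>simp add: Y_def c_def algebra_simps smult_add_right\<close>)
  hence "pcong T (int q ^ (j + 2)) (X ^ q) ((1 + smult c Y) ^ q)" by (rule pcong_power)
  also obtain R where "(1 + smult c Y) ^ q = 1 + of_nat q * smult c Y + of_nat (q choose 2) * (smult c Y) ^ 2 + (smult c Y) ^ 3 * R"
    using binomial_three_terms .
  hence "(1 + smult c Y) ^ q = 1 + smult (int q * c) Y + smult (int (q choose 2) * c ^ 2) (Y ^ 2) + smult (c ^ 3) (Y ^ 3 * R)"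
    by (simp add: smult_power of_nat_poly mult.commute)
  also have "pcong T (int q ^ (j + 2)) \<dots> (1 + smult (int q ^ (j + 1)) h + 0 + 0)"
  proof (intro pcong_add pcong_refl pcong_smult_dvd)
    show "pcong T (int q ^ (j + 2)) (smult (int q * c) Y) (smult (int q ^ (j + 1)) h)"
      unfolding pcong_def
      by (rule exI[of _ 0], rule exI[of _ k]) (simp add: Y_def c_def smult_add_right ac_simps)
    have "int q dvd int (q choose 2)" using prime_dvd_choose_two[OF q] by simp
    moreover have "int q ^ (j + 1) dvd c ^ 2" unfolding c_def power_mult[symmetric] using j by (intro le_imp_power_dvd) auto
    ultimately have "int q * int q ^ (j + 1) dvd int (q choose 2) * c ^ 2" by (rule mult_dvd_mono)
    thus "int q ^ (j + 2) dvd int (q choose 2) * c ^ 2" by simp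
    show "int q ^ (j + 2) dvd c ^ 3" unfolding c_def power_mult[symmetric] using j by (intro le_imp_power_dvd) auto
  qed
  finally show ?thesis by simp
qed

lemma pcong_power_prime_power:
  assumes q: "prime q" "odd q" and X: "pcong T (int q ^ 2) X (1 + smult (int q) h)"
  shows "pcong T (int q ^ (j + 2)) (X ^ (q ^ j)) (1 + smult (int q ^ (j + 1)) h)"
proof (induction j)
  case 0
  thus ?case using X by (simp add: power2_eq_square)
next
  case (Suc j)
  have "pcong T (int q ^ (Suc j + 2)) ((X ^ (q ^ j)) ^ q) (1 + smult (int q ^ (Suc j + 1)) h)"
    using pcong_power_prime[OF q, of "Suc j" T "X ^ (q ^ j)" h] Suc by simp
  thus ?case by (simp add: power_mult[symmetric] mult.commute)
qed

text \<open>Successive approximation: if X = 1 + q^j k modulo q^(j + 1), then X^q = 1 and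
  \<open>pcong_power_prime\<close> force q | k. For q = 2 the element -1 would be a
  counterexample.\<close>

lemma pcong_root_of_unity:
  assumes T: "lead_coeff T = 1" "degree T > 0" and q: "prime q" "odd q"
    and X: "pcong T (int q) X 1" and Xq: "pcong T 0 (X ^ q) 1"
  shows "pcong T 0 X 1"
proof (rule pcong_all_powers[OF T(1) _ _ T(2)])
  show "int q > 1" using prime_gt_1_nat[OF q(1)] by simp
  have q0: "int q ^ n \<noteq> 0" for n using prime_gt_0_nat[OF q(1)] by simp
  have *: "pcong T (int q ^ Suc j) X 1" for j
  proof (induction j)
    case 0
    thus ?case using X by simp
  next
    case (Suc j)
    obtain u k where uk: "X - 1 = T * u + smult (int q ^ Suc j) k" using Suc unfolding pcong_def by blast
    have Xk: "pcong T (int q ^ (Suc j + 1)) X (1 + smult (int q ^ Suc j) k)"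
      unfolding pcong_def by (rule exI[of _ u], rule exI[of _ 0]) (use uk in \<open>simp add: algebra_simps\<close>)
    have "pcong T (int q ^ (Suc j + 2)) (X ^ q) (1 + smult (int q ^ (Suc j + 1)) k)"
      by (rule pcong_power_prime[OF q _ Xk]) simp
    moreover have "pcong T (int q ^ (Suc j + 2)) (X ^ q) 1" using Xq pcong_dvd_modulus by blast
    ultimately have "pcong T (int q ^ (Suc j + 2)) (1 + smult (int q ^ (Suc j + 1)) k - 1) (1 - 1)"
      by (intro pcong_diff pcong_refl) (rule pcong_trans[OF pcong_sym])
    hence "pcong T (int q ^ (Suc j + 1) * int q) (smult (int q ^ (Suc j + 1)) k) 0" by (simp add: mult.commute mult.left_commute)
    hence "pcong T (int q) k 0" by (rule pcong_smult_cancel[OF T(1) q0])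
    hence "pcong T (int q ^ Suc j * int q) (smult (int q ^ Suc j) k) (smult (int q ^ Suc j) 0)" by (rule pcong_smult)
    hence k0: "pcong T (int q ^ (Suc j + 1)) (smult (int q ^ Suc j) k) 0" by (simp add: mult.commute)
    have "pcong T (int q ^ (Suc j + 1)) X (1 + 0)"
      using Xk pcong_add[OF pcong_refl k0] by (rule pcong_trans)
    thus ?case by simp
  qed
  show "pcong T (int q ^ j) X 1" for j
    by (rule pcong_dvd_modulus[OF *[of j]]) simp
qed

section \<open>Multiplicative relations and \<open>q\<close>-adic independence\<close>

lemma pcong_inverse_one:
  assumes "pcong T 0 (f * g) 1" "pcong T M f 1"
  shows "pcong T M g 1"
proof -
  have "pcong T M (g * f) (g * 1)" by (rule pcong_mult_left[OF assms(2)])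
  moreover have "pcong T M (f * g) 1" using assms(1) pcong_dvd_modulus by blast
  ultimately show ?thesis using pcong_trans[OF pcong_sym, of T M "g * f" g 1] by (simp add: mult.commute)
qed

lemma pcong_ipow_one:
  assumes "pcong T 0 (f * g) 1" "pcong T M f 1"
  shows "pcong T M (ipow f g n) 1"
  unfolding ipow_def
  using pcong_mult[OF pcong_power[OF assms(2), of "nat n"] pcong_power[OF pcong_inverse_one[OF assms], of "nat (- n)"]]
  by simp

lemma ipow_prod_power:
  assumes "\<And>i. i \<in> I \<Longrightarrow> pcong T 0 (f i * g i) 1"
  shows "pcong T 0 ((\<Prod>i\<in>I. ipow (f i) (g i) (n i)) ^ c) (\<Prod>i\<in>I. ipow (f i) (g i) (int c * n i))"
  unfolding prod_power_distrib by (intro pcong_prod ipow_power assms)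

text \<open>If q divides all exponents, the relation says X^q = 1 for a product X congruent to 1
  modulo q, so X = 1 already, with exponents divided by q. The sum of their absolute values drops,
  so this ends at a relation with some exponent not divisible by q.\<close>

lemma primitive_relation:
  fixes q :: nat and n :: "'i \<Rightarrow> int"
  assumes T: "lead_coeff T = 1" "degree T > 0" and q: "prime q" "odd q" and I: "finite I"
    and fg: "\<And>i. i \<in> I \<Longrightarrow> pcong T 0 (f i * g i) 1"
    and f1: "\<And>i. i \<in> I \<Longrightarrow> pcong T (int q) (f i) 1"
    and "\<exists>i\<in>I. n i \<noteq> 0" "pcong T 0 (\<Prod>i\<in>I. ipow (f i) (g i) (n i)) 1"
  shows "\<exists>n. (\<exists>i\<in>I. \<not> int q dvd n i) \<and> pcong T 0 (\<Prod>i\<in>I. ipow (f i) (g i) (n i)) 1"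
  using assms(8,9)
proof (induction "\<Sum>i\<in>I. nat \<bar>n i\<bar>" arbitrary: n rule: less_induct)
  case less
  show ?case
  proof (cases "\<exists>i\<in>I. \<not> int q dvd n i")
    case True
    thus ?thesis using less.prems by blast
  next
    case False
    define n' where "n' i = n i div int q" for i
    have n': "n i = int q * n' i" if "i \<in> I" for i using False that by (auto simp: n'_def)
    have q1: "int q > 1" using prime_gt_1_nat[OF q(1)] by simp
    let ?X = "\<Prod>i\<in>I. ipow (f i) (g i) (n' i)"
    have "pcong T 0 (?X ^ q) (\<Prod>i\<in>I. ipow (f i) (g i) (int q * n' i))"
      by (rule ipow_prod_power[OF fg])
    also have "(\<Prod>i\<in>I. ipow (f i) (g i) (int q * n' i)) = (\<Prod>i\<in>I. ipow (f i) (g i) (n i))"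
      by (intro prod.cong) (auto simp: n')
    also note less.prems(2)
    finally have Xq: "pcong T 0 (?X ^ q) 1" .
    have "pcong T (int q) ?X (\<Prod>i\<in>I. 1)"
      by (intro pcong_prod pcong_ipow_one fg f1)
    hence rel: "pcong T 0 ?X 1" by (intro pcong_root_of_unity[OF T q _ Xq]) simp
    obtain k where k: "k \<in> I" "n k \<noteq> 0" using less.prems(1) by blast
    have k': "n' k \<noteq> 0" using k n' by auto
    have le: "nat \<bar>n' i\<bar> \<le> nat \<bar>n i\<bar>" if "i \<in> I" for i
    proof -
      have "1 * \<bar>n' i\<bar> \<le> int q * \<bar>n' i\<bar>" using q1 by (intro mult_right_mono) auto
      thus ?thesis using n'[OF that] by (simp add: abs_mult)
    qed
    have "1 * \<bar>n' k\<bar> < int q * \<bar>n' k\<bar>" using q1 k' by (intro mult_strict_right_mono) auto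
    hence "nat \<bar>n' k\<bar> < nat \<bar>n k\<bar>" using n'[OF k(1)] by (simp add: abs_mult)
    hence "(\<Sum>i\<in>I. nat \<bar>n' i\<bar>) < (\<Sum>i\<in>I. nat \<bar>n i\<bar>)"
      using k(1) le by (intro sum_strict_mono_ex1 I) auto
    from less.hyps[OF this _ rel] k k' show ?thesis by blast
  qed
qed

lemma linear_relation:
  fixes q :: nat and n :: "'i \<Rightarrow> int"
  assumes T: "lead_coeff T = 1" and q: "q > 0" and I: "finite I"
    and fg: "\<And>i. i \<in> I \<Longrightarrow> pcong T 0 (f i * g i) 1"
    and ft: "\<And>i. i \<in> I \<Longrightarrow> pcong T (int q ^ 2) (f i) (1 + smult (int q) (t i))"
    and rel: "pcong T 0 (\<Prod>i\<in>I. ipow (f i) (g i) (n i)) 1"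
  shows "pcong T (int q) (\<Sum>i\<in>I. smult (n i) (t i)) 0"
proof -
  have d: "int q ^ 2 dvd int q * int q" by (simp add: power2_eq_square)
  have "pcong T (int q ^ 2) (\<Prod>i\<in>I. ipow (f i) (g i) (n i)) (1 + smult (int q) (\<Sum>i\<in>I. smult (n i) (t i)))"
    by (intro pcong_linear_prod I pcong_linear_ipow ft fg d)
  moreover have "pcong T (int q ^ 2) (\<Prod>i\<in>I. ipow (f i) (g i) (n i)) 1"
    using rel pcong_dvd_modulus by blast
  ultimately have "pcong T (int q ^ 2) (1 + smult (int q) (\<Sum>i\<in>I. smult (n i) (t i))) 1"
    by (rule pcong_trans[OF pcong_sym])
  from pcong_diff[OF this pcong_refl[of T "int q ^ 2" 1]]
  have "pcong T (int q * int q) (smult (int q) (\<Sum>i\<in>I. smult (n i) (t i))) 0"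
    by (simp add: power2_eq_square)
  thus ?thesis by (rule pcong_smult_cancel[OF T, rotated]) (use q in simp)
qed

lemma pcong_linear_imp_one:
  assumes "pcong T (int q ^ 2) f (1 + smult (int q) t)"
  shows "pcong T (int q) f 1"
proof -
  have "pcong T (int q) f (1 + smult (int q) t)"
    by (rule pcong_dvd_modulus[OF assms]) simp
  also have "pcong T (int q) (1 + smult (int q) t) (1 + 0)" by (intro pcong_add pcong_refl pcong_smult_self)
  finally show ?thesis by simp
qed

text \<open>The primitive relation is read to first order modulo q^2; independence of the logarithms
  would make q divide all of its exponents.\<close>

theorem no_relation_if_independent:
  fixes q :: nat and n :: "'i \<Rightarrow> int"
  assumes T: "lead_coeff T = 1" "degree T > 0" and q: "prime q" "odd q" and I: "finite I"
    and fg: "\<And>i. i \<in> I \<Longrightarrow> pcong T 0 (f i * g i) 1"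
    and ft: "\<And>i. i \<in> I \<Longrightarrow> pcong T (int q ^ 2) (f i) (1 + smult (int q) (t i))"
    and indep: "\<And>c. pcong T (int q) (\<Sum>i\<in>I. smult (c i) (t i)) 0 \<Longrightarrow> \<forall>i\<in>I. int q dvd c i"
    and rel: "\<exists>i\<in>I. n i \<noteq> 0" "pcong T 0 (\<Prod>i\<in>I. ipow (f i) (g i) (n i)) 1"
  shows False
proof -
  obtain n' where n': "\<exists>i\<in>I. \<not> int q dvd n' i" "pcong T 0 (\<Prod>i\<in>I. ipow (f i) (g i) (n' i)) 1"
    using primitive_relation[OF T q I fg pcong_linear_imp_one[OF ft] rel] by blast
  have "pcong T (int q) (\<Sum>i\<in>I. smult (n' i) (t i)) 0"
    by (rule linear_relation[OF T(1) prime_gt_0_nat[OF q(1)] I fg ft n'(2)])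
  thus False using indep n'(1) by blast
qed

text \<open>
  Skolem's argument: modulo high powers of \<open>q\<close> the relation expresses an element of the plane spanned
  by \<open>1\<close> and \<open>D\<close> through units whose logarithms are transversal to that plane, so all
  their exponents are highly divisible by \<open>q\<close>.
\<close>

theorem relation_with_plane:
  fixes q :: nat and n :: "'i \<Rightarrow> int"
  assumes T: "lead_coeff T = 1" "degree T > 0" and q: "prime q" "odd q" and J: "finite J" "z \<notin> J"
    and fg: "\<And>i. i \<in> insert z J \<Longrightarrow> pcong T 0 (f i * g i) 1"
    and ft: "\<And>i. i \<in> J \<Longrightarrow> pcong T (int q ^ 2) (f i) (1 + smult (int q) (t i))"
    and fz: "pcong T (int q ^ 2) (f z) (1 + smult (int q) ([:A0:] + smult B0 D))"
    and plane: "\<And>M A B. pcong T M ([:A:] + smult B D) 0 \<Longrightarrow> M dvd A \<and> M dvd B"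
    and indep: "\<And>A B c. pcong T (int q) ([:A:] + smult B D + (\<Sum>i\<in>J. smult (c i) (t i))) 0 \<Longrightarrow>
                  \<forall>i\<in>J. int q dvd c i"
    and rel: "\<exists>i\<in>insert z J. n i \<noteq> 0" "pcong T 0 (\<Prod>i\<in>insert z J. ipow (f i) (g i) (n i)) 1"
  obtains m where "\<not> q dvd m"
    "\<And>A B K. pcong T (int q ^ Suc K) (f z ^ m) ([:A:] + smult B D) \<Longrightarrow> int q ^ Suc K dvd B"
proof -
  let ?I = "insert z J"
  define t' where "t' i = (if i = z then [:A0:] + smult B0 D else t i)" for i
  have ft': "pcong T (int q ^ 2) (f i) (1 + smult (int q) (t' i))" if "i \<in> ?I" for i
    using ft fz J(2) that by (auto simp: t'_def)
  obtain n1 where n1: "\<exists>i\<in>?I. \<not> int q dvd n1 i" "pcong T 0 (\<Prod>i\<in>?I. ipow (f i) (g i) (n1 i)) 1"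
    using primitive_relation[OF T q _ fg pcong_linear_imp_one[OF ft'] rel] J by blast
  \<comment> \<open>Inverting the whole relation if necessary makes the exponent of
    \<open>f z\<close> nonnegative, so that it can be treated as an ordinary power.\<close>
  have "\<exists>n2. (\<exists>i\<in>?I. \<not> int q dvd n2 i) \<and> n2 z \<ge> 0 \<and> pcong T 0 (\<Prod>i\<in>?I. ipow (f i) (g i) (n2 i)) 1"
  proof (cases "n1 z \<ge> 0")
    case True
    thus ?thesis using n1 by blast
  next
    case False
    have "pcong T 0 (\<Prod>i\<in>?I. ipow (f i) (g i) (n1 i) * ipow (g i) (f i) (n1 i)) (\<Prod>i\<in>?I. 1)"
      by (intro pcong_prod ipow_swap fg)
    hence "pcong T 0 ((\<Prod>i\<in>?I. ipow (f i) (g i) (n1 i)) * (\<Prod>i\<in>?I. ipow (f i) (g i) (- n1 i))) 1"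
      by (simp add: prod.distrib ipow_uminus)
    hence "pcong T 0 (\<Prod>i\<in>?I. ipow (f i) (g i) (- n1 i)) 1"
      by (rule pcong_inverse_one[OF _ n1(2)])
    thus ?thesis using False n1(1) by (intro exI[of _ "\<lambda>i. - n1 i"]) auto
  qed
  then obtain n2 where n2: "\<exists>i\<in>?I. \<not> int q dvd n2 i" "n2 z \<ge> 0"
      "pcong T 0 (\<Prod>i\<in>?I. ipow (f i) (g i) (n2 i)) 1" by blast
  have q0: "q > 0" using prime_gt_0_nat[OF q(1)] .
  have "pcong T (int q) (\<Sum>i\<in>?I. smult (n2 i) (t' i)) 0"
    by (rule linear_relation[OF T(1) q0 _ fg ft' n2(3)]) (use J in auto)
  moreover have "(\<Sum>i\<in>?I. smult (n2 i) (t' i)) = [:n2 z * A0:] + smult (n2 z * B0) D + (\<Sum>i\<in>J. smult (n2 i) (t i))"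
  proof -
    have "(\<Sum>i\<in>J. smult (n2 i) (t' i)) = (\<Sum>i\<in>J. smult (n2 i) (t i))"
      using J(2) by (intro sum.cong) (auto simp: t'_def)
    thus ?thesis using J by (simp add: t'_def smult_add_right)
  qed
  ultimately have "\<forall>i\<in>J. int q dvd n2 i" using indep by simp
  \<comment> \<open>To first order the logarithm of \<open>f z\<close> lies in the plane, so
    transversality controls only the exponents in \<open>J\<close>; primitivity then leaves
    \<open>z\<close> as the index whose exponent is not divisible by q.\<close>
  hence qz: "\<not> int q dvd n2 z" using n2(1) by blast
  define m where "m = nat (n2 z)"
  have m: "n2 z = int m" using n2(2) by (simp add: m_def)
  have relm: "pcong T 0 (f z ^ m * (\<Prod>i\<in>J. ipow (f i) (g i) (n2 i))) 1"
    using n2(3) J by (simp add: m)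
  have fgJ: "\<And>i. i \<in> J \<Longrightarrow> pcong T 0 (f i * g i) 1" using fg by blast
  have d2: "int q ^ 2 dvd int q * int q" by (simp add: power2_eq_square)
  show thesis
  proof (rule that[of m])
    show "\<not> q dvd m" using qz by (simp add: m)
    fix A B :: int and K :: nat
    assume AB: "pcong T (int q ^ Suc K) (f z ^ m) ([:A:] + smult B D)"
    have step: "\<exists>S. (\<forall>i\<in>J. n2 i = int q ^ j * S i) \<and>
        pcong T (int q ^ (j + 2)) (\<Prod>i\<in>J. ipow (f i) (g i) (n2 i)) (1 + smult (int q ^ (j + 1)) (\<Sum>i\<in>J. smult (S i) (t i)))"
      if dvd: "\<forall>i\<in>J. int q ^ j dvd n2 i" for j
    proof -
      define S where "S i = n2 i div int q ^ j" for i
      have S: "n2 i = int q ^ j * S i" if "i \<in> J" for i using that dvd by (auto simp: S_def)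
      let ?W = "\<Prod>i\<in>J. ipow (f i) (g i) (S i)"
      have "pcong T (int q ^ 2) ?W (1 + smult (int q) (\<Sum>i\<in>J. smult (S i) (t i)))"
        by (intro pcong_linear_prod J pcong_linear_ipow ft fgJ d2)
      hence W: "pcong T (int q ^ (j + 2)) (?W ^ (q ^ j)) (1 + smult (int q ^ (j + 1)) (\<Sum>i\<in>J. smult (S i) (t i)))"
        by (rule pcong_power_prime_power[OF q])
      have "pcong T 0 (?W ^ (q ^ j)) (\<Prod>i\<in>J. ipow (f i) (g i) (int (q ^ j) * S i))"
        by (rule ipow_prod_power[OF fgJ])
      also have "(\<Prod>i\<in>J. ipow (f i) (g i) (int (q ^ j) * S i)) = (\<Prod>i\<in>J. ipow (f i) (g i) (n2 i))"
        by (intro prod.cong) (auto simp: S)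
      finally have "pcong T (int q ^ (j + 2)) (?W ^ (q ^ j)) (\<Prod>i\<in>J. ipow (f i) (g i) (n2 i))"
        using pcong_dvd_modulus by blast
      hence "pcong T (int q ^ (j + 2)) (\<Prod>i\<in>J. ipow (f i) (g i) (n2 i)) (1 + smult (int q ^ (j + 1)) (\<Sum>i\<in>J. smult (S i) (t i)))"
        using W by (rule pcong_trans[OF pcong_sym])
      thus ?thesis using S by blast
    qed
    have prod_one: "pcong T (int q ^ (j + 1)) (\<Prod>i\<in>J. ipow (f i) (g i) (n2 i)) 1"
      if dvd: "\<forall>i\<in>J. int q ^ j dvd n2 i" for j
    proof -
      obtain S where "pcong T (int q ^ (j + 2)) (\<Prod>i\<in>J. ipow (f i) (g i) (n2 i)) (1 + smult (int q ^ (j + 1)) (\<Sum>i\<in>J. smult (S i) (t i)))"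
        using step[OF dvd] by blast
      hence "pcong T (int q ^ (j + 1)) (\<Prod>i\<in>J. ipow (f i) (g i) (n2 i)) (1 + smult (int q ^ (j + 1)) (\<Sum>i\<in>J. smult (S i) (t i)))"
        by (rule pcong_dvd_modulus) simp
      also have "pcong T (int q ^ (j + 1)) (1 + smult (int q ^ (j + 1)) (\<Sum>i\<in>J. smult (S i) (t i))) (1 + 0)"
        by (intro pcong_add pcong_refl pcong_smult_self)
      finally show ?thesis by simp
    qed
    have AB1: "int q ^ (j + 1) dvd A - 1 \<and> int q ^ (j + 1) dvd B"
      if "j \<le> K" "\<forall>i\<in>J. int q ^ j dvd n2 i" for j
    proof -
      let ?M = "int q ^ (j + 1)"
      have "pcong T ?M (f z ^ m) ([:A:] + smult B D)"
        by (rule pcong_dvd_modulus[OF AB]) (use that(1) in \<open>intro le_imp_power_dvd, simp\<close>)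
      moreover have "pcong T ?M (f z ^ m * (\<Prod>i\<in>J. ipow (f i) (g i) (n2 i))) 1"
        using relm pcong_dvd_modulus by blast
      moreover have "pcong T ?M (f z ^ m * (\<Prod>i\<in>J. ipow (f i) (g i) (n2 i))) (f z ^ m * 1)"
        by (intro pcong_mult_left prod_one that(2))
      ultimately have "pcong T ?M ([:A:] + smult B D) 1"
        using pcong_trans[OF pcong_sym, of T ?M "f z ^ m" "[:A:] + smult B D" 1]
          pcong_trans[OF pcong_sym, of T ?M "f z ^ m * (\<Prod>i\<in>J. ipow (f i) (g i) (n2 i))" "f z ^ m * 1" 1] by simp
      from pcong_diff[OF this pcong_refl[of T ?M 1]]
      moreover have "[:A:] + smult B D - 1 = [:A - 1:] + smult B D" by (simp add: one_pCons)
      ultimately have "pcong T ?M ([:A - 1:] + smult B D) 0" by simp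
      thus ?thesis using plane by blast
    qed
    \<comment> \<open>Induction on the precision. If q^j divides the exponents in \<open>J\<close>,
      their product is 1 modulo q^(j + 1), so A - 1 and B are divisible by q^(j + 1). Comparing
      terms modulo q^(j + 2) leaves A' + B' D + (sum of S_i t_i) = 0 modulo q, and transversality
      yields one more factor q. The induction ends at \<open>K\<close> because \<open>AB\<close> is
      known only modulo q^(K + 1).\<close>
    have "j \<le> K \<Longrightarrow> \<forall>i\<in>J. int q ^ j dvd n2 i" for j
    proof (induction j)
      case (Suc j)
      hence IH: "\<forall>i\<in>J. int q ^ j dvd n2 i" by simp
      let ?M = "int q ^ (j + 2)"
      obtain S where S: "\<forall>i\<in>J. n2 i = int q ^ j * S i"
        "pcong T ?M (\<Prod>i\<in>J. ipow (f i) (g i) (n2 i)) (1 + smult (int q ^ (j + 1)) (\<Sum>i\<in>J. smult (S i) (t i)))"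
        using step[OF IH] by blast
      define s where "s = (\<Sum>i\<in>J. smult (S i) (t i))"
      obtain A' B' where A'B': "A - 1 = int q ^ (j + 1) * A'" "B = int q ^ (j + 1) * B'"
        using AB1[of j] IH Suc.prems unfolding dvd_def by auto
      have "pcong T ?M (f z ^ m) ([:A:] + smult B D)"
        by (rule pcong_dvd_modulus[OF AB]) (use Suc.prems in \<open>intro le_imp_power_dvd, simp\<close>)
      moreover have "[:A:] + smult B D = 1 + smult (int q ^ (j + 1)) ([:A':] + smult B' D)"
      proof -
        have "A = 1 + int q ^ (j + 1) * A'" using A'B'(1) by simp
        thus ?thesis using A'B'(2) by (simp add: smult_add_right one_pCons)
      qed
      ultimately have "pcong T ?M (f z ^ m) (1 + smult (int q ^ (j + 1)) ([:A':] + smult B' D))" by simp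
      hence "pcong T ?M (f z ^ m * (\<Prod>i\<in>J. ipow (f i) (g i) (n2 i))) (1 + smult (int q ^ (j + 1)) (([:A':] + smult B' D) + s))"
      proof (rule pcong_linear_mult)
        show "pcong T ?M (\<Prod>i\<in>J. ipow (f i) (g i) (n2 i)) (1 + smult (int q ^ (j + 1)) s)"
          using S(2) by (simp add: s_def)
        show "?M dvd int q ^ (j + 1) * int q ^ (j + 1)"
          unfolding power_add[symmetric] by (intro le_imp_power_dvd) simp
      qed
      moreover have "pcong T ?M (f z ^ m * (\<Prod>i\<in>J. ipow (f i) (g i) (n2 i))) 1"
        using relm pcong_dvd_modulus by blast
      ultimately have "pcong T ?M (1 + smult (int q ^ (j + 1)) (([:A':] + smult B' D) + s)) 1"
        by (rule pcong_trans[OF pcong_sym])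
      from pcong_diff[OF this pcong_refl[of T ?M 1]]
      have "pcong T (int q ^ (j + 1) * int q) (smult (int q ^ (j + 1)) (([:A':] + smult B' D) + s)) 0"
        by (simp add: mult.commute mult.left_commute)
      hence "pcong T (int q) (([:A':] + smult B' D) + s) 0"
        by (rule pcong_smult_cancel[OF T(1), rotated]) (use q0 in simp)
      hence "\<forall>i\<in>J. int q dvd S i" using indep unfolding s_def by blast
      thus ?case using S(1) by (simp add: mult.commute)
    qed simp
    from AB1[OF order_refl this[OF order_refl]] show "int q ^ Suc K dvd B" by simp
  qed
qed

section \<open>Norms and the rank of the unit group\<close>

abbreviation ev :: "int poly \<Rightarrow> complex \<Rightarrow> complex" where
  "ev f z \<equiv> poly (map_poly of_int f) z"

lemma ev_simps:
  "ev (f + g) z = ev f z + ev g z" "ev (f - g) z = ev f z - ev g z" "ev (f * g) z = ev f z * ev g z"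
  "ev (smult c f) z = of_int c * ev f z" "ev (f ^ n) z = ev f z ^ n" "ev 1 z = 1" "ev 0 z = 0"
  "ev (monom c n) z = of_int c * z ^ n"
  by (simp_all add: of_int_poly_hom.hom_add of_int_poly_hom.hom_minus of_int_poly_hom.hom_mult
      of_int_poly_hom.hom_power of_int_hom.map_poly_hom_smult map_poly_pCons poly_monom map_poly_monom)

lemma ev_const: "ev [:c:] z = of_int c"
  by (cases "c = 0") (auto simp: map_poly_pCons)

lemma ev_prod: "ev (prod f A) z = (\<Prod>i\<in>A. ev (f i) z)"
  by (induction A rule: infinite_finite_induct) (auto simp: ev_simps)

lemma ev_cnj: "ev f (cnj z) = cnj (ev f z)"
  by (induction f) (auto simp: map_poly_pCons)

lemma ev_altdef:
  assumes "degree f < d"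
  shows "ev f z = (\<Sum>i<d. of_int (coeff f i) * z ^ i)"
proof -
  have "ev f z = (\<Sum>i\<le>degree f. of_int (coeff f i) * z ^ i)"
    by (simp add: poly_altdef coeff_map_poly)
  also have "\<dots> = (\<Sum>i<d. of_int (coeff f i) * z ^ i)"
    using assms by (intro sum.mono_neutral_left) (auto simp: coeff_eq_0 not_less)
  finally show ?thesis .
qed

text \<open>Being d distinct zeros of a polynomial of degree d, the \<open>z k\<close> give all ring
  homomorphisms from Z[X]/(T) to the complex numbers.\<close>

locale int_poly_roots =
  fixes T :: "int poly" and d :: nat and z :: "nat \<Rightarrow> complex"
  assumes monic: "lead_coeff T = 1" and deg: "degree T = d" and d_pos: "d > 0"
    and root: "k < d \<Longrightarrow> ev T (z k) = 0"
    and distinct: "inj_on z {..<d}"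
begin

lemma ev_pcong: "pcong T 0 f g \<Longrightarrow> k < d \<Longrightarrow> ev f (z k) = ev g (z k)"
  using root unfolding pcong_def by (auto simp: ev_simps algebra_simps dest!: arg_cong[of "_ - _" _ "\<lambda>h. ev h (z k)"])

definition vander :: "complex mat" where
  "vander = mat d d (\<lambda>(k, i). z k ^ i)"

lemma vander_carrier [simp]: "vander \<in> carrier_mat d d"
  by (simp add: vander_def)

text \<open>A kernel vector would list the coefficients of a nonzero polynomial of degree below
  \<open>d\<close> with \<open>d\<close> zeros.\<close>

lemma det_vander: "det vander \<noteq> 0"
proof
  assume "det vander = 0"
  then obtain v where v: "v \<in> carrier_vec d" "v \<noteq> 0\<^sub>v d" "vander *\<^sub>v v = 0\<^sub>v d"
    using det_0_iff_vec_prod_zero[OF vander_carrier] by blast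
  define P where "P = (\<Sum>i<d. monom (v $ i) i)"
  have coeff_P: "coeff P i = (if i < d then v $ i else 0)" for i
    by (simp add: P_def coeff_sum)
  have "poly P (z k) = 0" if "k < d" for k
  proof -
    have "(vander *\<^sub>v v) $ k = (\<Sum>i<d. z k ^ i * v $ i)"
      using that v(1) by (simp add: vander_def scalar_prod_def lessThan_atLeast0)
    thus ?thesis using v(3) that by (simp add: P_def poly_sum poly_monom mult.commute)
  qed
  hence sub: "z ` {..<d} \<subseteq> {x. poly P x = 0}" by auto
  have "P = 0"
  proof (rule ccontr)
    assume P: "P \<noteq> 0"
    have "d = card (z ` {..<d})" using distinct by (simp add: card_image)
    also have "\<dots> \<le> card {x. poly P x = 0}" using sub P by (intro card_mono poly_roots_finite)
    also have "\<dots> \<le> degree P" using P by (rule card_poly_roots_bound)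
    also have "\<dots> < d" using d_pos coeff_P by (intro degree_lessI) auto
    finally show False by simp
  qed
  hence "v = 0\<^sub>v d" using v(1) coeff_P by (intro eq_vecI) (auto, metis coeff_0)
  thus False using v(2) by simp
qed

text \<open>N is the determinant of multiplication by \<open>f\<close> in the power basis. The
  Vandermonde matrix diagonalises this multiplication, with the values of \<open>f\<close> at the
  roots as eigenvalues. Column 0 of the adjugate gives the coefficients of \<open>g\<close>, since
  it solves f g = N.\<close>

lemma norm_and_inverse:
  obtains N g where "(\<Prod>k<d. ev f (z k)) = of_int N" "pcong T 0 (f * g) [:N:]"
proof -
  have "\<exists>r. degree r < d \<and> pcong T 0 (monom 1 j * f) r" for j
  proof -
    obtain h r where r: "monom 1 j * f = T * h + r" "r = 0 \<or> degree r < degree T"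
      using monic_division[OF monic] .
    have "degree r < d" using r(2) deg d_pos by (cases "r = 0") auto
    moreover have "pcong T 0 (monom 1 j * f) r" using r(1) by (simp add: pcong_0_iff_dvd)
    ultimately show ?thesis by blast
  qed
  then obtain r where r: "\<And>j. degree (r j) < d" "\<And>j. pcong T 0 (monom 1 j * f) (r j)" by metis
  define M where "M = mat d d (\<lambda>(i, j). coeff (r j) i)"
  have M: "M \<in> carrier_mat d d" by (simp add: M_def)
  define M' where "M' = map_mat (of_int :: int \<Rightarrow> complex) M"
  have M': "M' \<in> carrier_mat d d" using M by (simp add: M'_def)
  define G where "G = mat d d (\<lambda>(k, l). if k = l then ev f (z k) else 0)"
  have G: "G \<in> carrier_mat d d" by (simp add: G_def)
  have "vander * M' = G * vander"
  proof (rule eq_matI)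
    fix k j assume "k < dim_row (G * vander)" "j < dim_col (G * vander)"
    hence kj: "k < d" "j < d" by (auto simp: G_def vander_def)
    have "(vander * M') $$ (k, j) = (\<Sum>i<d. z k ^ i * of_int (coeff (r j) i))"
      using kj by (simp add: vander_def M'_def M_def scalar_prod_def lessThan_atLeast0)
    also have "\<dots> = ev (r j) (z k)" using ev_altdef[OF r(1)] by (simp add: mult.commute)
    also have "\<dots> = z k ^ j * ev f (z k)"
      using ev_pcong[OF r(2) kj(1), of j] by (simp add: ev_simps poly_monom)
    also have "\<dots> = (\<Sum>l<d. (if k = l then ev f (z k) else 0) * z l ^ j)"
      using kj by (simp add: if_distrib[of "\<lambda>x. x * _"] sum.delta cong: if_cong)
    also have "\<dots> = (G * vander) $$ (k, j)"
      using kj by (simp add: vander_def G_def scalar_prod_def lessThan_atLeast0)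
    finally show "(vander * M') $$ (k, j) = (G * vander) $$ (k, j)" .
  qed (auto simp: vander_def M'_def M_def G_def)
  hence "det (vander * M') = det (G * vander)" by simp
  hence "det vander * det M' = det G * det vander"
    using det_mult[OF vander_carrier M'] det_mult[OF G vander_carrier] by simp
  hence "det M' = det G" using det_vander by simp
  moreover have "det M' = of_int (det M)" unfolding M'_def by (simp add: of_int_hom.hom_det)
  moreover have "det G = (\<Prod>k<d. ev f (z k))"
  proof -
    have "det G = prod_list (diag_mat G)"
      by (rule det_upper_triangular[OF _ G]) (auto simp: G_def)
    also have "diag_mat G = map (\<lambda>k. ev f (z k)) [0..<d]" by (simp add: diag_mat_def G_def)
    also have "prod_list \<dots> = (\<Prod>k<d. ev f (z k))"
      using prod.distinct_set_conv_list[OF distinct_upt, of "\<lambda>k. ev f (z k)" 0 d]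
      by (simp add: lessThan_atLeast0)
    finally show ?thesis .
  qed
  ultimately have prod: "(\<Prod>k<d. ev f (z k)) = of_int (det M)" by simp
  define g where "g = (\<Sum>j<d. smult (adj_mat M $$ (j, 0)) (monom 1 j))"
  have "pcong T 0 (f * g) (\<Sum>j<d. smult (adj_mat M $$ (j, 0)) (r j))"
  proof -
    have "f * g = (\<Sum>j<d. smult (adj_mat M $$ (j, 0)) (monom 1 j * f))"
      by (simp add: g_def sum_distrib_left mult.commute)
    thus ?thesis by (simp add: pcong_sum pcong_smult_same r(2))
  qed
  also have "(\<Sum>j<d. smult (adj_mat M $$ (j, 0)) (r j)) = [:det M:]"
  proof (rule poly_eqI)
    fix i
    show "coeff (\<Sum>j<d. smult (adj_mat M $$ (j, 0)) (r j)) i = coeff [:det M:] i"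
    proof (cases "i < d")
      case True
      have "(\<Sum>j<d. coeff (r j) i * adj_mat M $$ (j, 0)) = (M * adj_mat M) $$ (i, 0)"
        using True d_pos adj_mat(1)[OF M] by (simp add: M_def scalar_prod_def lessThan_atLeast0)
      also have "\<dots> = (det M \<cdot>\<^sub>m 1\<^sub>m d) $$ (i, 0)" using adj_mat(2)[OF M] by simp
      also have "\<dots> = coeff [:det M:] i" using True d_pos by (cases i) auto
      finally show ?thesis by (simp add: coeff_sum mult.commute)
    next
      case False
      hence "coeff (r j) i = 0" for j using r(1)[of j] by (intro coeff_eq_0) simp
      moreover have "coeff [:det M:] i = 0" using False d_pos by (cases i) auto
      ultimately show ?thesis by (simp add: coeff_sum)
    qed
  qed
  finally show thesis using that prod by blast
qed

lemma unit_prod_norm: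
  assumes "pcong T 0 (f * g) 1"
  shows "(\<Prod>k<d. cmod (ev f (z k))) = 1"
proof -
  obtain N where N: "(\<Prod>k<d. ev f (z k)) = of_int N" by (rule norm_and_inverse)
  obtain N' where N': "(\<Prod>k<d. ev g (z k)) = of_int N'" by (rule norm_and_inverse)
  have "of_int (N * N') = (\<Prod>k<d. ev f (z k)) * (\<Prod>k<d. ev g (z k))" by (simp add: N N')
  also have "\<dots> = (\<Prod>k<d. ev (f * g) (z k))" by (simp only: ev_simps prod.distrib)
  also have "\<dots> = 1" using ev_pcong[OF assms] by (simp add: ev_simps)
  finally have "N * N' = 1" by (metis of_int_eq_1_iff)
  hence "\<bar>N\<bar> = 1" using abs_zmult_eq_1[of N N'] by simp
  moreover have "(\<Prod>k<d. cmod (ev f (z k))) = cmod (of_int N)" by (simp add: prod_norm N)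
  ultimately show ?thesis by simp
qed

text \<open>The inverse Vandermonde matrix recovers the coefficients from the values, so they are
  bounded integers.\<close>

lemma finite_bounded_values:
  "finite {f. degree f < d \<and> (\<forall>k<d. cmod (ev f (z k)) \<le> C)}"
proof -
  define K where "K i = (\<Sum>k<d. cmod (adj_mat vander $$ (i, k)) * \<bar>C\<bar>) / cmod (det vander)" for i
  define B where "B = \<lceil>\<Sum>i<d. K i\<rceil>"
  have K0: "K i \<ge> 0" for i unfolding K_def by (intro divide_nonneg_nonneg sum_nonneg) auto
  have bound: "\<bar>coeff f i\<bar> \<le> B" if f: "degree f < d" "\<forall>k<d. cmod (ev f (z k)) \<le> C" and i: "i < d" for f i
  proof -
    define v where "v = vec d (\<lambda>i. of_int (coeff f i) :: complex)"
    have v: "v \<in> carrier_vec d" by (simp add: v_def)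
    have Vv: "(vander *\<^sub>v v) $ k = ev f (z k)" if "k < d" for k
      using that ev_altdef[OF f(1), of "z k"]
      by (simp add: vander_def v_def scalar_prod_def lessThan_atLeast0 mult.commute)
    have "adj_mat vander *\<^sub>v (vander *\<^sub>v v) = (adj_mat vander * vander) *\<^sub>v v"
      by (rule assoc_mult_mat_vec[OF adj_mat(1)[OF vander_carrier] vander_carrier v, symmetric])
    also have "\<dots> = det vander \<cdot>\<^sub>v v"
      unfolding adj_mat(3)[OF vander_carrier] using v
      by (intro eq_vecI) (auto simp: scalar_prod_def if_distrib[of "\<lambda>x. _ * x"] if_distrib[of "\<lambda>x. x * _"] sum.delta cong: if_cong)
    finally have "(adj_mat vander *\<^sub>v (vander *\<^sub>v v)) $ i = det vander * of_int (coeff f i)"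
      using i by (simp add: v_def)
    moreover have "(adj_mat vander *\<^sub>v (vander *\<^sub>v v)) $ i = (\<Sum>k<d. adj_mat vander $$ (i, k) * ev f (z k))"
    proof -
      define w where "w = vander *\<^sub>v v"
      have dims: "dim_row (adj_mat vander) = d" "dim_col (adj_mat vander) = d" "dim_vec w = d"
        using adj_mat(1)[OF vander_carrier] by (auto simp: vander_def w_def)
      have "(adj_mat vander *\<^sub>v w) $ i = (\<Sum>k<d. adj_mat vander $$ (i, k) * w $ k)"
        using i dims by (simp add: scalar_prod_def lessThan_atLeast0)
      also have "\<dots> = (\<Sum>k<d. adj_mat vander $$ (i, k) * ev f (z k))"
        using Vv by (simp add: w_def)
      finally show ?thesis by (simp add: w_def)
    qed
    ultimately have "cmod (det vander) * \<bar>of_int (coeff f i)\<bar> = cmod (\<Sum>k<d. adj_mat vander $$ (i, k) * ev f (z k))"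
      by (metis norm_mult norm_of_int)
    also have "\<dots> \<le> (\<Sum>k<d. cmod (adj_mat vander $$ (i, k) * ev f (z k)))" by (rule norm_sum)
    also have "\<dots> \<le> (\<Sum>k<d. cmod (adj_mat vander $$ (i, k)) * \<bar>C\<bar>)"
      unfolding norm_mult using f(2) by (intro sum_mono mult_left_mono) (auto intro: order_trans)
    finally have "of_int \<bar>coeff f i\<bar> \<le> K i"
      unfolding K_def using det_vander by (simp add: field_simps)
    also have "\<dots> \<le> (\<Sum>i<d. K i)" using i K0 by (intro member_le_sum) auto
    also have "\<dots> \<le> of_int B" by (simp add: B_def)
    finally show ?thesis by simp
  qed
  have "f \<in> Poly ` {xs. set xs \<subseteq> {-B..B} \<and> length xs = d}"
    if f: "degree f < d" "\<forall>k<d. cmod (ev f (z k)) \<le> C" for f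
  proof -
    have "f = Poly (map (coeff f) [0..<d])"
      by (rule poly_eqI) (use f(1) in \<open>auto simp: nth_default_def coeff_eq_0 not_less\<close>)
    moreover have "set (map (coeff f) [0..<d]) \<subseteq> {-B..B}"
      using bound[OF f] by (auto simp: abs_le_iff) force
    ultimately show ?thesis by (intro image_eqI[of _ _ "map (coeff f) [0..<d]"]) auto
  qed
  hence "{f. degree f < d \<and> (\<forall>k<d. cmod (ev f (z k)) \<le> C)} \<subseteq> Poly ` {xs. set xs \<subseteq> {-B..B} \<and> length xs = d}"
    by auto
  thus ?thesis by (rule finite_subset) (simp add: finite_lists_length_eq)
qed

end

text \<open>There are r + 1 unknowns and r equations; a zero row at index 0 makes the matrix square
  and singular. The value 2 serves the later rounding: distinct integer multiples of
  \<open>c i0\<close> differ by at least 2, so their roundings differ.\<close>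

lemma linear_dependence:
  fixes l :: "nat \<Rightarrow> nat \<Rightarrow> real"
  obtains c i0 where "i0 \<le> r" "\<bar>c i0\<bar> = 2" "\<And>k. k \<in> {1..r} \<Longrightarrow> (\<Sum>i\<le>r. c i * l i k) = 0"
proof -
  define A where "A = mat (Suc r) (Suc r) (\<lambda>(k, i). if k = 0 then 0 else l i k)"
  have A: "A \<in> carrier_mat (Suc r) (Suc r)" by (simp add: A_def)
  have "det A = 0"
    using laplace_expansion_row[OF A, of 0] by (simp add: A_def del: sum.lessThan_Suc)
  then obtain v where v: "v \<in> carrier_vec (Suc r)" "v \<noteq> 0\<^sub>v (Suc r)" "A *\<^sub>v v = 0\<^sub>v (Suc r)"
    using det_0_iff_vec_prod_zero[OF A] by blast
  obtain i0 where i0: "i0 \<le> r" "v $ i0 \<noteq> 0"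
  proof -
    have "\<exists>i<Suc r. v $ i \<noteq> 0" using v(1,2) by (metis carrier_vecD eq_vecI index_zero_vec)
    thus thesis using that by (auto simp: less_Suc_eq_le)
  qed
  define c where "c i = 2 * v $ i / \<bar>v $ i0\<bar>" for i
  have "(\<Sum>i\<le>r. c i * l i k) = 0" if "k \<in> {1..r}" for k
  proof -
    have "(A *\<^sub>v v) $ k = (\<Sum>i<Suc r. l i k * v $ i)"
      using that v(1) by (simp add: A_def scalar_prod_def lessThan_atLeast0 del: sum.lessThan_Suc sum.op_ivl_Suc)
    hence "(\<Sum>i<Suc r. l i k * v $ i) = 0" using v(3) that by simp
    moreover have "(\<Sum>i\<le>r. c i * l i k) = 2 / \<bar>v $ i0\<bar> * (\<Sum>i<Suc r. l i k * v $ i)"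
      unfolding sum_distrib_left lessThan_Suc_atMost by (intro sum.cong) (auto simp: c_def)
    ultimately show ?thesis by simp
  qed
  moreover have "\<bar>c i0\<bar> = 2" using i0(2) by (simp add: c_def abs_mult)
  ultimately show thesis using that i0(1) by blast
qed

text \<open>
  The upper bound in Dirichlet's unit theorem for a field with one real and \<open>r\<close> pairs of complex
  embeddings. A real linear dependence between the logarithm vectors, multiplied by \<open>q \<in> \<nat>\<close> and
  rounded, gives infinitely many products of bounded height.
\<close>

theorem (in int_poly_roots) units_dependent:
  assumes d: "d = 2 * r + 1" and conj: "\<And>k. k \<in> {1..r} \<Longrightarrow> z (d - k) = cnj (z k)"
    and fg: "\<And>i. i \<le> r \<Longrightarrow> pcong T 0 (f i * g i) 1"
  obtains n where "\<exists>i\<le>r. n i \<noteq> (0::int)" "pcong T 0 (\<Prod>i\<le>r. ipow (f i) (g i) (n i)) 1"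
proof -
  define l where "l i k = ln (cmod (ev (f i) (z k)))" for i k
  have fg1: "ev (f i) (z k) * ev (g i) (z k) = 1" if "i \<le> r" "k < d" for i k
    using ev_pcong[OF fg that(2)] that(1) by (simp add: ev_simps)
  have nz: "ev (f i) (z k) \<noteq> 0" if "i \<le> r" "k < d" for i k
    using fg1[OF that] by auto
  have lg: "ln (cmod (ev (g i) (z k))) = - l i k" if "i \<le> r" "k < d" for i k
  proof -
    have "ev (g i) (z k) = inverse (ev (f i) (z k))" using fg1[OF that] by (metis inverse_unique)
    thus ?thesis using nz[OF that] by (simp add: l_def norm_inverse ln_inverse)
  qed
  have gnz: "ev (g i) (z k) \<noteq> 0" if "i \<le> r" "k < d" for i k
    using fg1[OF that] by auto
  define P where "P n = (\<Prod>i\<le>r. ipow (f i) (g i) (n i))" for n :: "nat \<Rightarrow> int"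
  have Pnz: "ev (P n) (z k) \<noteq> 0" if "k < d" for n k
    using nz gnz that by (simp add: P_def ev_prod ipow_def ev_simps)
  have lnP: "ln (cmod (ev (P n) (z k))) = (\<Sum>i\<le>r. of_int (n i) * l i k)" if k: "k < d" for n k
  proof -
    have "ln (cmod (ev (P n) (z k))) = ln (\<Prod>i\<le>r. cmod (ev (ipow (f i) (g i) (n i)) (z k)))"
      by (simp add: P_def ev_prod prod_norm)
    also have "\<dots> = (\<Sum>i\<le>r. ln (cmod (ev (ipow (f i) (g i) (n i)) (z k))))"
      using nz gnz k by (intro ln_prod) (auto simp: ipow_def ev_simps)
    also have "\<dots> = (\<Sum>i\<le>r. of_int (n i) * l i k)"
    proof (intro sum.cong refl)
      fix i assume "i \<in> {..r}"
      hence i: "i \<le> r" by simp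
      have "ln (cmod (ev (ipow (f i) (g i) (n i)) (z k))) =
          real (nat (n i)) * l i k + real (nat (- n i)) * (- l i k)"
        using nz[OF i k] gnz[OF i k] lg[OF i k]
        by (simp add: ipow_def ev_simps norm_mult norm_power ln_mult ln_realpow l_def)
      also have "\<dots> = of_int (n i) * l i k" by (cases "n i \<ge> 0") auto
      finally show "ln (cmod (ev (ipow (f i) (g i) (n i)) (z k))) = of_int (n i) * l i k" .
    qed
    finally show ?thesis .
  qed
  have l_conj: "l i (d - k) = l i k" if "k \<in> {1..r}" for i k
    using conj[OF that] by (simp add: l_def ev_cnj)
  have l_sum: "(\<Sum>k<d. l i k) = 0" if "i \<le> r" for i
  proof -
    have "(\<Sum>k<d. l i k) = ln (\<Prod>k<d. cmod (ev (f i) (z k)))"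
      unfolding l_def using nz[OF that] by (intro ln_prod[symmetric]) auto
    thus ?thesis using unit_prod_norm[OF fg[OF that]] by simp
  qed
  obtain c i0 where c: "i0 \<le> r" "\<bar>c i0\<bar> = 2" "\<And>k. k \<in> {1..r} \<Longrightarrow> (\<Sum>i\<le>r. c i * l i k) = 0"
    using linear_dependence[of r l] by blast
  define n where "n q i = round (real q * c i)" for q i
  define C where "C = (\<Sum>k<d. \<Sum>i\<le>r. \<bar>l i k\<bar>)"
  have C0: "C \<ge> 0" unfolding C_def by (intro sum_nonneg) auto
  have bound1: "\<bar>\<Sum>i\<le>r. of_int (n q i) * l i k\<bar> \<le> C" if k: "k \<in> {1..r}" for q k
  proof -
    have "(\<Sum>i\<le>r. of_int (n q i) * l i k) = (\<Sum>i\<le>r. (of_int (n q i) - real q * c i) * l i k)"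
      using c(3)[OF k] by (simp add: algebra_simps sum_subtractf sum_distrib_left[symmetric])
    also have "\<bar>\<dots>\<bar> \<le> (\<Sum>i\<le>r. \<bar>(of_int (n q i) - real q * c i) * l i k\<bar>)" by (rule sum_abs)
    also have "\<dots> \<le> (\<Sum>i\<le>r. 1 * \<bar>l i k\<bar>)"
      unfolding abs_mult
    proof (intro sum_mono mult_right_mono)
      fix i
      show "\<bar>of_int (n q i) - real q * c i\<bar> \<le> 1"
        using of_int_round_abs_le[of "real q * c i"] by (simp add: n_def)
    qed auto
    also have "\<dots> = (\<Sum>i\<le>r. \<bar>l i k\<bar>)" by simp
    also have "\<dots> \<le> C" unfolding C_def using k d by (intro member_le_sum[of k]) (auto intro: sum_nonneg)
    finally show ?thesis .
  qed
  have bound2: "\<bar>\<Sum>i\<le>r. of_int (n q i) * l i k\<bar> \<le> C" if "k \<in> {1..<d}" for q k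
  proof (cases "k \<le> r")
    case True
    thus ?thesis using bound1 that by auto
  next
    case False
    hence dk: "d - k \<in> {1..r}" "d - (d - k) = k" using that d by auto
    thus ?thesis using bound1[OF dk(1)] l_conj[OF dk(1)] by simp
  qed
  have bound: "cmod (ev (P (n q)) (z k)) \<le> exp (real d * C)" if k: "k < d" for q k
  proof -
    let ?L = "\<lambda>k. \<Sum>i\<le>r. of_int (n q i) * l i k"
    have "?L k \<le> real d * C"
    proof (cases "k = 0")
      case False
      hence "?L k \<le> 1 * C" using bound2[of k q] k by auto
      also have "\<dots> \<le> real d * C" using d_pos C0 by (intro mult_right_mono) auto
      finally show ?thesis .
    next
      case True
      \<comment> \<open>The dependence gives no bound at the real embedding. There the bound follows
        from the others, because the logarithms of a unit sum to zero over all embeddings.\<close>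
      have "(\<Sum>k<d. ?L k) = (\<Sum>i\<le>r. of_int (n q i) * (\<Sum>k<d. l i k))"
        unfolding sum_distrib_left by (rule sum.swap)
      also have "\<dots> = 0" using l_sum by simp
      also have "(\<Sum>k<d. ?L k) = ?L 0 + (\<Sum>k\<in>{1..<d}. ?L k)"
        using d_pos by (simp add: lessThan_atLeast0 sum.atLeast_Suc_lessThan)
      finally have "?L 0 = - (\<Sum>k\<in>{1..<d}. ?L k)" by simp
      also have "\<dots> \<le> \<bar>\<Sum>k\<in>{1..<d}. ?L k\<bar>" by simp
      also have "\<dots> \<le> (\<Sum>k\<in>{1..<d}. \<bar>?L k\<bar>)" by (rule sum_abs)
      also have "\<dots> \<le> (\<Sum>k\<in>{1..<d}. C)" by (intro sum_mono bound2)
      also have "\<dots> \<le> real d * C" using C0 by (simp add: mult_right_mono)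
      finally show ?thesis using True by simp
    qed
    hence "ln (cmod (ev (P (n q)) (z k))) \<le> real d * C" using lnP[OF k] by simp
    thus ?thesis using Pnz[OF k] by (metis exp_le_cancel_iff exp_ln zero_less_norm_iff)
  qed
  have "\<exists>R. degree R < d \<and> pcong T 0 (P (n q)) R" for q
  proof -
    obtain h R where R: "P (n q) = T * h + R" "R = 0 \<or> degree R < degree T"
      using monic_division[OF monic] .
    have "degree R < d" using R(2) deg d_pos by (cases "R = 0") auto
    moreover have "pcong T 0 (P (n q)) R" using R(1) by (simp add: pcong_0_iff_dvd)
    ultimately show ?thesis by blast
  qed
  then obtain R where R: "\<And>q. degree (R q) < d" "\<And>q. pcong T 0 (P (n q)) (R q)" by metis
  have "range R \<subseteq> {f. degree f < d \<and> (\<forall>k<d. cmod (ev f (z k)) \<le> exp (real d * C))}"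
    using R(1) ev_pcong[OF R(2)] bound by (auto simp flip: ev_pcong[OF R(2)])
  hence "finite (range R)" using finite_bounded_values finite_subset by blast
  \<comment> \<open>Pigeonhole: infinitely many multiples give only finitely many reduced
    representatives. Two products coincide, and their quotient is the relation.\<close>
  hence "\<not> inj R" using finite_imageD infinite_UNIV_nat by blast
  then obtain q1 q2 where q: "q1 \<noteq> q2" "R q1 = R q2" by (auto simp: inj_def)
  have P12: "pcong T 0 (P (n q1)) (P (n q2))"
    using pcong_trans[OF R(2)[of q1] pcong_sym[OF R(2)[of q2, folded q(2)]]] .
  define m where "m i = n q1 i - n q2 i" for i
  have "m i0 \<noteq> 0"
  proof
    assume "m i0 = 0"
    hence "n q1 i0 = n q2 i0" by (simp add: m_def)
    hence "\<bar>real q1 * c i0 - real q2 * c i0\<bar> \<le> 1"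
      using of_int_round_abs_le[of "real q1 * c i0"] of_int_round_abs_le[of "real q2 * c i0"]
      unfolding n_def by linarith
    hence "\<bar>real q1 - real q2\<bar> * 2 \<le> 1" using c(2) by (metis abs_mult left_diff_distrib)
    moreover have "\<bar>real q1 - real q2\<bar> \<ge> 1"
      using q(1) by (cases q1 q2 rule: linorder_cases) (auto simp: abs_if)
    moreover have False if "D * 2 \<le> 1" "D \<ge> 1" for D :: real using that by simp
    ultimately show False by blast
  qed
  moreover have "pcong T 0 (\<Prod>i\<le>r. ipow (f i) (g i) (m i)) 1"
  proof -
    have add: "pcong T 0 (ipow (f i) (g i) a * ipow (f i) (g i) b) (ipow (f i) (g i) (a + b))" if "i \<le> r" for i a b
    proof -
      have "ipow (f i) (g i) a * ipow (f i) (g i) b = f i ^ (nat a + nat b) * g i ^ (nat (- a) + nat (- b))"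
        by (simp add: ipow_def power_add ac_simps)
      moreover have "int (nat a + nat b) - int (nat (- a) + nat (- b)) = a + b" by simp
      ultimately show ?thesis using ipow_repr[OF fg[OF that], of "nat a + nat b" "nat (- a) + nat (- b)"] by simp
    qed
    have "pcong T 0 (P (n q1) * P (\<lambda>i. - n q2 i)) (\<Prod>i\<le>r. ipow (f i) (g i) (m i))"
      unfolding P_def prod.distrib[symmetric] m_def using add[of _ "n q1 _" "- n q2 _"] by (intro pcong_prod) auto
    moreover have "pcong T 0 (P (n q1) * P (\<lambda>i. - n q2 i)) (P (n q2) * P (\<lambda>i. - n q2 i))"
      by (rule pcong_mult[OF P12 pcong_refl])
    moreover have "pcong T 0 (P (n q2) * P (\<lambda>i. - n q2 i)) 1"
    proof -
      have "pcong T 0 (P (n q2) * P (\<lambda>i. - n q2 i)) (\<Prod>i\<le>r. 1)"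
        unfolding P_def prod.distrib[symmetric] ipow_uminus using fg by (intro pcong_prod ipow_swap) auto
      thus ?thesis by simp
    qed
    ultimately show ?thesis using pcong_trans pcong_sym by blast
  qed
  ultimately show thesis using that c(1) by blast
qed

section \<open>The field of the Lucas polynomial\<close>

fun lucasp :: "nat \<Rightarrow> int poly" where
  "lucasp 0 = [:2:]"
| "lucasp (Suc 0) = [:0, 1:]"
| "lucasp (Suc (Suc n)) = [:0, 1:] * lucasp (Suc n) + lucasp n"

text \<open>Fibonacci polynomials. For x x' = -1 the powers of x and of x' both satisfy this
  recurrence at X = x + x', with the initial values of (x^n - x'^n)/(x - x'); \<open>lucasp\<close>
  has those of x^n + x'^n.\<close>

fun fibp :: "nat \<Rightarrow> int poly" where
  "fibp 0 = 0"
| "fibp (Suc 0) = 1"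
| "fibp (Suc (Suc n)) = [:0, 1:] * fibp (Suc n) + fibp n"

definition lpoly :: "nat \<Rightarrow> int poly" where "lpoly p = lucasp p - [:2:]"

lemma ev_X_mult: "ev ([:0, 1:] * f) z = z * ev f z"
  by (simp add: ev_simps of_int_hom.map_poly_pCons_hom)

lemma ev_lucasp:
  assumes "x * x' = -1"
  shows "ev (lucasp n) (x + x') = x ^ n + x' ^ n"
proof (induction n rule: lucasp.induct)
  case (3 n)
  have "ev (lucasp (Suc (Suc n))) (x + x') = (x + x') * (x ^ Suc n + x' ^ Suc n) + (x ^ n + x' ^ n)"
    using 3 by (simp only: lucasp.simps ev_simps(1) ev_X_mult)
  also have "\<dots> = x ^ Suc (Suc n) + x' ^ Suc (Suc n) + (x * x' + 1) * (x ^ n + x' ^ n)"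
    by (simp add: algebra_simps)
  finally show ?case by (simp add: assms)
qed (auto simp: map_poly_pCons)

lemma ev_fibp:
  assumes "x * x' = -1"
  shows "(x - x') * ev (fibp n) (x + x') = x ^ n - x' ^ n"
proof (induction n rule: fibp.induct)
  case (3 n)
  have "(x - x') * ev (fibp (Suc (Suc n))) (x + x') =
      (x + x') * ((x - x') * ev (fibp (Suc n)) (x + x')) + (x - x') * ev (fibp n) (x + x')"
    by (simp only: fibp.simps ev_simps(1) ev_X_mult) (simp add: algebra_simps)
  also have "\<dots> = (x + x') * (x ^ Suc n - x' ^ Suc n) + (x ^ n - x' ^ n)"
    using 3 by simp
  also have "\<dots> = x ^ Suc (Suc n) - x' ^ Suc (Suc n) + (x * x' + 1) * (x ^ n - x' ^ n)"
    by (simp add: algebra_simps)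
  finally show ?case by (simp add: assms)
qed (auto simp: ev_simps)

lemma degree_lucasp: "degree (lucasp n) = n \<and> (n > 0 \<longrightarrow> lead_coeff (lucasp n) = 1)"
proof (induction n rule: lucasp.induct)
  case (3 n)
  have d: "degree ([:0, 1:] * lucasp (Suc n)) = Suc (Suc n)"
    using 3(1) by (subst degree_mult_eq) auto
  have lt: "degree (lucasp n) < degree ([:0, 1:] * lucasp (Suc n))" using 3 d by simp
  have "degree (lucasp (Suc (Suc n))) = Suc (Suc n)"
    using degree_add_eq_left[OF lt] d by simp
  moreover have "lead_coeff (lucasp (Suc (Suc n))) = lead_coeff ([:0, 1:] * lucasp (Suc n))"
    using lead_coeff_add_le[OF lt] by (simp add: add.commute)
  moreover have "lead_coeff ([:0, 1:] * lucasp (Suc n)) = 1"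
  proof -
    have "lead_coeff (lucasp (Suc n)) = 1" using 3(1) by blast
    thus ?thesis by (simp only: lead_coeff_mult) simp
  qed
  ultimately show ?case by simp
qed auto

lemma lpoly_monic:
  assumes "p > 0"
  shows "degree (lpoly p) = p" "lead_coeff (lpoly p) = 1"
proof -
  have "degree [:2::int:] < degree (lucasp p)" using degree_lucasp[of p] assms by simp
  hence "degree (lucasp p + [:-2:]) = degree (lucasp p)" by (intro degree_add_eq_left) simp
  moreover have "lpoly p = lucasp p + [:-2:]" by (simp add: lpoly_def)
  ultimately show d: "degree (lpoly p) = p" using degree_lucasp by simp
  have "coeff (lucasp p) p = 1" using degree_lucasp[of p] assms by metis
  thus "lead_coeff (lpoly p) = 1" unfolding d using assms by (simp add: lpoly_def coeff_eq_0)
qed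

section \<open>The roots of the Lucas polynomial equation\<close>

definition unity_root :: "nat \<Rightarrow> nat \<Rightarrow> complex" where
  "unity_root p k = cis (2 * pi * real k / real p)"

lemma unity_root_power:
  assumes "p > 0"
  shows "unity_root p k ^ n = unity_root p ((n * k) mod p)"
proof -
  have "n * k = (n * k) mod p + p * ((n * k) div p)" by simp
  hence eq: "real (n * k) = real ((n * k) mod p) + real p * real ((n * k) div p)"
    by (metis of_nat_add of_nat_mult)
  have "unity_root p k ^ n = cis (2 * pi * real (n * k) / real p)"
    unfolding unity_root_def Complex.DeMoivre by (simp add: mult_ac)
  also have "2 * pi * real (n * k) / real p = 2 * pi * real ((n * k) mod p) / real p + 2 * pi * real ((n * k) div p)"
    unfolding eq using assms by (simp add: field_simps)
  also have "cis \<dots> = unity_root p ((n * k) mod p)"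
    by (simp add: unity_root_def cis_mult[symmetric] cis_multiple_2pi)
  finally show ?thesis .
qed

lemma inj_unity_root: "p > 0 \<Longrightarrow> inj_on (unity_root p) {..<p}"
  using Complex.bij_betw_roots_unity[of p] by (simp add: bij_betw_def unity_root_def[abs_def])

lemma unity_root_power_self: "p > 0 \<Longrightarrow> unity_root p k ^ p = 1"
  using unity_root_power[of p k p] by (simp add: unity_root_def[of p 0])

lemma prod_minus_unity_roots:
  assumes "p > 0"
  shows "(\<Prod>k<p. t - unity_root p k) = t ^ p - 1"
proof -
  define P where "P = (\<Prod>k<p. [:- unity_root p k, 1:])"
  define Q where "Q = monom (1::complex) p - 1"
  have degP: "degree P = p" by (simp add: P_def degree_prod_eq_sum_degree)
  have lcP: "lead_coeff P = 1" by (simp only: P_def lead_coeff_prod) simp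
  have degQ: "degree Q \<le> p" "coeff Q p = 1"
    using assms by (auto simp: Q_def intro!: degree_diff_le degree_monom_le)
  have "P - Q = 0"
  proof (rule ccontr)
    assume nz: "P - Q \<noteq> 0"
    have "coeff (P - Q) p = 0" using lcP degQ unfolding degP by simp
    moreover have "degree (P - Q) \<le> p" using degP degQ by (intro degree_diff_le) auto
    ultimately have lt: "degree (P - Q) < p"
      using nz by (metis le_neq_implies_less leading_coeff_0_iff)
    have "unity_root p ` {..<p} \<subseteq> {x. poly (P - Q) x = 0}"
    proof safe
      fix k assume "k < p"
      hence "poly P (unity_root p k) = 0" by (auto simp: P_def poly_prod)
      thus "poly (P - Q) (unity_root p k) = 0"
        by (simp add: Q_def poly_monom unity_root_power_self[OF assms])
    qed
    hence "card (unity_root p ` {..<p}) \<le> card {x. poly (P - Q) x = 0}"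
      using nz by (intro card_mono poly_roots_finite)
    also have "\<dots> \<le> degree (P - Q)" using nz by (rule card_poly_roots_bound)
    finally show False using lt inj_unity_root[OF assms] by (simp add: card_image)
  qed
  hence "poly P t = poly Q t" by simp
  thus ?thesis by (simp add: P_def Q_def poly_prod poly_monom)
qed

text \<open>Taking out the factor \<zeta>^(-r) leaves A \<zeta>^(2r) - B. As p does not divide 2r,
  multiplication by 2r permutes the residues modulo p, and for odd p the product of all p-th roots
  of unity is 1.\<close>

lemma prod_unity_root_form:
  assumes p: "prime p" "odd p" and r: "0 < r" "r < p"
  shows "(\<Prod>k<p. A * unity_root p k ^ r - B * inverse (unity_root p k) ^ r) = A ^ p - B ^ p"
proof -
  have p0: "p > 0" using prime_gt_0_nat[OF p(1)] .
  have nz: "unity_root p k \<noteq> 0" for k by (simp add: unity_root_def)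
  define w where "w = (\<Prod>k<p. unity_root p k)"
  have "w = 1"
  proof -
    have "(\<Prod>k<p. 0 - unity_root p k) = 0 ^ p - 1" by (rule prod_minus_unity_roots[OF p0])
    hence "(-1) ^ p * w = -1" using p0 by (simp add: w_def prod_uminus)
    thus ?thesis using p(2) by simp
  qed
  have nd: "\<not> p dvd 2 * r"
    using p r by (metis dvd_imp_le linorder_not_less prime_dvd_mult_iff primes_dvd_imp_eq two_is_prime_nat odd_numeral even_numeral)
  have "bij_betw (\<lambda>k. (2 * r * k) mod p) {..<p} {..<p}"
  proof -
    have "inj_on (\<lambda>k. (2 * r * k) mod p) {..<p}"
    proof (rule inj_onI)
      have *: "k = l" if "k < p" "l \<le> k" "(2 * r * k) mod p = (2 * r * l) mod p" for k l
      proof -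
        have "p dvd 2 * r * k - 2 * r * l" using that by (subst mod_eq_dvd_iff_nat[symmetric]) auto
        hence "p dvd 2 * r * (k - l)" by (simp add: diff_mult_distrib2)
        hence "p dvd k - l" using nd prime_dvd_mult_iff[OF p(1), of "2 * r"] by blast
        thus ?thesis using that by (metis dvd_imp_le diff_is_0_eq le_antisym less_imp_diff_less linorder_not_less zero_less_diff)
      qed
      fix k l assume "k \<in> {..<p}" "l \<in> {..<p}" "(2 * r * k) mod p = (2 * r * l) mod p"
      thus "k = l" using *[of k l] *[of l k] by (cases "l \<le> k") auto
    qed
    moreover have "(\<lambda>k. (2 * r * k) mod p) ` {..<p} \<subseteq> {..<p}" using p0 by auto
    ultimately show ?thesis by (simp add: bij_betw_def endo_inj_surj)
  qed
  hence perm: "(\<Prod>k<p. A * unity_root p ((2 * r * k) mod p) - B) = (\<Prod>k<p. A * unity_root p k - B)"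
    by (rule prod.reindex_bij_betw)
  have "(\<Prod>k<p. A * unity_root p k ^ r - B * inverse (unity_root p k) ^ r) =
      (\<Prod>k<p. inverse (unity_root p k) ^ r * (A * unity_root p k ^ (2 * r) - B))"
  proof (intro prod.cong refl)
    fix k
    have "unity_root p k ^ (2 * r) = unity_root p k ^ r * unity_root p k ^ r"
      by (simp add: mult_2 power_add)
    thus "A * unity_root p k ^ r - B * inverse (unity_root p k) ^ r =
        inverse (unity_root p k) ^ r * (A * unity_root p k ^ (2 * r) - B)"
      using nz[of k] by (simp add: field_simps power_inverse)
  qed
  also have "\<dots> = inverse w ^ r * (\<Prod>k<p. A * unity_root p k - B)"
    unfolding prod.distrib perm[symmetric]
    by (simp add: w_def unity_root_power[OF p0] prod_power_distrib prod_inversef[symmetric] o_def)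
  also have "\<dots> = (\<Prod>k<p. A * unity_root p k - B)" by (simp add: \<open>w = 1\<close>)
  also have "\<dots> = A ^ p - B ^ p"
  proof (cases "A = 0")
    case True
    thus ?thesis using p(2) p0 by (simp add: power_minus_odd)
  next
    case False
    have "(\<Prod>k<p. A * unity_root p k - B) = (\<Prod>k<p. (- A) * (B / A - unity_root p k))"
      using False by (intro prod.cong) (auto simp: field_simps)
    also have "\<dots> = (- A) ^ p * ((B / A) ^ p - 1)"
      by (simp only: prod.distrib prod_minus_unity_roots[OF p0] prod_constant card_lessThan)
    also have "\<dots> = A ^ p - B ^ p" using p(2) False by (simp add: power_divide field_simps)
    finally show ?thesis .
  qed
  finally show ?thesis .
qed

definition eta :: "nat \<Rightarrow> real" where "eta p = root p (1 + sqrt 2)"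

lemma eta_gt_1: "p > 0 \<Longrightarrow> eta p > 1"
  by (simp add: eta_def real_root_gt_1_iff)

lemma eta_power: "p > 0 \<Longrightarrow> eta p ^ p = 1 + sqrt 2"
  by (simp add: eta_def real_root_pow_pos2)

definition eroot :: "nat \<Rightarrow> nat \<Rightarrow> complex" where
  "eroot p k = of_real (eta p) * unity_root p k"

definition eroot' :: "nat \<Rightarrow> nat \<Rightarrow> complex" where
  "eroot' p k = - inverse (of_real (eta p)) * inverse (unity_root p k)"

definition lroot :: "nat \<Rightarrow> nat \<Rightarrow> complex" where
  "lroot p k = eroot p k + eroot' p k"

lemma eroot_mult: "p > 0 \<Longrightarrow> eroot p k * eroot' p k = -1"
  using eta_gt_1[of p] by (simp add: eroot_def eroot'_def unity_root_def field_simps)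

lemma eroot_power: "p > 0 \<Longrightarrow> eroot p k ^ p = 1 + of_real (sqrt 2)"
  by (simp add: eroot_def power_mult_distrib unity_root_power_self eta_power flip: of_real_power)

lemma eroot'_power:
  assumes "odd p"
  shows "eroot' p k ^ p = 1 - of_real (sqrt 2)"
proof -
  have p: "p > 0" using assms by (auto intro: Nat.gr0I)
  have "(eroot p k * eroot' p k) ^ p = (-1) ^ p" using eroot_mult[OF p] by simp
  hence "(1 + of_real (sqrt 2)) * eroot' p k ^ p = -1"
    using assms by (simp add: power_mult_distrib eroot_power[OF p])
  moreover have "(1 + of_real (sqrt 2)) * (1 - of_real (sqrt 2)) = (-1 :: complex)"
  proof -
    have "(of_real (sqrt 2) :: complex) * of_real (sqrt 2) = 2"
      unfolding of_real_mult[symmetric] by simp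
    thus ?thesis by (simp add: algebra_simps)
  qed
  moreover have "(1 + of_real (sqrt 2) :: complex) \<noteq> 0"
    using calculation(2) by auto
  ultimately show ?thesis by (metis mult_left_cancel)
qed

text \<open>For distinctness: x + x' = y + y' together with x x' = y y' = -1 gives (x - y)(x y + 1)
  = 0, and the second factor is nonzero because |x y| is the square of \<open>eta p\<close>, hence
  greater than 1.\<close>

lemma lroot_int_poly_roots:
  assumes p: "prime p" "odd p"
  shows "int_poly_roots (lpoly p) p (lroot p)"
proof
  have p0: "p > 0" using prime_gt_0_nat[OF p(1)] .
  show "lead_coeff (lpoly p) = 1" "degree (lpoly p) = p" "p > 0" using lpoly_monic p0 by auto
  show "ev (lpoly p) (lroot p k) = 0" for k
    using ev_lucasp[OF eroot_mult[OF p0, of k], of p] eroot_power[OF p0, of k] eroot'_power[OF p(2), of k]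
    by (simp add: lpoly_def lroot_def ev_simps ev_const del: of_int_poly_hom.hom_minus)
  show "inj_on (lroot p) {..<p}"
  proof (rule inj_onI)
    fix k l assume kl: "k \<in> {..<p}" "l \<in> {..<p}" "lroot p k = lroot p l"
    let ?x = "eroot p k" and ?x' = "eroot' p k" and ?y = "eroot p l" and ?y' = "eroot' p l"
    have "cmod (?x * ?y) = eta p * eta p"
      using eta_gt_1[OF p0] by (simp add: eroot_def norm_mult unity_root_def)
    moreover have "eta p * eta p > 1" using eta_gt_1[OF p0] by (simp add: less_1_mult)
    ultimately have ne: "?x * ?y + 1 \<noteq> 0" by (metis add_eq_0_iff2 less_irrefl norm_minus_cancel norm_one)
    have "(?x - ?y) * (?x * ?y + 1) = ?x * ?y * ((?x + ?x') - (?y + ?y'))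
          - ?y * (?x * ?x' + 1) + ?x * (?y * ?y' + 1)" by (simp add: algebra_simps)
    also have "\<dots> = 0" using kl(3) eroot_mult[OF p0] by (simp add: lroot_def)
    finally have "?x = ?y" using ne by simp
    hence "unity_root p k = unity_root p l" using eta_gt_1[OF p0] by (simp add: eroot_def)
    thus "k = l" using inj_unity_root[OF p0] kl by (auto dest: inj_onD)
  qed
qed

lemma lroot_cnj:
  assumes "0 < k" "k \<le> p"
  shows "lroot p (p - k) = cnj (lroot p k)"
proof -
  have "2 * pi * real (p - k) / real p = - (2 * pi * real k / real p) + 2 * pi * real 1"
    using assms by (simp add: of_nat_diff field_simps)
  hence "unity_root p (p - k) = cis (- (2 * pi * real k / real p)) * cis (2 * pi * real 1)"
    unfolding unity_root_def cis_mult by simp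
  hence "unity_root p (p - k) = cnj (unity_root p k)"
    by (simp add: unity_root_def cis_cnj)
  thus ?thesis by (simp add: lroot_def eroot_def eroot'_def)
qed

text \<open>The coefficient of b in the unit, namely sqrt 2 (\<eta>^r + \<eta>'^r)/(\<eta> -
  \<eta>'). It becomes a polynomial in \<tau> because \<eta>^p = 1 + sqrt 2 and \<eta> \<eta>' = -1
  replace sqrt 2 by powers with exponent p - r.\<close>

definition epoly :: "nat \<Rightarrow> nat \<Rightarrow> int poly" where
  "epoly p r = fibp r + smult ((-1) ^ r) (fibp (p - r))"

text \<open>Used with both square roots of 2, so that an equation in Z[sqrt 2] also yields its
  conjugate.\<close>

definition zemb :: "complex \<Rightarrow> zsqrt2 \<Rightarrow> complex" where
  "zemb s w = of_int (zre w) + of_int (zim w) * s"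

lemma zemb_mult: "s * s = 2 \<Longrightarrow> zemb s (v * w) = zemb s v * zemb s w"
proof -
  assume s: "s * s = 2"
  have "zemb s v * zemb s w = of_int (zre v * zre w) + of_int (zre v * zim w + zim v * zre w) * s + of_int (zim v * zim w) * (s * s)"
    by (simp add: zemb_def algebra_simps)
  thus ?thesis unfolding s by (simp add: zemb_def algebra_simps)
qed

lemma zemb_power: "s * s = 2 \<Longrightarrow> zemb s (w ^ n) = zemb s w ^ n"
  by (induction n) (auto simp: zemb_mult zemb_def[of _ 1])

text \<open>
  With \<open>\<eta>\<^sup>p = 1 + \<surd>2\<close>, the equation \<open>x + \<surd>2 = (1 + \<surd>2)\<^sup>r (a + b\<surd>2)\<^sup>p\<close> says that
  \<open>\<eta>\<^sup>r(a + b\<surd>2) - \<eta>'\<^sup>r(a - b\<surd>2)\<close> and \<open>\<eta> - \<eta>'\<close> have the same norm \<open>2\<surd>2\<close>; their quotient is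
  the polynomial below, evaluated at \<open>\<eta> + \<eta>'\<close>.
\<close>

lemma solution_gives_unit:
  assumes p: "prime p" "odd p" and r: "0 < r" "r < p"
    and eq: "ZS x 1 = fund_unit ^ r * ZS a b ^ p"
  obtains g where "pcong (lpoly p) 0 ((smult a (fibp r) + smult b (epoly p r)) * g) 1"
proof -
  interpret int_poly_roots "lpoly p" p "lroot p" by (rule lroot_int_poly_roots[OF p])
  let ?u = "smult a (fibp r) + smult b (epoly p r)"
  define s :: complex where "s = of_real (sqrt 2)"
  have s2: "s * s = 2" unfolding s_def of_real_mult[symmetric] by simp
  define \<alpha> \<alpha>' where "\<alpha> = of_int a + of_int b * s" and "\<alpha>' = of_int a - of_int b * s"
  have e1: "of_int x + s = (1 + s) ^ r * \<alpha> ^ p"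
    using arg_cong[OF eq, of "zemb s"] s2 by (simp add: zemb_mult zemb_power) (simp add: zemb_def \<alpha>_def)
  have e2: "of_int x - s = (1 - s) ^ r * \<alpha>' ^ p"
    using arg_cong[OF eq, of "zemb (- s)"] s2 by (simp add: zemb_mult zemb_power) (simp add: zemb_def \<alpha>'_def)
  have key: "(eroot p k - eroot' p k) * ev ?u (lroot p k) = eroot p k ^ r * \<alpha> - eroot' p k ^ r * \<alpha>'" for k
  proof -
    let ?x = "eroot p k" and ?x' = "eroot' p k"
    have xx: "?x * ?x' = -1" using eroot_mult d_pos by simp
    have F: "(?x - ?x') * ev (fibp n) (lroot p k) = ?x ^ n - ?x' ^ n" for n
      unfolding lroot_def by (rule ev_fibp[OF xx])
    have split: "w ^ p = w ^ (p - r) * w ^ r" for w :: complex using r by (simp flip: power_add)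
    have x1: "(-1) ^ r * ?x ^ (p - r) = (1 + s) * ?x' ^ r"
    proof -
      have "(1 + s) * ?x' ^ r = ?x ^ (p - r) * (?x * ?x') ^ r"
        using split[of ?x] eroot_power[OF d_pos, of k] by (simp add: s_def power_mult_distrib)
      thus ?thesis by (simp add: xx)
    qed
    have x2: "(-1) ^ r * ?x' ^ (p - r) = (1 - s) * ?x ^ r"
    proof -
      have "(1 - s) * ?x ^ r = ?x' ^ (p - r) * (?x * ?x') ^ r"
        using split[of ?x'] eroot'_power[OF p(2), of k] by (simp add: s_def power_mult_distrib)
      thus ?thesis by (simp add: xx)
    qed
    have "(?x - ?x') * ev ?u (lroot p k) =
      of_int a * ((?x - ?x') * ev (fibp r) (lroot p k)) + of_int b * ((?x - ?x') * ev (fibp r) (lroot p k) +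
      (-1) ^ r * ((?x - ?x') * ev (fibp (p - r)) (lroot p k)))"
      by (simp only: ev_simps epoly_def) (simp add: algebra_simps)
    also have "\<dots> = of_int a * (?x ^ r - ?x' ^ r) + of_int b * (?x ^ r - ?x' ^ r + ((-1) ^ r * ?x ^ (p - r) - (-1) ^ r * ?x' ^ (p - r)))"
      unfolding F by (simp add: algebra_simps)
    also have "\<dots> = ?x ^ r * \<alpha> - ?x' ^ r * \<alpha>'"
      unfolding x1 x2 by (simp add: \<alpha>_def \<alpha>'_def algebra_simps)
    finally show ?thesis .
  qed
  have prod: "(\<Prod>k<p. eroot p k ^ n * A - eroot' p k ^ n * B) = (1 + s) ^ n * A ^ p - (1 - s) ^ n * B ^ p"
    if n: "0 < n" "n < p" for n A B
  proof -
    define e where "e = (of_real (eta p) :: complex)"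
    have e: "e ^ p = 1 + s" using eta_power[OF d_pos] by (simp add: e_def s_def flip: of_real_power)
    have e': "(- inverse e) ^ p = 1 - s"
    proof -
      have "eroot' p 0 ^ p = 1 - s" using eroot'_power[OF p(2), of 0] by (simp add: s_def)
      thus ?thesis by (simp add: eroot'_def e_def unity_root_def)
    qed
    have "(\<Prod>k<p. eroot p k ^ n * A - eroot' p k ^ n * B) =
        (\<Prod>k<p. (e ^ n * A) * unity_root p k ^ n - ((- inverse e) ^ n * B) * inverse (unity_root p k) ^ n)"
      by (intro prod.cong refl) (simp only: eroot_def eroot'_def e_def power_mult_distrib ac_simps)
    also have "\<dots> = (e ^ n * A) ^ p - ((- inverse e) ^ n * B) ^ p"
      by (rule prod_unity_root_form[OF p n])
    also have "\<dots> = (e ^ p) ^ n * A ^ p - ((- inverse e) ^ p) ^ n * B ^ p"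
      by (simp add: power_mult_distrib power_mult[symmetric] mult.commute)
    finally show ?thesis by (simp only: e e')
  qed
  have "(\<Prod>k<p. eroot p k - eroot' p k) * (\<Prod>k<p. ev ?u (lroot p k)) = (\<Prod>k<p. eroot p k ^ r * \<alpha> - eroot' p k ^ r * \<alpha>')"
    unfolding prod.distrib[symmetric] key ..
  also have "\<dots> = (of_int x + s) - (of_int x - s)" unfolding prod[OF r] e1 e2 ..
  also have "\<dots> = 2 * s" by simp
  \<comment> \<open>The same product formula with exponent 1 and both coefficients 1, giving (1 + s)
    - (1 - s).\<close>
  also have "(\<Prod>k<p. eroot p k - eroot' p k) = 2 * s"
    using prod[of 1 1 1] prime_gt_1_nat[OF p(1)] by simp
  finally have "(\<Prod>k<p. ev ?u (lroot p k)) = 1" using s2 by auto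
  moreover obtain N g where "(\<Prod>k<p. ev ?u (lroot p k)) = of_int N" "pcong (lpoly p) 0 (?u * g) [:N:]"
    by (rule norm_and_inverse)
  ultimately have "pcong (lpoly p) 0 (?u * g) 1" by (simp add: one_pCons)
  thus thesis by (rule that)
qed

section \<open>Arithmetic on coefficient lists\<close>

fun addl :: "int list \<Rightarrow> int list \<Rightarrow> int list" where
  "addl (x # xs) (y # ys) = (x + y) # addl xs ys"
| "addl [] ys = ys"
| "addl xs [] = xs"

fun pmul :: "int list \<Rightarrow> int list \<Rightarrow> int list" where
  "pmul [] ys = []"
| "pmul (x # xs) ys = addl (map ((*) x) ys) (0 # pmul xs ys)"

text \<open>One Horner step: z + X ys is formed, and its top coefficient is removed through the
  relation X^p = -low modulo T, where \<open>low\<close> lists the coefficients below the leading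
  one. As \<open>x mod 0 = x\<close>, the modulus 0 turns the same code into exact
  arithmetic.\<close>

definition red_step :: "int \<Rightarrow> int list \<Rightarrow> int \<Rightarrow> int list \<Rightarrow> int list" where
  "red_step M low z ys = addl (z # butlast ys) (map ((*) (- (last ys mod M))) low)"

text \<open>Horner's scheme from the top coefficient downwards; the length of the third argument
  counts the reduction steps.\<close>

fun redl :: "int \<Rightarrow> int list \<Rightarrow> int list \<Rightarrow> int list \<Rightarrow> int list" where
  "redl M low (c # cs) (z # zs) = red_step M low z (redl M low cs zs)"
| "redl M low _ zs = zs"

definition mulT :: "int \<Rightarrow> int list \<Rightarrow> int list \<Rightarrow> int list \<Rightarrow> int list" where
  "mulT M low xs ys = map (\<lambda>x. x mod M) (redl M low (tl low) (pmul xs ys))"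

definition pow_step :: "int \<Rightarrow> int list \<Rightarrow> int list \<Rightarrow> bool \<Rightarrow> int list \<Rightarrow> int list" where
  "pow_step M low xs b s = (if b then mulT M low xs s else s)"

fun powT :: "int \<Rightarrow> int list \<Rightarrow> int list \<Rightarrow> bool list \<Rightarrow> int list \<Rightarrow> int list" where
  "powT M low xs [] acc = acc"
| "powT M low xs (b # bs) acc = powT M low xs bs (pow_step M low xs b (mulT M low acc acc))"

fun bits_val :: "bool list \<Rightarrow> nat \<Rightarrow> nat" where
  "bits_val [] n = n"
| "bits_val (b # bs) n = bits_val bs (if b then Suc (2 * n) else 2 * n)"

definition onel :: "int list \<Rightarrow> int list" where "onel low = 1 # map (\<lambda>_. 0) (tl low)"

definition dot :: "int list \<Rightarrow> int list \<Rightarrow> int" where "dot xs ys = sum_list (map2 (*) xs ys)"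

lemma Poly_addl [simp]: "Poly (addl xs ys) = Poly xs + Poly ys"
  by (induction xs ys rule: addl.induct) auto

lemma length_addl [simp]: "length (addl xs ys) = max (length xs) (length ys)"
  by (induction xs ys rule: addl.induct) auto

lemma Poly_map_mult [simp]: "Poly (map ((*) c) xs) = smult c (Poly xs)"
  by (induction xs) auto

lemma Poly_pmul [simp]: "Poly (pmul xs ys) = Poly xs * Poly ys"
  by (induction xs) auto

lemma length_pmul: "ys \<noteq> [] \<Longrightarrow> xs \<noteq> [] \<Longrightarrow> length (pmul xs ys) = length xs + length ys - 1"
proof (induction xs)
  case (Cons x xs)
  thus ?case by (cases xs; cases ys) auto
qed simp

lemma Poly_map_mod: "pcong T M (Poly (map (\<lambda>x. x mod M) xs)) (Poly xs)"
proof (induction xs)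
  case (Cons x xs)
  have "Poly (map (\<lambda>x. x mod M) (x # xs)) = [:x mod M:] + [:0, 1:] * Poly (map (\<lambda>x. x mod M) xs)"
    by simp
  also have "pcong T M \<dots> ([:x:] + [:0, 1:] * Poly xs)"
  proof (intro pcong_add pcong_mult_left Cons)
    have "M dvd x mod M - x" by (simp add: mod_eq_dvd_iff[symmetric])
    then obtain k where "x mod M - x = M * k" by (rule dvdE)
    hence "[:x mod M:] - [:x:] = smult M [:k:]" by simp
    thus "pcong T M [:x mod M:] [:x:]" unfolding pcong_def by (metis add_0 mult_zero_right)
  qed
  finally show ?case by simp
qed simp

context
  fixes T :: "int poly" and low :: "int list"
  assumes T: "T = monom 1 (length low) + Poly low" and low: "low \<noteq> []"
begin

lemma redl_correct:
  "length zs = length cs + length low \<Longrightarrow>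
     length (redl M low cs zs) = length low \<and> pcong T M (Poly (redl M low cs zs)) (Poly zs)"
proof (induction cs arbitrary: zs)
  case (Cons c cs)
  then obtain z zs' where zs: "zs = z # zs'" by (cases zs) auto
  define ys where "ys = redl M low cs zs'"
  have ys: "length ys = length low" "pcong T M (Poly ys) (Poly zs')"
    using Cons by (auto simp: zs ys_def)
  have ne: "ys \<noteq> []" using ys(1) low by auto
  define l where "l = last ys"
  obtain n where n: "length low = Suc n" using low by (cases low) auto
  have Pys: "Poly ys = Poly (butlast ys) + monom l n"
    using Poly_snoc[of "butlast ys" "last ys"] ne ys(1) by (simp add: l_def n)
  have X: "[:0, 1:] * monom l n = monom l (length low)" by (simp add: n monom_Suc)
  have red: "redl M low (c # cs) zs = addl (z # butlast ys) (map ((*) (- (l mod M))) low)"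
    by (simp add: zs ys_def l_def red_step_def)
  have "Poly (redl M low (c # cs) zs) = [:z:] + [:0, 1:] * Poly (butlast ys) - smult (l mod M) (Poly low)"
    unfolding red by simp
  also have "\<dots> = [:z:] + [:0, 1:] * Poly ys - T * [:l:] + smult (l - l mod M) (Poly low)"
    by (simp add: Pys X distrib_left T smult_diff_left smult_add_right smult_monom del: mult_pCons_left)
  also have "pcong T M \<dots> ([:z:] + [:0, 1:] * Poly zs' - 0 + 0)"
  proof (intro pcong_add pcong_diff pcong_refl pcong_mult_left ys pcong_mult_self pcong_smult_dvd)
    show "M dvd l - l mod M" by (simp add: mod_eq_dvd_iff[symmetric])
  qed
  finally have "pcong T M (Poly (redl M low (c # cs) zs)) (Poly zs)" by (simp add: zs)
  moreover have "length (redl M low (c # cs) zs) = length low"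
    unfolding red using ys(1) low by (auto simp: length_butlast)
  ultimately show ?case by blast
qed auto

lemma mulT_correct:
  assumes "length xs = length low" "length ys = length low"
  shows "length (mulT M low xs ys) = length low" "pcong T M (Poly (mulT M low xs ys)) (Poly xs * Poly ys)"
proof -
  have ne: "xs \<noteq> []" "ys \<noteq> []" using assms low by auto
  have len: "length (pmul xs ys) = length (tl low) + length low"
    using length_pmul[OF ne(2,1)] assms low by (cases low) auto
  note r = redl_correct[OF len, of M]
  show "length (mulT M low xs ys) = length low" using r by (simp add: mulT_def)
  show "pcong T M (Poly (mulT M low xs ys)) (Poly xs * Poly ys)"
    unfolding mulT_def using pcong_trans[OF Poly_map_mod r[THEN conjunct2]] by simp
qed

lemma powT_correct:
  assumes xs: "length xs = length low"
  shows "length acc = length low \<Longrightarrow> pcong T M (Poly acc) (Poly xs ^ n) \<Longrightarrow>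
     length (powT M low xs bs acc) = length low \<and> pcong T M (Poly (powT M low xs bs acc)) (Poly xs ^ bits_val bs n)"
proof (induction bs arbitrary: acc n)
  case (Cons b bs)
  define s where "s = mulT M low acc acc"
  have s: "length s = length low" "pcong T M (Poly s) (Poly xs ^ (2 * n))"
  proof -
    show "length s = length low" using mulT_correct Cons.prems by (simp add: s_def)
    have "pcong T M (Poly s) (Poly acc * Poly acc)" using mulT_correct Cons.prems by (simp add: s_def)
    also have "pcong T M (Poly acc * Poly acc) (Poly xs ^ n * Poly xs ^ n)"
      by (intro pcong_mult Cons.prems)
    finally show "pcong T M (Poly s) (Poly xs ^ (2 * n))" by (simp add: mult_2 power_add)
  qed
  have "pcong T M (Poly (mulT M low xs s)) (Poly xs * Poly s)" using mulT_correct xs s by simp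
  also have "pcong T M (Poly xs * Poly s) (Poly xs * Poly xs ^ (2 * n))" by (intro pcong_mult_left s)
  finally have b: "pcong T M (Poly (mulT M low xs s)) (Poly xs ^ Suc (2 * n))" by simp
  show ?case
  proof (cases b)
    case True
    thus ?thesis using Cons.IH[OF mulT_correct(1)[OF xs s(1)] b] by (simp add: s_def[symmetric] pow_step_def)
  next
    case False
    thus ?thesis using Cons.IH[OF s] by (simp add: s_def[symmetric] pow_step_def)
  qed
qed auto

lemma Poly_onel [simp]: "Poly (onel low) = 1" "length (onel low) = length low"
proof -
  have "Poly (map (\<lambda>_. 0) xs) = 0" for xs :: "int list" by (induction xs) auto
  thus "Poly (onel low) = 1" by (simp add: onel_def one_pCons)
  show "length (onel low) = length low" using low by (cases low) (auto simp: onel_def)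
qed

lemma powT_onel:
  assumes "length xs = length low"
  shows "length (powT M low xs bs (onel low)) = length low"
    "pcong T M (Poly (powT M low xs bs (onel low))) (Poly xs ^ bits_val bs 0)"
  using powT_correct[OF assms, of "onel low" M 0 bs] by auto

end

lemma degree_Poly_less: "xs \<noteq> [] \<Longrightarrow> degree (Poly xs) < length xs"
  by (rule degree_lessI) (auto simp: nth_default_def)

text \<open>Independence modulo q is certified by evaluating such forms on reduced coefficients
  instead of computing a rank.\<close>

definition Lin :: "int list \<Rightarrow> int poly \<Rightarrow> int" where
  "Lin lam f = (\<Sum>i<length lam. lam ! i * coeff f i)"

lemma Lin_add: "Lin lam (f + g) = Lin lam f + Lin lam g"
  by (simp add: Lin_def algebra_simps sum.distrib)

lemma Lin_smult: "Lin lam (smult c f) = c * Lin lam f"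
  by (simp add: Lin_def sum_distrib_left ac_simps)

lemma Lin_sum: "Lin lam (sum f A) = (\<Sum>i\<in>A. Lin lam (f i))"
proof -
  have "Lin lam 0 = 0" by (simp add: Lin_def)
  thus ?thesis by (induction A rule: infinite_finite_induct) (auto simp: Lin_add)
qed

lemma Lin_Poly: "length xs = length lam \<Longrightarrow> Lin lam (Poly xs) = dot lam xs"
  unfolding Lin_def dot_def sum_list_sum_nth lessThan_atLeast0
  by (intro sum.cong) (auto simp: nth_default_def)

lemma Lin_pcong:
  assumes "lead_coeff T = 1" "degree f < degree T" "pcong T q f 0"
  shows "q dvd Lin lam f"
  unfolding Lin_def using pcong_coeff[OF assms] by (intro dvd_sum dvd_mult) auto

lemma power_add_small:
  fixes x y :: "'a :: comm_ring_1"
  obtains R where "(x + y) ^ Suc n = x ^ Suc n + of_nat (Suc n) * x ^ n * y + y ^ 2 * R"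
proof -
  have "\<exists>R. (x + y) ^ Suc n = x ^ Suc n + of_nat (Suc n) * x ^ n * y + y ^ 2 * R"
  proof (induction n)
    case 0
    show ?case by (rule exI[of _ 0]) simp
  next
    case (Suc n)
    then obtain R where R: "(x + y) ^ Suc n = x ^ Suc n + of_nat (Suc n) * x ^ n * y + y ^ 2 * R" by blast
    have "(x + y) ^ Suc (Suc n) = (x + y) * (x + y) ^ Suc n" by simp
    also have "\<dots> = x ^ Suc (Suc n) + of_nat (Suc (Suc n)) * x ^ Suc n * y + y ^ 2 * (of_nat (Suc n) * x ^ n + (x + y) * R)"
      unfolding R by (simp add: algebra_simps power2_eq_square)
    finally show ?case by blast
  qed
  thus thesis using that by blast
qed

definition unitl :: "int \<Rightarrow> int list \<Rightarrow> int list \<Rightarrow> int \<Rightarrow> int \<Rightarrow> int list" where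
  "unitl q A B a b = map (\<lambda>x. x mod (q * q)) (addl (map ((*) a) A) (map ((*) b) B))"

text \<open>
  The linear form \<open>lam\<close> does not vanish on the logarithm of the unit \<open>u = a A + b B\<close> modulo \<open>q\<close>, but it does
  on \<open>A/u\<close> and \<open>B/u\<close>, so its value depends only on \<open>a\<close> and \<open>b\<close> modulo \<open>q\<close>; here \<open>w = u\<^sup>E\<^sup>-\<^sup>1\<close> is the inverse of
  \<open>u\<close> modulo \<open>q\<close>.
\<close>

definition obstr_lin :: "int \<Rightarrow> int list \<Rightarrow> int list \<Rightarrow> bool" where
  "obstr_lin q lam t \<longleftrightarrow> list_all (\<lambda>x. x mod q = 0) t \<and> dot lam (map (\<lambda>x. x div q) t) mod q \<noteq> 0"

definition obstr_inv :: "int \<Rightarrow> int list \<Rightarrow> int list \<Rightarrow> int list \<Rightarrow> int list \<Rightarrow> int list \<Rightarrow> int list \<Rightarrow> bool" where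
  "obstr_inv q low A B lam u w \<longleftrightarrow>
     obstr_lin q lam (addl (map uminus (onel low)) (mulT (q * q) low u w)) \<and>
     dot lam (mulT q low A w) mod q = 0 \<and> dot lam (mulT q low B w) mod q = 0"

definition obstr_unit :: "int \<Rightarrow> int list \<Rightarrow> bool list \<Rightarrow> int list \<Rightarrow> int list \<Rightarrow> int list \<Rightarrow> int list \<Rightarrow> bool" where
  "obstr_unit q low bs A B lam u \<longleftrightarrow> obstr_inv q low A B lam u (powT (q * q) low u bs (onel low))"

definition obstr :: "int \<Rightarrow> int list \<Rightarrow> bool list \<Rightarrow> int list \<Rightarrow> int list \<Rightarrow> int list \<Rightarrow> int \<Rightarrow> int \<Rightarrow> bool" where
  "obstr q low bs A B lam a b \<longleftrightarrow> obstr_unit q low bs A B lam (unitl q A B a b)"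

lemma obstr_sound:
  fixes q :: nat
  assumes T: "T = monom 1 (length low) + Poly low" and low: "low \<noteq> []"
    and A: "length A = length low" and B: "length B = length low" and lam: "length lam = length low"
    and ob: "obstr (int q) low bs A B lam (a mod int q) (b mod int q)" and E: "E = Suc (bits_val bs 0)"
  obtains t where "degree t < length low" "\<not> int q dvd Lin lam t"
    "pcong T (int q ^ 2) ((smult a (Poly A) + smult b (Poly B)) ^ E) (1 + smult (int q) t)"
proof -
  let ?q = "int q"
  define u where "u = unitl ?q A B (a mod ?q) (b mod ?q)"
  define w where "w = powT (?q * ?q) low u bs (onel low)"
  define v where "v = mulT (?q * ?q) low u w"
  define tl where "tl = addl (map uminus (onel low)) v"
  define t0 where "t0 = map (\<lambda>x. x div ?q) tl"
  define sA where "sA = mulT ?q low A w"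
  define sB where "sB = mulT ?q low B w"
  have ob': "list_all (\<lambda>x. x mod ?q = 0) tl" "dot lam t0 mod ?q \<noteq> 0" "dot lam sA mod ?q = 0" "dot lam sB mod ?q = 0"
    using ob unfolding obstr_def obstr_unit_def obstr_inv_def obstr_lin_def u_def[symmetric] w_def[symmetric] v_def[symmetric] tl_def[symmetric]
      t0_def[symmetric] sA_def[symmetric] sB_def[symmetric] by auto
  have lu: "length u = length low" by (simp add: u_def unitl_def A B)
  note w = powT_onel[OF T low lu, of "?q * ?q" bs, folded w_def]
  note v = mulT_correct[OF T low lu w(1), of "?q * ?q", folded v_def]
  note sA = mulT_correct[OF T low A w(1), of ?q, folded sA_def]
  note sB = mulT_correct[OF T low B w(1), of ?q, folded sB_def]
  have ltl: "length tl = length low" using v(1) Poly_onel(2)[OF T low] by (simp add: tl_def)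
  have t0: "smult ?q (Poly t0) = Poly tl"
  proof -
    have "map ((*) ?q) t0 = tl" unfolding t0_def map_map
      using ob'(1) by (intro map_idI) (auto simp: list_all_iff mod_eq_0_iff_dvd)
    thus ?thesis by (metis Poly_map_mult)
  qed
  have "Poly (map uminus xs) = - Poly xs" for xs :: "int list" by (induction xs) auto
  hence "Poly tl = Poly v - 1" using Poly_onel(1)[OF T low] by (simp add: tl_def)
  hence Pv: "Poly v = 1 + smult ?q (Poly t0)" by (simp add: t0)
  define a' where "a' = a div ?q"
  define b' where "b' = b div ?q"
  define s where "s = smult a' (Poly A) + smult b' (Poly B)"
  define u0 where "u0 = smult (a mod ?q) (Poly A) + smult (b mod ?q) (Poly B)"
  have u0: "pcong T (?q * ?q) (Poly u) u0"
    unfolding u_def unitl_def u0_def using Poly_map_mod[of T "?q * ?q" "addl (map ((*) (a mod ?q)) A) (map ((*) (b mod ?q)) B)"] by simp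
  have split: "smult a (Poly A) + smult b (Poly B) = u0 + smult ?q s"
  proof -
    have "a = a mod ?q + ?q * a'" "b = b mod ?q + ?q * b'" by (simp_all add: a'_def b'_def)
    hence "smult a (Poly A) = smult (a mod ?q) (Poly A) + smult (?q * a') (Poly A)"
      "smult b (Poly B) = smult (b mod ?q) (Poly B) + smult (?q * b') (Poly B)"
      by (metis smult_add_left)+
    thus ?thesis by (simp add: u0_def s_def smult_add_right)
  qed
  let ?n = "bits_val bs 0"
  \<comment> \<open>Lifting (a, b) from its residues changes the base by q s, hence the E-th power
    by q E u0^(E - 1) s modulo q^2. The lists \<open>sA\<close> and \<open>sB\<close> represent A
    u0^(E - 1) and B u0^(E - 1), on which the form vanishes modulo q.\<close>
  define t where "t = Poly t0 + smult (int E * a') (Poly sA) + smult (int E * b') (Poly sB)"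
  have d: "int q ^ 2 = ?q * ?q" by (simp add: power2_eq_square)
  have wq: "pcong T ?q (Poly w) (u0 ^ ?n)"
  proof -
    have "pcong T (?q * ?q) (Poly w) (Poly u ^ ?n)" by (rule w(2))
    also have "pcong T (?q * ?q) (Poly u ^ ?n) (u0 ^ ?n)" by (rule pcong_power[OF u0])
    finally show ?thesis by (rule pcong_dvd_modulus) simp
  qed
  have uE: "pcong T (?q * ?q) (u0 ^ E) (1 + smult ?q (Poly t0))"
  proof -
    have "pcong T (?q * ?q) (Poly v) (Poly u * Poly w)" by (rule v(2))
    also have "pcong T (?q * ?q) (Poly u * Poly w) (u0 * u0 ^ ?n)"
      by (rule pcong_mult[OF u0 pcong_trans[OF w(2) pcong_power[OF u0]]])
    finally have "pcong T (?q * ?q) (Poly v) (u0 ^ E)" by (simp add: E)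
    thus ?thesis unfolding Pv by (rule pcong_sym)
  qed
  have us: "pcong T ?q (u0 ^ ?n * s) (smult a' (Poly sA) + smult b' (Poly sB))"
  proof -
    have *: "pcong T ?q (u0 ^ ?n * Poly C) (Poly sC)" if "pcong T ?q (Poly sC) (Poly C * Poly w)" for C sC
      using pcong_sym[OF pcong_trans[OF that pcong_mult_left[OF wq]]] by (simp add: mult.commute)
    have "u0 ^ ?n * s = smult a' (u0 ^ ?n * Poly A) + smult b' (u0 ^ ?n * Poly B)"
      by (simp add: s_def distrib_left)
    also have "pcong T ?q \<dots> (smult a' (Poly sA) + smult b' (Poly sB))"
      by (intro pcong_add pcong_smult_same * sA sB)
    finally show ?thesis .
  qed
  obtain R where R: "(u0 + smult ?q s) ^ Suc ?n = u0 ^ Suc ?n + of_nat (Suc ?n) * u0 ^ ?n * smult ?q s + (smult ?q s) ^ 2 * R"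
    by (rule power_add_small)
  have "(u0 + smult ?q s) ^ E = u0 ^ E + smult ?q (smult (int E) (u0 ^ ?n * s)) + smult (?q * ?q) (s ^ 2 * R)"
    using R unfolding E by (simp add: smult_power power2_eq_square of_nat_poly mult.commute)
  also have "pcong T (?q * ?q) \<dots> ((1 + smult ?q (Poly t0)) + smult ?q (smult (int E) (smult a' (Poly sA) + smult b' (Poly sB))) + 0)"
    by (intro pcong_add uE pcong_smult pcong_smult_same us pcong_smult_self)
  also have "(1 + smult ?q (Poly t0)) + smult ?q (smult (int E) (smult a' (Poly sA) + smult b' (Poly sB))) + 0 = 1 + smult ?q t"
    by (simp add: t_def smult_add_right)
  finally have main: "pcong T (int q ^ 2) ((smult a (Poly A) + smult b (Poly B)) ^ E) (1 + smult ?q t)"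
    unfolding split d .
  have ne: "t0 \<noteq> []" "sA \<noteq> []" "sB \<noteq> []" using ltl sA(1) sB(1) low by (auto simp: t0_def)
  have "degree t < length low"
    unfolding t_def using degree_Poly_less[OF ne(1)] degree_Poly_less[OF ne(2)] degree_Poly_less[OF ne(3)] ltl sA(1) sB(1)
    by (intro degree_add_less) (auto simp: t0_def intro: le_less_trans[OF degree_smult_le])
  moreover have "\<not> ?q dvd Lin lam t"
  proof -
    have "Lin lam t = dot lam t0 + (int E * a') * dot lam sA + (int E * b') * dot lam sB"
      using lam ltl sA(1) sB(1) by (simp add: t_def Lin_add Lin_smult Lin_Poly t0_def)
    moreover have "?q dvd (int E * a') * dot lam sA" "?q dvd (int E * b') * dot lam sB"
      using ob'(3,4) by (auto intro: dvd_mult)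
    moreover have "\<not> ?q dvd dot lam t0" using ob'(2) by auto
    ultimately show ?thesis by (simp add: dvd_add_left_iff)
  qed
  ultimately show thesis using that main by blast
qed

section \<open>Certificates\<close>

text \<open>The quadratic coefficient is kept explicit because, when q divides E,
  \<open>class_one\<close> needs the factor q contained in it.\<close>

lemma power_add_small_three:
  fixes x y :: "'a :: comm_ring_1"
  obtains R where "(x + y) ^ (n + 2) = x ^ (n + 2) + of_nat (n + 2) * x ^ (n + 1) * y +
    of_nat ((n + 2) choose 2) * x ^ n * y ^ 2 + y ^ 3 * R"
proof -
  have "\<exists>R. (x + y) ^ (n + 2) = x ^ (n + 2) + of_nat (n + 2) * x ^ (n + 1) * y +
    of_nat ((n + 2) choose 2) * x ^ n * y ^ 2 + y ^ 3 * R"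
  proof (induction n)
    case 0
    show ?case by (rule exI[of _ 0]) (simp add: power2_eq_square algebra_simps choose_two)
  next
    case (Suc n)
    then obtain R where R: "(x + y) ^ (n + 2) = x ^ (n + 2) + of_nat (n + 2) * x ^ (n + 1) * y +
      of_nat ((n + 2) choose 2) * x ^ n * y ^ 2 + y ^ 3 * R" by blast
    have c: "(Suc n + 2) choose 2 = (n + 2) + ((n + 2) choose 2)" by (simp add: numeral_2_eq_2)
    have "(x + y) ^ (Suc n + 2) = (x + y) * (x + y) ^ (n + 2)" by simp
    also have "\<dots> = x ^ (Suc n + 2) + of_nat (Suc n + 2) * x ^ (Suc n + 1) * y +
      (of_nat (n + 2) + of_nat ((n + 2) choose 2)) * x ^ Suc n * y ^ 2 +
      y ^ 3 * (of_nat ((n + 2) choose 2) * x ^ n + (x + y) * R)"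
      unfolding R by (simp add: algebra_simps power2_eq_square power3_eq_cube)
    finally show ?case unfolding c of_nat_add[symmetric] by blast
  qed
  thus thesis using that by blast
qed

text \<open>Modulus 0: the product is checked exactly, not modulo q.\<close>

definition unit_ok :: "nat \<Rightarrow> int list \<Rightarrow> int list \<times> int list \<Rightarrow> bool" where
  "unit_ok p low ee \<longleftrightarrow> length (fst ee) = p \<and> length (snd ee) = p \<and> mulT 0 low (fst ee) (snd ee) = onel low"

text \<open>The E-th power is computed as e times e^(E - 1). Comparing lists is legitimate because
  \<open>mulT\<close> returns residues in [0, q^2), which 1 + q t matches when t has entries in [0,
  q).\<close>

definition unit_lin :: "nat \<Rightarrow> int \<Rightarrow> int list \<Rightarrow> bool list \<Rightarrow> int list \<times> int list \<Rightarrow> int list \<Rightarrow> bool" where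
  "unit_lin p q low bs ee t \<longleftrightarrow> length t = p \<and>
     mulT (q * q) low (fst ee) (powT (q * q) low (fst ee) bs (onel low)) = addl (onel low) (map ((*) q) t)"

definition dot_mod :: "int \<Rightarrow> int list \<Rightarrow> int list \<Rightarrow> int" where
  "dot_mod q lam t = dot lam t mod q"

locale unit_certificate =
  fixes p q :: nat and low :: "int list" and es :: "(int list \<times> int list) list"
    and ts mus :: "int list list" and bs :: "bool list" and E :: nat
  assumes p: "prime p" "odd p" and q: "prime q" "odd q"
    and lpoly: "lpoly p = monom 1 p + Poly low" and low: "length low = p"
    and len: "length es = (p - 1) div 2"
    and es: "list_all (unit_ok p low) es"
    and ts: "list_all2 (unit_lin p (int q) low bs) es ts"
    and mus: "list_all (\<lambda>mu. length mu = p) mus" "length mus = length es"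
    and mu_ts: "map (\<lambda>mu. map (dot_mod (int q) mu) ts) mus =
       map (\<lambda>i. map (\<lambda>j. if i = j then 1 else 0) [0..<length es]) [0..<length es]"
    and E: "E = Suc (bits_val bs 0)"
begin

abbreviation "r0 \<equiv> (p - 1) div 2"

lemma p_eq: "p = 2 * r0 + 1" using p(2) by (auto elim!: oddE)

lemma p_pos: "p > 0" using prime_gt_0_nat[OF p(1)] .

lemma low_ne: "low \<noteq> []" using low p_pos by auto

lemma T_eq: "lpoly p = monom 1 (length low) + Poly low" using lpoly low by simp

sublocale int_poly_roots "lpoly p" p "lroot p"
  by (rule lroot_int_poly_roots[OF p])

lemma degree_T: "degree (lpoly p) > 0" using deg d_pos by simp

lemma lts: "length ts = r0" using list_all2_lengthD[OF ts] len by simp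

lemma e_props:
  assumes "i < r0"
  shows "length (fst (es ! i)) = p" "pcong (lpoly p) 0 (Poly (fst (es ! i)) * Poly (snd (es ! i))) 1"
proof -
  obtain e e' where ee: "es ! i = (e, e')" by fastforce
  hence "(e, e') \<in> set es" using assms len by (metis nth_mem)
  hence *: "length e = p" "length e' = p" "mulT 0 low e e' = onel low" using es by (auto simp: list_all_iff unit_ok_def)
  show "length (fst (es ! i)) = p" using * ee by simp
  have "pcong (lpoly p) 0 (Poly (mulT 0 low e e')) (Poly e * Poly e')"
    by (rule mulT_correct(2)[OF T_eq low_ne]) (simp_all only: * low)
  thus "pcong (lpoly p) 0 (Poly (fst (es ! i)) * Poly (snd (es ! i))) 1"
    unfolding *(3) Poly_onel(1)[OF T_eq low_ne] ee by (auto intro: pcong_sym)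
qed

lemma t_props:
  assumes "i < r0"
  shows "length (ts ! i) = p"
    "pcong (lpoly p) (int q ^ 2) (Poly (fst (es ! i)) ^ E) (1 + smult (int q) (Poly (ts ! i)))"
proof -
  define e where "e = fst (es ! i)"
  have le: "length e = length low" using e_props[OF assms] low by (simp add: e_def)
  let ?M = "int q * int q"
  have *: "length (ts ! i) = p" "mulT ?M low e (powT ?M low e bs (onel low)) = addl (onel low) (map ((*) (int q)) (ts ! i))"
    using list_all2_nthD[OF ts, of i] assms len by (auto simp: unit_lin_def e_def)
  show "length (ts ! i) = p" by (rule *(1))
  note w = powT_onel[OF T_eq low_ne le, of ?M bs]
  have "pcong (lpoly p) ?M (Poly (mulT ?M low e (powT ?M low e bs (onel low)))) (Poly e * Poly (powT ?M low e bs (onel low)))"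
    by (rule mulT_correct(2)[OF T_eq low_ne le w(1)])
  also have "pcong (lpoly p) ?M (Poly e * Poly (powT ?M low e bs (onel low))) (Poly e * Poly e ^ bits_val bs 0)"
    by (rule pcong_mult_left[OF w(2)])
  finally have "pcong (lpoly p) ?M (1 + smult (int q) (Poly (ts ! i))) (Poly e ^ E)"
    unfolding *(2) by (simp add: Poly_onel(1)[OF T_eq low_ne] E)
  thus "pcong (lpoly p) (int q ^ 2) (Poly (fst (es ! i)) ^ E) (1 + smult (int q) (Poly (ts ! i)))"
    unfolding e_def power2_eq_square by (rule pcong_sym)
qed

lemma degree_t: "i < r0 \<Longrightarrow> degree (Poly (ts ! i)) < p"
  using degree_Poly_less[of "ts ! i"] t_props(1)[of i] p_pos by auto

lemma length_mu: "i < r0 \<Longrightarrow> length (mus ! i) = p"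
  using mus len by (auto simp: list_all_iff)

lemma mu_t: "i < r0 \<Longrightarrow> j < r0 \<Longrightarrow> Lin (mus ! i) (Poly (ts ! j)) mod int q = (if i = j then 1 else 0)"
proof -
  assume ij: "i < r0" "j < r0"
  have "dot (mus ! i) (ts ! j) mod int q = map (\<lambda>mu. map (dot_mod (int q) mu) ts) mus ! i ! j"
    using ij mus(2) len lts by (simp add: dot_mod_def)
  also have "\<dots> = (if i = j then 1 else 0)" unfolding mu_ts using ij len by simp
  finally show ?thesis using Lin_Poly[of "ts ! j" "mus ! i"] t_props(1) length_mu ij by simp
qed

lemma q_not_dvd_1: "\<not> int q dvd 1" using prime_gt_1_nat[OF q(1)] by simp

text \<open>Duality of \<open>mus\<close> and \<open>ts\<close> isolates one coefficient;
  \<open>x\<close> collects the contribution of the remaining terms to the form.\<close>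

lemma mu_extract:
  assumes "i < r0" "int q dvd x + (\<Sum>j<r0. c j * Lin (mus ! i) (Poly (ts ! j)))" "int q dvd x"
  shows "int q dvd c i"
proof -
  have dvd: "int q dvd (\<Sum>j<r0. c j * Lin (mus ! i) (Poly (ts ! j)))" using assms(2,3) by (simp add: dvd_add_right_iff)
  have "(\<Sum>j<r0. c j * Lin (mus ! i) (Poly (ts ! j))) mod int q = (\<Sum>j<r0. (c j * (Lin (mus ! i) (Poly (ts ! j)) mod int q)) mod int q) mod int q"
    by (simp add: mod_sum_eq mod_mult_right_eq)
  also have "(\<Sum>j<r0. (c j * (Lin (mus ! i) (Poly (ts ! j)) mod int q)) mod int q) = (\<Sum>j<r0. if j = i then c i mod int q else 0)"
    by (intro sum.cong refl) (use assms(1) in \<open>auto simp: mu_t\<close>)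
  also have "\<dots> = c i mod int q" using assms(1) by simp
  finally show ?thesis using dvd by (simp add: dvd_eq_mod_eq_0)
qed

text \<open>Index 0 carries the unit coming from the solution, the others the explicit units; the
  exponent \<open>E\<close> is there to make them 1 modulo q.\<close>

definition funits :: "int poly \<Rightarrow> nat \<Rightarrow> int poly" where
  "funits u i = (case i of 0 \<Rightarrow> u | Suc j \<Rightarrow> Poly (fst (es ! j))) ^ E"

definition funits_inv :: "int poly \<Rightarrow> nat \<Rightarrow> int poly" where
  "funits_inv g i = (case i of 0 \<Rightarrow> g | Suc j \<Rightarrow> Poly (snd (es ! j))) ^ E"

text \<open>The rank bound is applied directly to the E-th powers: they are r0 + 1 units, and the
  rank is at most r0.\<close>

lemma unit_relation:
  assumes ug: "pcong (lpoly p) 0 (u * g) 1"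
  shows "\<And>i. i \<le> r0 \<Longrightarrow> pcong (lpoly p) 0 (funits u i * funits_inv g i) 1"
    "\<exists>n. (\<exists>i\<le>r0. n i \<noteq> (0::int)) \<and>
       pcong (lpoly p) 0 (\<Prod>i\<le>r0. ipow (funits u i) (funits_inv g i) (n i)) 1"
proof -
  let ?f = "funits u" and ?h = "funits_inv g"
  show fh: "pcong (lpoly p) 0 (?f i * ?h i) 1" if "i \<le> r0" for i
  proof -
    let ?a = "case i of 0 \<Rightarrow> u | Suc j \<Rightarrow> Poly (fst (es ! j))" and ?b = "case i of 0 \<Rightarrow> g | Suc j \<Rightarrow> Poly (snd (es ! j))"
    have "pcong (lpoly p) 0 (?a * ?b) 1" using that ug e_props(2) by (cases i) auto
    from pcong_power[OF this, of E] show ?thesis unfolding funits_def funits_inv_def power_mult_distrib by simp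
  qed
  have conj: "lroot p (p - k) = cnj (lroot p k)" if "k \<in> {1..r0}" for k
    using that p_eq by (intro lroot_cnj) auto
  obtain n where "\<exists>i\<le>r0. n i \<noteq> (0::int)" "pcong (lpoly p) 0 (\<Prod>i\<le>r0. ipow (?f i) (?h i) (n i)) 1"
    by (rule units_dependent[OF p_eq conj fh])
  thus "\<exists>n. (\<exists>i\<le>r0. n i \<noteq> (0::int)) \<and> pcong (lpoly p) 0 (\<Prod>i\<le>r0. ipow (?f i) (?h i) (n i)) 1" by blast
qed

text \<open>The form \<open>lam\<close> vanishes on the logarithms of the explicit units but not on
  that of the new unit, so a dependence modulo q has q | c 0. The dual forms \<open>mus\<close> then
  give the other coefficients: the logarithms are independent, which no relation allows.\<close>

theorem class_excluded:
  assumes r: "0 < r" "r < p" and eq: "ZS x 1 = fund_unit ^ r * ZS a b ^ p"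
    and A: "Poly A = fibp r" "length A = p" and B: "Poly B = epoly p r" "length B = p"
    and lam: "length lam = p" "list_all (\<lambda>t. dot lam t mod int q = 0) ts"
    and ob: "obstr (int q) low bs A B lam (a mod int q) (b mod int q)"
  shows False
proof -
  let ?T = "lpoly p"
  define u where "u = smult a (fibp r) + smult b (epoly p r)"
  obtain g where g: "pcong ?T 0 (u * g) 1" by (rule solution_gives_unit[OF p r eq, folded u_def])
  define f where "f = funits u"
  define h where "h = funits_inv g"
  have f0_def: "f 0 = u ^ E" and f_Suc: "\<And>j. f (Suc j) = Poly (fst (es ! j)) ^ E"
    by (simp_all add: f_def funits_def)
  note rel = unit_relation[OF g, folded f_def h_def]
  obtain n where n: "\<exists>i\<le>r0. n i \<noteq> (0::int)" "pcong ?T 0 (\<Prod>i\<le>r0. ipow (f i) (h i) (n i)) 1"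
    using rel(2) by blast
  obtain tu where tu: "degree tu < length low" "\<not> int q dvd Lin lam tu"
    "pcong ?T (int q ^ 2) (u ^ E) (1 + smult (int q) tu)"
    by (rule obstr_sound[OF T_eq low_ne _ _ _ ob E, unfolded A(1) B(1), folded u_def]) (simp_all only: A(2) B(2) lam(1) low)
  define t where "t i = (case i of 0 \<Rightarrow> tu | Suc j \<Rightarrow> Poly (ts ! j))" for i
  show False
  proof (rule no_relation_if_independent[OF monic degree_T q, of "{..r0}" f h t n])
    show "pcong ?T 0 (f i * h i) 1" if "i \<in> {..r0}" for i using rel(1) that by simp
    show "pcong ?T (int q ^ 2) (f i) (1 + smult (int q) (t i))" if "i \<in> {..r0}" for i
      using that tu(3) t_props(2) by (cases i) (auto simp: f0_def f_Suc t_def)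
    show "\<forall>i\<in>{..r0}. int q dvd c i" if "pcong ?T (int q) (\<Sum>i\<in>{..r0}. smult (c i) (t i)) 0" for c
    proof -
      let ?S = "\<Sum>i\<in>{..r0}. smult (c i) (t i)"
      have "degree (smult (c i) (t i)) < degree ?T" if "i \<le> r0" for i
        using that tu(1) degree_t low by (cases i) (auto simp: t_def deg intro!: le_less_trans[OF degree_smult_le])
      hence "degree ?S < degree ?T" using degree_T by (intro degree_sum_less) auto
      hence dvd: "int q dvd Lin l ?S" for l using Lin_pcong[OF monic _ that] by blast
      have LinS: "Lin l ?S = c 0 * Lin l tu + (\<Sum>j<r0. c (Suc j) * Lin l (Poly (ts ! j)))" for l
        unfolding sum.atMost_shift by (simp add: Lin_add Lin_sum Lin_smult t_def)
      have "int q dvd (\<Sum>j<r0. c (Suc j) * Lin lam (Poly (ts ! j)))"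
      proof (intro dvd_sum dvd_mult)
        fix j assume "j \<in> {..<r0}"
        hence "Lin lam (Poly (ts ! j)) = dot lam (ts ! j)" "ts ! j \<in> set ts"
          using Lin_Poly[of "ts ! j" lam] t_props(1) lam(1) lts by auto
        thus "int q dvd Lin lam (Poly (ts ! j))" using lam(2) by (auto simp: list_all_iff)
      qed
      hence "int q dvd c 0 * Lin lam tu" using dvd[of lam] unfolding LinS by (simp add: dvd_add_left_iff)
      hence c0: "int q dvd c 0" using tu(2) q(1) by (simp add: prime_dvd_mult_iff)
      have cS: "int q dvd c (Suc i)" if "i < r0" for i
      proof (rule mu_extract[OF that, of "c 0 * Lin (mus ! i) tu" "\<lambda>j. c (Suc j)"])
        show "int q dvd c 0 * Lin (mus ! i) tu + (\<Sum>j<r0. c (Suc j) * Lin (mus ! i) (Poly (ts ! j)))"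
          using dvd[of "mus ! i"] unfolding LinS .
        show "int q dvd c 0 * Lin (mus ! i) tu" using c0 by (rule dvd_mult2)
      qed
      show ?thesis
      proof
        fix i assume "i \<in> {..r0}"
        thus "int q dvd c i" using c0 cS by (cases i) auto
      qed
    qed
  qed (use n in auto)
qed

text \<open>Let k be the exponent of q in b, assumed nonzero, and N = E m. Modulo q^(2k + e) the
  power (a + b D)^N equals a^N + N a^(N - 1) b D, so \<open>relation_with_plane\<close> makes q^(2k
  + e) divide N a^(N - 1) b. But the exact power of q there is q^(k + e), and k >= 1. The bound e <=
  1 puts the cubic terms, divisible by q^(3k), within the precision.\<close>

theorem class_one:
  assumes eq: "ZS x 1 = fund_unit * ZS a b ^ p" and b: "int q dvd b"
    and D: "Poly D = epoly p 1" "length D = p" "0 < k0" "k0 < p" "D ! k0 = -1"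
    and muD: "list_all (\<lambda>mu. dot mu (onel low) mod int q = 0 \<and> dot mu D mod int q = 0) mus"
    and a: "int q dvd a ^ E - 1" and e: "e \<le> 1" "q ^ e dvd E" "\<not> q ^ Suc e dvd E" and E2: "2 \<le> E"
  shows "b = 0"
proof (rule ccontr)
  assume b0: "b \<noteq> 0"
  let ?T = "lpoly p" and ?D = "epoly p 1" and ?q = "int q"
  have q1: "?q > 1" using prime_gt_1_nat[OF q(1)] by simp
  have pq: "prime ?q" using q(1) by simp
  define u where "u = smult a (fibp 1) + smult b ?D"
  have u: "u = [:a:] + smult b ?D" by (simp add: u_def one_pCons)
  have eq': "ZS x 1 = fund_unit ^ 1 * ZS a b ^ p" using eq by simp
  obtain g where g: "pcong ?T 0 (u * g) 1"
    by (rule solution_gives_unit[OF p _ _ eq', folded u_def]) (use prime_gt_1_nat[OF p(1)] in auto)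
  define f where "f = funits u"
  define h where "h = funits_inv g"
  have f0_def: "f 0 = u ^ E" and f_Suc: "\<And>j. f (Suc j) = Poly (fst (es ! j)) ^ E"
    by (simp_all add: f_def funits_def)
  note rel = unit_relation[OF g, folded f_def h_def]
  obtain n where n: "\<exists>i\<le>r0. n i \<noteq> (0::int)" "pcong ?T 0 (\<Prod>i\<le>r0. ipow (f i) (h i) (n i)) 1"
    using rel(2) by blast
  have ins: "insert 0 {1..r0} = {..r0}" by auto
  have degD: "degree ?D < degree ?T"
    using degree_Poly_less[of D] D(1,2) p_pos deg by (auto simp flip: D(1))
  have degC: "degree [:A:] < degree ?T" for A :: int using degree_T by simp
  have a_ndvd: "\<not> ?q dvd a"
  proof
    assume "?q dvd a"
    hence "?q dvd a ^ E" using E by (simp add: dvd_power)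
    from dvd_diff[OF this a] show False using q_not_dvd_1 by simp
  qed
  obtain n0 where n0: "E = Suc n0" using E by blast
  obtain A0 where A0: "a ^ E - 1 = ?q * A0" using a by (rule dvdE)
  obtain b1 where b1: "b = ?q * b1" using b by (rule dvdE)
  define B0 where "B0 = int E * a ^ n0 * b1"
  have f0: "pcong ?T (?q ^ 2) (f 0) (1 + smult ?q ([:A0:] + smult B0 ?D))"
  proof -
    obtain R where R: "([:a:] + smult b ?D) ^ Suc n0 = [:a:] ^ Suc n0 + of_nat (Suc n0) * [:a:] ^ n0 * smult b ?D + (smult b ?D) ^ 2 * R"
      by (rule power_add_small)
    have "f 0 = [:a ^ E:] + smult (int E * a ^ n0 * b) ?D + smult (b ^ 2) (?D ^ 2 * R)"
      unfolding f0_def u n0 using R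
      by (simp add: smult_power of_nat_poly poly_const_pow ac_simps)
    moreover have "[:a ^ E:] = 1 + smult ?q [:A0:]" using A0 by (simp add: one_pCons algebra_simps)
    moreover have "int E * a ^ n0 * b = ?q * B0" by (simp add: B0_def b1 ac_simps)
    ultimately have "f 0 = 1 + smult ?q ([:A0:] + smult B0 ?D) + smult (b ^ 2) (?D ^ 2 * R)"
      by (simp add: smult_add_right add.assoc)
    moreover have "pcong ?T (?q ^ 2) (1 + smult ?q ([:A0:] + smult B0 ?D) + smult (b ^ 2) (?D ^ 2 * R)) (1 + smult ?q ([:A0:] + smult B0 ?D) + 0)"
      by (intro pcong_add pcong_refl pcong_smult_dvd) (use b in \<open>simp add: dvd_power_same\<close>)
    ultimately show ?thesis by simp
  qed
  obtain m where m: "\<not> q dvd m"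
    "\<And>A B K. pcong ?T (?q ^ Suc K) (f 0 ^ m) ([:A:] + smult B ?D) \<Longrightarrow> ?q ^ Suc K dvd B"
  proof (rule relation_with_plane[OF monic degree_T q, of "{1..r0}" 0 f h "\<lambda>i. Poly (ts ! (i - 1))" A0 B0 ?D n])
    show "pcong ?T 0 (f i * h i) 1" if "i \<in> insert 0 {1..r0}" for i using rel(1) that by auto
    show "pcong ?T (?q ^ 2) (f i) (1 + smult ?q (Poly (ts ! (i - 1))))" if "i \<in> {1..r0}" for i
      using that t_props(2)[of "i - 1"] by (cases i) (auto simp: f_Suc)
    show "pcong ?T (?q ^ 2) (f 0) (1 + smult ?q ([:A0:] + smult B0 ?D))" by (rule f0)
    \<comment> \<open>Coefficient \<open>k0\<close> sees only B, because D has -1 there and the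
      constant has 0; once that part is removed, coefficient 0 gives A.\<close>
    show "M dvd A \<and> M dvd B" if "pcong ?T M ([:A:] + smult B ?D) 0" for M A B
    proof -
      have dg: "degree ([:A:] + smult B ?D) < degree ?T"
        by (intro degree_add_less degC le_less_trans[OF degree_smult_le degD])
      have "M dvd coeff ([:A:] + smult B ?D) k0" by (rule pcong_coeff[OF monic dg that])
      moreover have "coeff ?D k0 = -1" using D(2,4,5) unfolding D(1)[symmetric] by (simp add: nth_default_def)
      moreover have "coeff [:A:] k0 = 0" using D(3) by (cases k0) auto
      ultimately have MB: "M dvd B" by (simp del: One_nat_def)
      hence "pcong ?T M (smult B ?D) 0" by (rule pcong_smult_dvd)
      from pcong_diff[OF that this] have "pcong ?T M [:A:] 0" by simp
      from pcong_coeff[OF monic degC this, of 0] MB show ?thesis by simp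
    qed
    show "\<forall>i\<in>{1..r0}. ?q dvd c i"
      if S: "pcong ?T ?q ([:A:] + smult B ?D + (\<Sum>i\<in>{1..r0}. smult (c i) (Poly (ts ! (i - 1))))) 0" for A B c
    proof -
      let ?S = "[:A:] + smult B ?D + (\<Sum>i\<in>{1..r0}. smult (c i) (Poly (ts ! (i - 1))))"
      have "degree (\<Sum>i\<in>{1..r0}. smult (c i) (Poly (ts ! (i - 1)))) < degree ?T"
        using degree_T degree_t by (intro degree_sum_less) (auto simp: deg intro!: le_less_trans[OF degree_smult_le])
      hence "degree ?S < degree ?T" by (intro degree_add_less degC le_less_trans[OF degree_smult_le degD])
      hence dvd: "?q dvd Lin l ?S" for l using Lin_pcong[OF monic _ S] by blast
      have "?q dvd c (Suc i)" if i: "i < r0" for i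
      proof (rule mu_extract[OF i, of _ "\<lambda>j. c (Suc j)"])
        have "mus ! i \<in> set mus" using i mus(2) len by simp
        hence *: "?q dvd dot (mus ! i) (onel low)" "?q dvd dot (mus ! i) D" using muD by (auto simp: list_all_iff)
        have "Lin (mus ! i) ?D = dot (mus ! i) D" using Lin_Poly[of D "mus ! i"] length_mu[OF i] D(1,2) by simp
        moreover have "Lin (mus ! i) [:A:] = A * dot (mus ! i) (onel low)"
        proof -
          have "[:A:] = smult A (Poly (onel low))" by (simp add: Poly_onel(1)[OF T_eq low_ne] one_pCons)
          thus ?thesis using Lin_Poly[of "onel low" "mus ! i"] length_mu[OF i] low Poly_onel(2)[OF T_eq low_ne]
            by (simp only: Lin_smult)
        qed
        ultimately show "?q dvd Lin (mus ! i) [:A:] + B * Lin (mus ! i) ?D" using * by simp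
        have "(\<Sum>i\<in>{1..r0}. smult (c i) (Poly (ts ! (i - 1)))) = (\<Sum>j<r0. smult (c (Suc j)) (Poly (ts ! j)))"
          by (rule sum.reindex_bij_witness[of _ Suc "\<lambda>i. i - 1"]) auto
        thus "?q dvd Lin (mus ! i) [:A:] + B * Lin (mus ! i) ?D + (\<Sum>j<r0. c (Suc j) * Lin (mus ! i) (Poly (ts ! j)))"
          using dvd[of "mus ! i"] by (simp add: Lin_add Lin_sum Lin_smult)
      qed
      hence cS: "\<And>i. i < r0 \<Longrightarrow> ?q dvd c (Suc i)" .
      show ?thesis
      proof
        fix i assume "i \<in> {1..r0}"
        thus "?q dvd c i" using cS by (cases i) auto
      qed
    qed
    show "\<exists>i\<in>insert 0 {1..r0}. n i \<noteq> 0" "pcong ?T 0 (\<Prod>i\<in>insert 0 {1..r0}. ipow (f i) (h i) (n i)) 1"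
      unfolding ins using n by auto
  qed auto
  define k where "k = multiplicity ?q b"
  obtain b' where b': "b = ?q ^ k * b'" "\<not> ?q dvd b'"
    using multiplicity_decompose'[of b ?q] b0 q1 unfolding k_def by auto
  have k1: "k \<ge> 1" using b b' by (cases k) auto
  obtain E' where E': "E = q ^ e * E'" using e(2) by (rule dvdE)
  have nE': "\<not> q dvd E'" using e(3) E' by (auto simp: mult_dvd_mono)
  have m0: "m > 0" using m(1) by (auto intro: Nat.gr0I)
  define N where "N = E * m"
  have N2: "N \<ge> 2" unfolding N_def using E2 m0 mult_le_mono[of 2 E 1 m] by simp
  then obtain n1 where n1: "N = n1 + 2" by (metis add.commute le_Suc_ex)
  obtain R where R: "([:a:] + smult b ?D) ^ (n1 + 2) = [:a:] ^ (n1 + 2) + of_nat (n1 + 2) * [:a:] ^ (n1 + 1) * smult b ?D +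
      of_nat ((n1 + 2) choose 2) * [:a:] ^ n1 * (smult b ?D) ^ 2 + (smult b ?D) ^ 3 * R"
    by (rule power_add_small_three)
  have "f 0 ^ m = [:a ^ N:] + smult (int N * a ^ (n1 + 1) * b) ?D + smult (int (N choose 2) * b ^ 2) (smult (a ^ n1) (?D ^ 2)) + smult (b ^ 3) (?D ^ 3 * R)"
    unfolding f0_def u using R
    by (simp add: power_mult[symmetric] N_def[symmetric] n1 smult_power of_nat_poly poly_const_pow ac_simps)
  also have "pcong ?T (?q ^ (2 * k + e)) \<dots> ([:a ^ N:] + smult (int N * a ^ (n1 + 1) * b) ?D + 0 + 0)"
  proof (intro pcong_add pcong_refl pcong_smult_dvd)
    have "?q ^ e dvd int (N choose 2)"
    proof (cases "e = 0")
      case False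
      hence "e = 1" using e(1) by simp
      hence "q dvd N" using e(2) by (simp add: N_def)
      hence "?q dvd int (N * (N - 1))" by simp
      moreover have "N * (N - 1) = 2 * (N choose 2)"
      proof -
        have "2 dvd N * (N - 1)" by (cases N) auto
        thus ?thesis unfolding choose_two by (rule dvd_mult_div_cancel[symmetric])
      qed
      ultimately have "?q dvd 2 * int (N choose 2)" by (metis of_nat_mult of_nat_numeral)
      moreover have "\<not> ?q dvd 2"
      proof
        assume "?q dvd 2"
        hence "q = 2" using q(1) q1 zdvd_imp_le[of ?q 2] by simp
        thus False using q(2) by simp
      qed
      ultimately have "?q dvd int (N choose 2)" using pq by (auto simp: prime_dvd_mult_iff)
      thus ?thesis using \<open>e = 1\<close> by simp
    qed simp
    moreover have "?q ^ (2 * k) dvd b ^ 2" unfolding b'(1) by (simp add: power_mult_distrib power_mult[symmetric] mult.commute)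
    ultimately have "?q ^ e * ?q ^ (2 * k) dvd int (N choose 2) * b ^ 2" by (rule mult_dvd_mono)
    thus "?q ^ (2 * k + e) dvd int (N choose 2) * b ^ 2" by (simp add: power_add mult.commute)
    have "?q ^ (2 * k + e) dvd ?q ^ (k * 3)" using k1 e(1) by (intro le_imp_power_dvd) simp
    thus "?q ^ (2 * k + e) dvd b ^ 3" unfolding b'(1) by (simp add: power_mult_distrib power_mult[symmetric] dvd_mult2)
  qed
  finally have "pcong ?T (?q ^ Suc (2 * k + e - 1)) (f 0 ^ m) ([:a ^ N:] + smult (int N * a ^ (n1 + 1) * b) ?D)"
    using k1 by simp
  from m(2)[OF this] have "?q ^ (2 * k + e) dvd int N * a ^ (n1 + 1) * b" using k1 by simp
  also have "int N * a ^ (n1 + 1) * b = ?q ^ (k + e) * (int E' * int m * a ^ (n1 + 1) * b')"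
    unfolding N_def E' b'(1) by (simp add: power_add ac_simps)
  also have "?q ^ (2 * k + e) = ?q ^ (k + e) * ?q ^ k" by (simp add: power_add mult_2)
  finally have "?q ^ k dvd int E' * int m * a ^ (n1 + 1) * b'" using q1 by simp
  moreover have "?q dvd ?q ^ k" using k1 by (simp add: dvd_power)
  ultimately have "?q dvd int E' * int m * a ^ (n1 + 1) * b'" by (rule dvd_trans[rotated])
  hence "q dvd E' \<or> q dvd m \<or> ?q dvd a \<or> ?q dvd b'"
    unfolding prime_dvd_mult_iff[OF pq] int_dvd_int_iff using prime_dvd_power[OF pq] by blast
  thus False using nE' m(1) a_ndvd b'(2) by blast
qed

end

section \<open>Residue classes of the pair (a, b) and their certificates\<close>

fun zpowm :: "int \<Rightarrow> int \<Rightarrow> int \<Rightarrow> nat \<Rightarrow> int \<times> int" where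
  "zpowm M a b 0 = (1, 0)"
| "zpowm M a b (Suc n) =
     (let (c, d) = zpowm M a b n in ((a * c + 2 * b * d) mod M, (a * d + b * c) mod M))"

text \<open>The coefficient of sqrt 2 on the right-hand side, which is 1 for a solution. This
  necessary condition filters the pairs that require a certificate.\<close>

definition zimm :: "int \<Rightarrow> nat \<Rightarrow> nat \<Rightarrow> int \<Rightarrow> int \<Rightarrow> int" where
  "zimm M r p a b = (case (zpowm M 1 1 r, zpowm M a b p) of ((e, f), (c, d)) \<Rightarrow> (e * d + f * c) mod M)"

lemma zpowm_correct:
  assumes "M > 1" "a' mod M = a mod M" "b' mod M = b mod M"
  shows "zpowm M a' b' n = (zre (ZS a b ^ n) mod M, zim (ZS a b ^ n) mod M)"
proof (induction n)
  case 0
  thus ?case using assms(1) by simp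
next
  case (Suc n)
  define c where "c = zre (ZS a b ^ n)"
  define d where "d = zim (ZS a b ^ n)"
  have cong: "(a' * (x mod M) + k * b' * (y mod M)) mod M = (a * x + k * b * y) mod M" for x y k
    using assms(2,3) by (intro mod_add_cong mod_mult_cong) auto
  show ?case
    using cong[of c 2 d] cong[of d 1 c] by (simp add: Suc c_def[symmetric] d_def[symmetric])
qed

lemma zimm_correct:
  assumes "M > 1"
  shows "zimm M r p (a mod M) (b mod M) = zim (fund_unit ^ r * ZS a b ^ p) mod M"
proof -
  have "((x mod M) * (y mod M) + (z mod M) * (w mod M)) mod M = (x * y + z * w) mod M" for x y z w
    by (intro mod_add_cong mod_mult_cong) auto
  thus ?thesis
    unfolding zimm_def zpowm_correct[OF assms refl refl, of 1 1]
      zpowm_correct[OF assms mod_mod_trivial mod_mod_trivial, of a b] by simp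
qed

fun cert_ok :: "nat \<Rightarrow> int \<Rightarrow> int list \<Rightarrow> int list list \<Rightarrow> bool list \<Rightarrow> int list \<Rightarrow> int list \<Rightarrow> int \<Rightarrow> int \<Rightarrow>
    int list option \<Rightarrow> bool" where
  "cert_ok p q low ts bs A B a b None \<longleftrightarrow> False"
| "cert_ok p q low ts bs A B a b (Some lam) \<longleftrightarrow>
     length lam = p \<and> list_all (\<lambda>t. dot_mod q lam t = 0) ts \<and> obstr q low bs A B lam a b"

text \<open>The exempted classes r = 1, b = 0, a nonzero include the one of the true solution; they
  are left to \<open>class_one\<close>.\<close>

definition pair_ok :: "nat \<Rightarrow> int \<Rightarrow> int list \<Rightarrow> int list list \<Rightarrow> bool list \<Rightarrow> nat \<Rightarrow> int list \<Rightarrow> int list \<Rightarrow>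
    ((int \<times> int) \<times> int list) list \<Rightarrow> int \<Rightarrow> int \<Rightarrow> bool" where
  "pair_ok p q low ts bs r A B certs a b \<longleftrightarrow>
     (if zimm q r p a b \<noteq> 1 \<or> r = 1 \<and> b = 0 \<and> a \<noteq> 0 then True
      else cert_ok p q low ts bs A B a b (map_of certs (a, b)))"

definition row_ok :: "nat \<Rightarrow> int \<Rightarrow> int list \<Rightarrow> int list list \<Rightarrow> bool list \<Rightarrow> nat \<Rightarrow> int list \<Rightarrow> int list \<Rightarrow>
    ((int \<times> int) \<times> int list) list \<Rightarrow> int \<Rightarrow> bool" where
  "row_ok p q low ts bs r A B certs a \<longleftrightarrow> list_all (pair_ok p q low ts bs r A B certs a) [0..q - 1]"

definition class_check :: "nat \<Rightarrow> int \<Rightarrow> int list \<Rightarrow> int list list \<Rightarrow> bool list \<Rightarrow> nat \<Rightarrow> int list \<Rightarrow> int list \<Rightarrow>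
    ((int \<times> int) \<times> int list) list \<Rightarrow> bool" where
  "class_check p q low ts bs r A B certs \<longleftrightarrow> list_all (row_ok p q low ts bs r A B certs) [0..q - 1]"

lemma (in unit_certificate) class_check_sound:
  assumes r: "0 < r" "r < p" and eq: "ZS x 1 = fund_unit ^ r * ZS a b ^ p"
    and A: "Poly A = fibp r" "length A = p" and B: "Poly B = epoly p r" "length B = p"
    and chk: "class_check p (int q) low ts bs r A B certs"
  shows "r = 1 \<and> int q dvd b \<and> \<not> int q dvd a"
proof -
  have q1: "int q > 1" using prime_gt_1_nat[OF q(1)] by simp
  have "zimm (int q) r p (a mod int q) (b mod int q) = 1"
    using zimm_correct[OF q1, of r p a b] q1 unfolding eq[symmetric] by simp
  moreover have "a mod int q \<in> set [0..int q - 1]" "b mod int q \<in> set [0..int q - 1]" using q1 by auto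
  ultimately have "r = 1 \<and> b mod int q = 0 \<and> a mod int q \<noteq> 0 \<or>
      (\<exists>lam. length lam = p \<and> list_all (\<lambda>t. dot lam t mod int q = 0) ts \<and>
         obstr (int q) low bs A B lam (a mod int q) (b mod int q))"
  proof -
    assume 1: "zimm (int q) r p (a mod int q) (b mod int q) = 1"
      and mem: "a mod int q \<in> set [0..int q - 1]" "b mod int q \<in> set [0..int q - 1]"
    have "pair_ok p (int q) low ts bs r A B certs (a mod int q) (b mod int q)"
      using chk mem unfolding class_check_def row_ok_def list_all_iff by blast
    thus ?thesis using 1
      by (cases "map_of certs (a mod int q, b mod int q)")
        (auto simp: pair_ok_def list_all_iff dot_mod_def split: if_splits)
  qed
  thus ?thesis using class_excluded[OF r eq A B] by (auto simp: dvd_eq_mod_eq_0)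
qed

lemma fermat_small:
  fixes q :: nat
  assumes chk: "list_all (\<lambda>a. a = 0 \<or> a ^ n mod int q = 1) [0..int q - 1]" and "\<not> int q dvd a" "n dvd E" "q > 1"
  shows "int q dvd a ^ E - 1"
proof -
  obtain k where k: "E = n * k" using assms(3) by (rule dvdE)
  have "a mod int q \<in> set [0..int q - 1]" "a mod int q \<noteq> 0" using assms(2,4) by (auto simp: dvd_eq_mod_eq_0)
  hence "(a mod int q) ^ n mod int q = 1" using chk by (auto simp: list_all_iff)
  hence 1: "a ^ n mod int q = 1" by (simp add: power_mod)
  have "a ^ E mod int q = (a ^ n mod int q) ^ k mod int q" unfolding k power_mult by (simp add: power_mod)
  also have "\<dots> = 1 mod int q" using 1 by simp
  finally show ?thesis by (simp add: mod_eq_dvd_iff)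
qed

section \<open>The certificates for \<open>p = 3, 5, 7, 11, 13\<close>\<close>

text \<open>
  The units were found by a search for smooth elements of \<open>\<int>[\<tau>]\<close>. Row \<open>i\<close> of \<open>ts\<close> is the logarithm of the
  \<open>i\<close>-th unit modulo \<open>q\<close>, the rows of \<open>mus\<close> are dual to it and vanish on \<open>1\<close> and on \<open>epoly p 1\<close>, and \<open>bs\<close> is
  the binary expansion of \<open>E - 1\<close>, most significant bit first, where \<open>E\<close> is an exponent of
  \<open>(\<int>[\<tau>]/q)\<^sup>*\<close>.
\<close>

definition low3 :: "int list" where
  "low3 = [-2,3,0]"

definition units3 :: "(int list \<times> int list) list" where
  "units3 =
    [([-1,1,1],
      [-17,-3,-5])]"

definition ts3 :: "int list list" where
  "ts3 =
    [[1,2,2]]"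

definition mus3 :: "int list list" where
  "mus3 =
    [[0,0,2]]"

definition bs3 :: "bool list" where
  "bs3 = [True,False,True]"

text \<open>Modulo 3 the polynomial is (X - 2)^3, so the units modulo 3 have exponent 6 = 2 * 3.
  This is the only case in which q divides E.\<close>

lemma unit_certificate_3: "unit_certificate 3 3 low3 units3 ts3 mus3 bs3 6"
proof
  show "lpoly 3 = monom 1 3 + Poly low3"
    by (simp add: lpoly_def low3_def eval_nat_numeral monom_altdef)
  show "list_all (unit_ok 3 low3) units3" "list_all2 (unit_lin 3 (int 3) low3 bs3) units3 ts3"
    "map (\<lambda>mu. map (dot_mod (int 3) mu) ts3) mus3 =
      map (\<lambda>i. map (\<lambda>j. if i = j then 1 else 0) [0..<length units3]) [0..<length units3]"
    by code_simp+
qed (simp_all add: low3_def units3_def mus3_def bs3_def prime_nat_numeral_eq)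

lemma fib_3_1:
  "Poly [1,0,0] = fibp 1" "Poly [1,-1,0] = epoly 3 1"
  by (simp_all add: epoly_def eval_nat_numeral one_pCons)

lemma class_solution_3:
  assumes eq: "ZS x 1 = fund_unit ^ r * ZS a b ^ 3" and r: "0 < r" "r \<le> (3 - 1) div 2"
  shows "r = 1 \<and> b = 0"
proof -
  interpret unit_certificate 3 3 low3 units3 ts3 mus3 bs3 6 by (rule unit_certificate_3)
  have r1: "r = 1" using r by simp
  \<comment> \<open>Modulo 3 cubing is additive and the condition is merely a + 2b = 1. Modulo 9 it
    forces 3 | b and excludes 3 | a, so p = 3 needs no table of forms.\<close>
  have chk: "list_all (\<lambda>a. list_all (\<lambda>b. zimm 9 1 3 a b \<noteq> 1 \<or> b mod 3 = 0 \<and> a mod 3 \<noteq> 0) [0..8]) [0..8]"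
    by code_simp
  have "zimm 9 1 3 (a mod 9) (b mod 9) = 1"
    using zimm_correct[of 9 1 3 a b] unfolding eq[unfolded r1, symmetric] by simp
  moreover have mem: "a mod 9 \<in> set [0..8]" "b mod 9 \<in> set [0..8]" by auto
  ultimately have "b mod 9 mod 3 = 0 \<and> a mod 9 mod 3 \<noteq> 0"
    using chk[unfolded list_all_iff, rule_format, OF mem] by simp
  hence *: "r = 1 \<and> int 3 dvd b \<and> \<not> int 3 dvd a" using r1 by (auto simp: mod_mod_cancel dvd_eq_mod_eq_0)

  have "b = 0"
  \<comment> \<open>In all five cases \<open>k0\<close> is p - 2, the degree of
    \<open>epoly p 1\<close>, whose leading coefficient is -1. Here \<open>e = 1\<close> because 3
    divides 6 exactly once.\<close>
  proof (rule class_one[OF _ _ fib_3_1(2), where x = x and a = a and ?k0.0 = 1 and e = 1])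
    show "ZS x 1 = fund_unit * ZS a b ^ 3" using eq * by simp
    show "int 3 dvd a ^ 6 - 1" by (rule fermat_small[of 2]) (use * in \<open>simp_all add: upto_rec1\<close>)
    show "list_all (\<lambda>mu. dot mu (onel low3) mod int 3 = 0 \<and> dot mu [1,-1,0] mod int 3 = 0) mus3"
      by code_simp
  qed (use * in auto)
  thus ?thesis using * by blast
qed

definition low5 :: "int list" where
  "low5 = [-2,5,0,5,0]"

definition units5 :: "(int list \<times> int list) list" where
  "units5 =
    [([1,-3,1,-1,0],
      [45,15,41,3,8]),
     ([1,-1,0,-1,0],
      [3,-4,1,-1,0])]"

definition ts5 :: "int list list" where
  "ts5 =
    [[6,4,8,0,9],
     [5,7,6,4,3]]"

definition mus5 :: "int list list" where
  "mus5 =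
    [[0,5,10,1,0],
     [0,8,7,6,0]]"

definition bs5 :: "bool list" where
  "bs5 = [True,True,True,False,True,True,True]"

definition certs5_1 :: "((int \<times> int) \<times> int list) list" where
  "certs5_1 =
    [((1,7), [0,8,1,8,9]),
     ((1,10), [0,0,7,7,6]),
     ((2,5), [0,6,9,6,4]),
     ((3,8), [0,0,7,7,6]),
     ((3,10), [0,8,1,8,9]),
     ((4,6), [0,8,1,8,9]),
     ((4,7), [0,0,7,7,6]),
     ((5,2), [0,8,1,8,9]),
     ((5,6), [0,0,7,7,6]),
     ((6,4), [0,6,9,6,4]),
     ((7,1), [0,6,9,6,4]),
     ((8,9), [0,6,9,6,4]),
     ((9,2), [0,0,7,7,6]),
     ((9,8), [0,8,1,8,9]),
     ((10,3), [0,6,9,6,4])]"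

definition certs5_2 :: "((int \<times> int) \<times> int list) list" where
  "certs5_2 =
    [((0,1), [0,10,3,9,10]),
     ((0,3), [0,10,3,9,10]),
     ((0,4), [0,10,3,9,10]),
     ((0,5), [0,10,3,9,10]),
     ((0,9), [0,10,3,9,10]),
     ((1,6), [0,3,5,9,4]),
     ((2,6), [0,7,7,9,9]),
     ((2,8), [0,2,7,6,10]),
     ((3,7), [0,3,5,9,4]),
     ((4,2), [0,3,5,9,4]),
     ((5,8), [0,3,5,9,4]),
     ((6,2), [0,2,7,6,10]),
     ((6,7), [0,7,7,9,9]),
     ((7,6), [0,2,7,6,10]),
     ((7,10), [0,7,7,9,9]),
     ((8,2), [0,7,7,9,9]),
     ((8,10), [0,2,7,6,10]),
     ((9,10), [0,3,5,9,4]),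
     ((10,7), [0,2,7,6,10]),
     ((10,8), [0,7,7,9,9])]"

text \<open>The exponent is 11^2 - 1. For p = 7, 11, 13 it is 3^3 - 1, 3^10 - 1 and 5^4 - 1; all are
  prime to q, whence \<open>e = 0\<close> in these cases.\<close>

lemma unit_certificate_5: "unit_certificate 5 11 low5 units5 ts5 mus5 bs5 120"
proof
  show "lpoly 5 = monom 1 5 + Poly low5"
    by (simp add: lpoly_def low5_def eval_nat_numeral monom_altdef)
  show "list_all (unit_ok 5 low5) units5" "list_all2 (unit_lin 5 (int 11) low5 bs5) units5 ts5"
    "map (\<lambda>mu. map (dot_mod (int 11) mu) ts5) mus5 =
      map (\<lambda>i. map (\<lambda>j. if i = j then 1 else 0) [0..<length units5]) [0..<length units5]"
    by code_simp+
qed (simp_all add: low5_def units5_def mus5_def bs5_def prime_nat_numeral_eq)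

lemma class_check_5_1: "class_check 5 (int 11) low5 ts5 bs5 1 [1,0,0,0,0] [1,-2,0,-1,0] certs5_1"
  by code_simp

lemma class_check_5_2: "class_check 5 (int 11) low5 ts5 bs5 2 [0,1,0,0,0] [1,1,1,0,0] certs5_2"
  by code_simp

lemma fib_5_1:
  "Poly [1,0,0,0,0] = fibp 1" "Poly [1,-2,0,-1,0] = epoly 5 1"
  by (simp_all add: epoly_def eval_nat_numeral one_pCons)

lemma fib_5_2:
  "Poly [0,1,0,0,0] = fibp 2" "Poly [1,1,1,0,0] = epoly 5 2"
  by (simp_all add: epoly_def eval_nat_numeral one_pCons)

lemma class_solution_5:
  assumes eq: "ZS x 1 = fund_unit ^ r * ZS a b ^ 5" and r: "0 < r" "r \<le> (5 - 1) div 2"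
  shows "r = 1 \<and> b = 0"
proof -
  interpret unit_certificate 5 11 low5 units5 ts5 mus5 bs5 120 by (rule unit_certificate_5)
  have "r \<in> {1, 2}" using r by auto
  hence *: "r = 1 \<and> int 11 dvd b \<and> \<not> int 11 dvd a"
    using class_check_sound[OF _ _ _ fib_5_1(1) _ fib_5_1(2) _ class_check_5_1, of x a b]
      class_check_sound[OF _ _ _ fib_5_2(1) _ fib_5_2(2) _ class_check_5_2, of x a b] eq
    by auto

  have "b = 0"
  proof (rule class_one[OF _ _ fib_5_1(2), where x = x and a = a and ?k0.0 = 3 and e = 0])
    show "ZS x 1 = fund_unit * ZS a b ^ 5" using eq * by simp
    show "int 11 dvd a ^ 120 - 1" by (rule fermat_small[of 10]) (use * in \<open>simp_all add: upto_rec1\<close>)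
    show "list_all (\<lambda>mu. dot mu (onel low5) mod int 11 = 0 \<and> dot mu [1,-2,0,-1,0] mod int 11 = 0) mus5"
      by code_simp
  qed (use * in auto)
  thus ?thesis using * by blast
qed

definition low7 :: "int list" where
  "low7 = [-2,7,0,14,0,7,0]"

definition units7 :: "(int list \<times> int list) list" where
  "units7 =
    [([-1,4,0,1,0,0,0],
      [31,14,57,7,28,1,4]),
     ([-1,6,-9,5,-6,1,-1],
      [-411,-189,-750,-92,-367,-13,-52]),
     ([1,-4,2,-5,4,-1,1],
      [13,14,36,7,20,1,3])]"

definition ts7 :: "int list list" where
  "ts7 =
    [[2,0,2,2,0,0,2],
     [0,0,1,0,0,2,2],
     [2,1,1,1,2,0,0]]"

definition mus7 :: "int list list" where
  "mus7 =
    [[0,2,1,0,0,0,1],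
     [0,1,2,0,0,0,1],
     [0,1,0,0,0,0,0]]"

definition bs7 :: "bool list" where
  "bs7 = [True,True,False,False,True]"

definition certs7_1 :: "((int \<times> int) \<times> int list) list" where
  "certs7_1 =
    [((0,2), [0,0,1,2,0,1,0]),
     ((1,2), [0,0,1,2,0,1,0])]"

definition certs7_2 :: "((int \<times> int) \<times> int list) list" where
  "certs7_2 =
    [((1,1), [0,0,1,2,0,1,0]),
     ((1,2), [0,1,0,0,1,0,0]),
     ((2,0), [0,0,1,2,0,1,0])]"

definition certs7_3 :: "((int \<times> int) \<times> int list) list" where
  "certs7_3 =
    [((0,2), [0,1,0,0,1,0,0]),
     ((2,0), [0,2,2,1,2,2,0]),
     ((2,2), [0,2,1,2,2,1,0])]"

lemma unit_certificate_7: "unit_certificate 7 3 low7 units7 ts7 mus7 bs7 26"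
proof
  show "lpoly 7 = monom 1 7 + Poly low7"
    by (simp add: lpoly_def low7_def eval_nat_numeral monom_altdef)
  show "list_all (unit_ok 7 low7) units7" "list_all2 (unit_lin 7 (int 3) low7 bs7) units7 ts7"
    "map (\<lambda>mu. map (dot_mod (int 3) mu) ts7) mus7 =
      map (\<lambda>i. map (\<lambda>j. if i = j then 1 else 0) [0..<length units7]) [0..<length units7]"
    by code_simp+
qed (simp_all add: low7_def units7_def mus7_def bs7_def prime_nat_numeral_eq)

lemma class_check_7_1: "class_check 7 (int 3) low7 ts7 bs7 1 [1,0,0,0,0,0,0] [1,-3,0,-4,0,-1,0] certs7_1"
  by code_simp

lemma class_check_7_2: "class_check 7 (int 3) low7 ts7 bs7 2 [0,1,0,0,0,0,0] [1,1,3,0,1,0,0] certs7_2"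
  by code_simp

lemma class_check_7_3: "class_check 7 (int 3) low7 ts7 bs7 3 [1,0,1,0,0,0,0] [1,-2,1,-1,0,0,0] certs7_3"
  by code_simp

lemma fib_7_1:
  "Poly [1,0,0,0,0,0,0] = fibp 1" "Poly [1,-3,0,-4,0,-1,0] = epoly 7 1"
  by (simp_all add: epoly_def eval_nat_numeral one_pCons)

lemma fib_7_2:
  "Poly [0,1,0,0,0,0,0] = fibp 2" "Poly [1,1,3,0,1,0,0] = epoly 7 2"
  by (simp_all add: epoly_def eval_nat_numeral one_pCons)

lemma fib_7_3:
  "Poly [1,0,1,0,0,0,0] = fibp 3" "Poly [1,-2,1,-1,0,0,0] = epoly 7 3"
  by (simp_all add: epoly_def eval_nat_numeral one_pCons)

lemma class_solution_7:
  assumes eq: "ZS x 1 = fund_unit ^ r * ZS a b ^ 7" and r: "0 < r" "r \<le> (7 - 1) div 2"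
  shows "r = 1 \<and> b = 0"
proof -
  interpret unit_certificate 7 3 low7 units7 ts7 mus7 bs7 26 by (rule unit_certificate_7)
  have "r \<in> {1, 2, 3}" using r by auto
  hence *: "r = 1 \<and> int 3 dvd b \<and> \<not> int 3 dvd a"
    using class_check_sound[OF _ _ _ fib_7_1(1) _ fib_7_1(2) _ class_check_7_1, of x a b]
      class_check_sound[OF _ _ _ fib_7_2(1) _ fib_7_2(2) _ class_check_7_2, of x a b]
      class_check_sound[OF _ _ _ fib_7_3(1) _ fib_7_3(2) _ class_check_7_3, of x a b] eq
    by auto

  have "b = 0"
  proof (rule class_one[OF _ _ fib_7_1(2), where x = x and a = a and ?k0.0 = 5 and e = 0])
    show "ZS x 1 = fund_unit * ZS a b ^ 7" using eq * by simp
    show "int 3 dvd a ^ 26 - 1" by (rule fermat_small[of 2]) (use * in \<open>simp_all add: upto_rec1\<close>)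
    show "list_all (\<lambda>mu. dot mu (onel low7) mod int 3 = 0 \<and> dot mu [1,-3,0,-4,0,-1,0] mod int 3 = 0) mus7"
      by code_simp
  qed (use * in auto)
  thus ?thesis using * by blast
qed

definition low11 :: "int list" where
  "low11 = [-2,11,0,55,0,77,0,44,0,11,0]"

definition units11 :: "(int list \<times> int list) list" where
  "units11 =
    [([-1,4,12,1,43,0,34,0,10,0,1],
      [-49,-38,-225,-57,-309,-36,-176,-10,-44,-1,-4]),
     ([-1,7,-8,26,-38,14,-33,2,-10,0,-1],
      [4801,3524,21952,4833,30086,2741,17050,683,4245,62,385]),
     ([1,-4,-10,-19,-30,-21,-27,-8,-9,-1,-1],
      [-13151,-9646,-60141,-13218,-82433,-7489,-46718,-1864,-11632,-169,-1055]),
     ([-1,3,0,13,0,7,0,1,0,0,0],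
      [-7,14,95,7,188,1,121,0,32,0,3]),
     ([1,-4,0,-20,0,-21,0,-8,0,-1,0],
      [5,-12,25,-19,26,-8,9,-1,1,0,0])]"

definition ts11 :: "int list list" where
  "ts11 =
    [[0,2,2,0,2,1,2,2,2,0,2],
     [0,1,0,1,2,1,0,0,0,2,1],
     [2,2,2,2,2,1,2,1,0,0,0],
     [1,0,2,0,2,2,0,1,0,0,2],
     [2,1,0,1,1,0,2,0,2,1,2]]"

definition mus11 :: "int list list" where
  "mus11 =
    [[0,2,0,1,0,0,0,0,0,0,0],
     [0,0,0,0,1,2,1,0,0,0,0],
     [0,1,1,2,1,1,1,0,0,0,0],
     [0,0,1,0,2,2,2,0,0,0,0],
     [0,0,2,0,2,2,1,0,0,0,0]]"

definition bs11 :: "bool list" where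
  "bs11 = [True,True,True,False,False,True,True,False,True,False,True,False,False,True,True,True]"

definition certs11_1 :: "((int \<times> int) \<times> int list) list" where
  "certs11_1 =
    [((0,2), [0,2,1,0,2,0,1,0,0,0,0]),
     ((2,1), [0,2,0,2,1,0,2,1,0,0,0])]"

definition certs11_2 :: "((int \<times> int) \<times> int list) list" where
  "certs11_2 =
    [((2,0), [0,2,0,2,1,0,2,1,0,0,0]),
     ((2,1), [0,0,2,2,0,1,0,0,2,0,0]),
     ((2,2), [0,0,2,2,2,0,1,1,0,0,0])]"

definition certs11_3 :: "((int \<times> int) \<times> int list) list" where
  "certs11_3 =
    [((0,2), [0,2,2,1,0,0,0,2,0,0,0]),
     ((1,1), [0,2,2,1,0,0,0,2,0,0,0]),
     ((2,0), [0,0,1,1,0,2,0,0,1,0,0])]"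

definition certs11_4 :: "((int \<times> int) \<times> int list) list" where
  "certs11_4 =
    [((0,1), [0,0,2,2,0,1,0,0,2,0,0]),
     ((1,1), [0,2,0,2,0,2,0,2,1,0,0]),
     ((2,1), [0,2,0,2,2,1,1,0,2,0,0])]"

definition certs11_5 :: "((int \<times> int) \<times> int list) list" where
  "certs11_5 =
    [((0,1), [0,1,0,1,2,0,1,2,0,0,0]),
     ((1,2), [0,2,2,1,0,0,0,2,0,0,0]),
     ((2,0), [0,2,1,0,2,0,1,0,0,0,0])]"

lemma unit_certificate_11: "unit_certificate 11 3 low11 units11 ts11 mus11 bs11 59048"
proof
  show "lpoly 11 = monom 1 11 + Poly low11"
    by (simp add: lpoly_def low11_def eval_nat_numeral monom_altdef)
  show "list_all (unit_ok 11 low11) units11" "list_all2 (unit_lin 11 (int 3) low11 bs11) units11 ts11"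
    "map (\<lambda>mu. map (dot_mod (int 3) mu) ts11) mus11 =
      map (\<lambda>i. map (\<lambda>j. if i = j then 1 else 0) [0..<length units11]) [0..<length units11]"
    by code_simp+
qed (simp_all add: low11_def units11_def mus11_def bs11_def prime_nat_numeral_eq)

lemma class_check_11_1: "class_check 11 (int 3) low11 ts11 bs11 1 [1,0,0,0,0,0,0,0,0,0,0] [1,-5,0,-20,0,-21,0,-8,0,-1,0] certs11_1"
  by code_simp

lemma class_check_11_2: "class_check 11 (int 3) low11 ts11 bs11 2 [0,1,0,0,0,0,0,0,0,0,0] [1,1,10,0,15,0,7,0,1,0,0] certs11_2"
  by code_simp

lemma class_check_11_3: "class_check 11 (int 3) low11 ts11 bs11 3 [1,0,1,0,0,0,0,0,0,0,0] [1,-4,1,-10,0,-6,0,-1,0,0,0] certs11_3"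
  by code_simp

lemma class_check_11_4: "class_check 11 (int 3) low11 ts11 bs11 4 [0,2,0,1,0,0,0,0,0,0,0] [1,2,6,1,5,0,1,0,0,0,0] certs11_4"
  by code_simp

lemma class_check_11_5: "class_check 11 (int 3) low11 ts11 bs11 5 [1,0,3,0,1,0,0,0,0,0,0] [1,-3,3,-4,1,-1,0,0,0,0,0] certs11_5"
  by code_simp

lemma fib_11_1:
  "Poly [1,0,0,0,0,0,0,0,0,0,0] = fibp 1" "Poly [1,-5,0,-20,0,-21,0,-8,0,-1,0] = epoly 11 1"
  by (simp_all add: epoly_def eval_nat_numeral one_pCons)

lemma fib_11_2:
  "Poly [0,1,0,0,0,0,0,0,0,0,0] = fibp 2" "Poly [1,1,10,0,15,0,7,0,1,0,0] = epoly 11 2"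
  by (simp_all add: epoly_def eval_nat_numeral one_pCons)

lemma fib_11_3:
  "Poly [1,0,1,0,0,0,0,0,0,0,0] = fibp 3" "Poly [1,-4,1,-10,0,-6,0,-1,0,0,0] = epoly 11 3"
  by (simp_all add: epoly_def eval_nat_numeral one_pCons)

lemma fib_11_4:
  "Poly [0,2,0,1,0,0,0,0,0,0,0] = fibp 4" "Poly [1,2,6,1,5,0,1,0,0,0,0] = epoly 11 4"
  by (simp_all add: epoly_def eval_nat_numeral one_pCons)

lemma fib_11_5:
  "Poly [1,0,3,0,1,0,0,0,0,0,0] = fibp 5" "Poly [1,-3,3,-4,1,-1,0,0,0,0,0] = epoly 11 5"
  by (simp_all add: epoly_def eval_nat_numeral one_pCons)

lemma class_solution_11:
  assumes eq: "ZS x 1 = fund_unit ^ r * ZS a b ^ 11" and r: "0 < r" "r \<le> (11 - 1) div 2"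
  shows "r = 1 \<and> b = 0"
proof -
  interpret unit_certificate 11 3 low11 units11 ts11 mus11 bs11 59048 by (rule unit_certificate_11)
  have "r \<in> {1, 2, 3, 4, 5}" using r by auto
  hence *: "r = 1 \<and> int 3 dvd b \<and> \<not> int 3 dvd a"
    using class_check_sound[OF _ _ _ fib_11_1(1) _ fib_11_1(2) _ class_check_11_1, of x a b]
      class_check_sound[OF _ _ _ fib_11_2(1) _ fib_11_2(2) _ class_check_11_2, of x a b]
      class_check_sound[OF _ _ _ fib_11_3(1) _ fib_11_3(2) _ class_check_11_3, of x a b]
      class_check_sound[OF _ _ _ fib_11_4(1) _ fib_11_4(2) _ class_check_11_4, of x a b]
      class_check_sound[OF _ _ _ fib_11_5(1) _ fib_11_5(2) _ class_check_11_5, of x a b] eq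
    by auto

  have "b = 0"
  proof (rule class_one[OF _ _ fib_11_1(2), where x = x and a = a and ?k0.0 = 9 and e = 0])
    show "ZS x 1 = fund_unit * ZS a b ^ 11" using eq * by simp
    show "int 3 dvd a ^ 59048 - 1" by (rule fermat_small[of 2]) (use * in \<open>simp_all add: upto_rec1\<close>)
    show "list_all (\<lambda>mu. dot mu (onel low11) mod int 3 = 0 \<and> dot mu [1,-5,0,-20,0,-21,0,-8,0,-1,0] mod int 3 = 0) mus11"
      by code_simp
  qed (use * in auto)
  thus ?thesis using * by blast
qed

definition low13 :: "int list" where
  "low13 = [-2,13,0,91,0,182,0,156,0,65,0,13,0]"

definition units13 :: "(int list \<times> int list) list" where
  "units13 =
    [([-3,19,11,81,31,123,27,78,9,21,1,2,0],
      [-2431,-2109,-15568,-4116,-30499,-3486,-25935,-1442,-10764,-287,-2148,-22,-165]),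
     ([1,-7,3,-41,1,-61,0,-37,0,-10,0,-1,0],
      [2045,1781,13106,3493,25674,2974,21833,1236,9063,247,1809,19,139]),
     ([1,-5,0,-35,0,-56,0,-36,0,-10,0,-1,0],
      [7,-24,42,-86,70,-104,43,-53,11,-12,1,-1,0]),
     ([-1,8,-4,-1,-25,-13,-50,-7,-35,-1,-10,0,-1],
      [18095,15730,115909,30818,227016,26213,193020,10884,80108,2173,15986,167,1228]),
     ([-3,20,3,97,-59,111,-95,54,-52,12,-12,1,-1],
      [-211,-176,-1349,-322,-2669,-242,-2298,-87,-964,-15,-194,-1,-15]),
     ([-1,6,3,50,5,96,1,69,0,20,0,2,0],
      [1429,1245,9156,2435,17938,2066,15253,855,6330,170,1263,13,97])]"

definition ts13 :: "int list list" where
  "ts13 =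
    [[3,0,3,1,1,4,3,4,2,1,1,0,1],
     [2,0,4,2,4,0,3,4,3,0,2,4,4],
     [3,3,3,0,4,0,4,2,2,0,4,1,3],
     [1,3,0,4,1,2,2,2,3,3,0,2,2],
     [1,1,0,4,1,1,1,3,1,0,0,4,2],
     [3,1,3,2,1,0,3,3,4,4,3,3,2]]"

definition mus13 :: "int list list" where
  "mus13 =
    [[0,2,4,0,0,0,4,3,0,0,0,0,0],
     [0,3,0,1,2,4,3,3,0,0,0,0,0],
     [0,1,3,4,2,2,3,2,0,0,0,0,0],
     [0,3,2,0,2,2,3,0,0,0,0,0,0],
     [0,1,2,2,1,3,0,1,0,0,0,0,0],
     [0,3,0,3,2,1,4,1,0,0,0,0,0]]"

definition bs13 :: "bool list" where
  "bs13 = [True,False,False,True,True,False,True,True,True,True]"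

definition certs13_1 :: "((int \<times> int) \<times> int list) list" where
  "certs13_1 =
    [((0,4), [0,4,3,4,2,4,0,3,0,2,0,0,0]),
     ((1,3), [0,1,4,3,0,1,2,4,2,0,0,0,0]),
     ((3,1), [0,0,4,4,0,2,4,1,0,0,0,0,0]),
     ((3,3), [0,1,3,2,0,3,1,0,2,0,0,0,0])]"

definition certs13_2 :: "((int \<times> int) \<times> int list) list" where
  "certs13_2 =
    [((0,3), [0,2,3,1,0,2,4,3,4,0,0,0,0]),
     ((3,0), [0,1,2,1,0,0,0,1,2,0,0,0,0]),
     ((3,1), [0,1,1,0,0,2,4,2,2,0,0,0,0]),
     ((4,1), [0,3,2,4,0,3,1,2,1,0,0,0,0]),
     ((4,2), [0,1,2,1,0,0,0,1,2,0,0,0,0])]"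

definition certs13_3 :: "((int \<times> int) \<times> int list) list" where
  "certs13_3 =
    [((0,2), [0,1,0,4,0,4,3,3,2,0,0,0,0]),
     ((1,2), [0,4,3,4,0,0,0,4,3,0,0,0,0]),
     ((2,3), [0,4,2,3,0,2,4,0,3,0,0,0,0]),
     ((3,3), [0,2,0,3,0,3,1,1,4,0,0,0,0]),
     ((4,2), [0,1,4,3,0,1,2,4,2,0,0,0,0])]"

definition certs13_4 :: "((int \<times> int) \<times> int list) list" where
  "certs13_4 =
    [((0,2), [0,1,0,4,0,4,3,3,2,0,0,0,0]),
     ((3,0), [0,0,2,2,0,1,2,3,0,0,0,0,0]),
     ((3,4), [0,3,0,2,0,2,4,4,1,0,0,0,0]),
     ((4,3), [0,2,3,1,0,2,4,3,4,0,0,0,0]),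
     ((4,4), [0,1,0,4,0,4,3,3,2,0,0,0,0])]"

definition certs13_5 :: "((int \<times> int) \<times> int list) list" where
  "certs13_5 =
    [((0,4), [0,4,3,4,0,0,0,4,3,0,0,0,0]),
     ((2,1), [0,4,0,1,0,1,2,2,3,0,0,0,0]),
     ((2,3), [0,3,3,0,0,1,2,1,1,0,0,0,0]),
     ((4,0), [0,1,0,4,0,4,3,3,2,0,0,0,0]),
     ((4,3), [0,0,4,4,0,2,4,1,0,0,0,0,0])]"

definition certs13_6 :: "((int \<times> int) \<times> int list) list" where
  "certs13_6 =
    [((0,1), [0,4,0,1,0,1,2,2,3,0,0,0,0]),
     ((1,4), [0,4,2,3,0,2,4,0,3,0,0,0,0]),
     ((2,1), [0,3,4,1,0,4,3,0,1,0,0,0,0]),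
     ((3,1), [0,2,4,2,1,2,0,4,0,1,0,0,0]),
     ((4,4), [0,2,3,1,0,2,4,3,4,0,0,0,0])]"

lemma unit_certificate_13: "unit_certificate 13 5 low13 units13 ts13 mus13 bs13 624"
proof
  show "lpoly 13 = monom 1 13 + Poly low13"
    by (simp add: lpoly_def low13_def eval_nat_numeral monom_altdef)
  show "list_all (unit_ok 13 low13) units13" "list_all2 (unit_lin 13 (int 5) low13 bs13) units13 ts13"
    "map (\<lambda>mu. map (dot_mod (int 5) mu) ts13) mus13 =
      map (\<lambda>i. map (\<lambda>j. if i = j then 1 else 0) [0..<length units13]) [0..<length units13]"
    by code_simp+
qed (simp_all add: low13_def units13_def mus13_def bs13_def prime_nat_numeral_eq)

lemma class_check_13_1: "class_check 13 (int 5) low13 ts13 bs13 1 [1,0,0,0,0,0,0,0,0,0,0,0,0] [1,-6,0,-35,0,-56,0,-36,0,-10,0,-1,0] certs13_1"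
  by code_simp

lemma class_check_13_2: "class_check 13 (int 5) low13 ts13 bs13 2 [0,1,0,0,0,0,0,0,0,0,0,0,0] [1,1,15,0,35,0,28,0,9,0,1,0,0] certs13_2"
  by code_simp

lemma class_check_13_3: "class_check 13 (int 5) low13 ts13 bs13 3 [1,0,1,0,0,0,0,0,0,0,0,0,0] [1,-5,1,-20,0,-21,0,-8,0,-1,0,0,0] certs13_3"
  by code_simp

lemma class_check_13_4: "class_check 13 (int 5) low13 ts13 bs13 4 [0,2,0,1,0,0,0,0,0,0,0,0,0] [1,2,10,1,15,0,7,0,1,0,0,0,0] certs13_4"
  by code_simp

lemma class_check_13_5: "class_check 13 (int 5) low13 ts13 bs13 5 [1,0,3,0,1,0,0,0,0,0,0,0,0] [1,-4,3,-10,1,-6,0,-1,0,0,0,0,0] certs13_5"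
  by code_simp

lemma class_check_13_6: "class_check 13 (int 5) low13 ts13 bs13 6 [0,3,0,4,0,1,0,0,0,0,0,0,0] [1,3,6,4,5,1,1,0,0,0,0,0,0] certs13_6"
  by code_simp

lemma fib_13_1:
  "Poly [1,0,0,0,0,0,0,0,0,0,0,0,0] = fibp 1" "Poly [1,-6,0,-35,0,-56,0,-36,0,-10,0,-1,0] = epoly 13 1"
  by (simp_all add: epoly_def eval_nat_numeral one_pCons)

lemma fib_13_2:
  "Poly [0,1,0,0,0,0,0,0,0,0,0,0,0] = fibp 2" "Poly [1,1,15,0,35,0,28,0,9,0,1,0,0] = epoly 13 2"
  by (simp_all add: epoly_def eval_nat_numeral one_pCons)

lemma fib_13_3:
  "Poly [1,0,1,0,0,0,0,0,0,0,0,0,0] = fibp 3" "Poly [1,-5,1,-20,0,-21,0,-8,0,-1,0,0,0] = epoly 13 3"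
  by (simp_all add: epoly_def eval_nat_numeral one_pCons)

lemma fib_13_4:
  "Poly [0,2,0,1,0,0,0,0,0,0,0,0,0] = fibp 4" "Poly [1,2,10,1,15,0,7,0,1,0,0,0,0] = epoly 13 4"
  by (simp_all add: epoly_def eval_nat_numeral one_pCons)

lemma fib_13_5:
  "Poly [1,0,3,0,1,0,0,0,0,0,0,0,0] = fibp 5" "Poly [1,-4,3,-10,1,-6,0,-1,0,0,0,0,0] = epoly 13 5"
  by (simp_all add: epoly_def eval_nat_numeral one_pCons)

lemma fib_13_6:
  "Poly [0,3,0,4,0,1,0,0,0,0,0,0,0] = fibp 6" "Poly [1,3,6,4,5,1,1,0,0,0,0,0,0] = epoly 13 6"
  by (simp_all add: epoly_def eval_nat_numeral one_pCons)

lemma class_solution_13: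
  assumes eq: "ZS x 1 = fund_unit ^ r * ZS a b ^ 13" and r: "0 < r" "r \<le> (13 - 1) div 2"
  shows "r = 1 \<and> b = 0"
proof -
  interpret unit_certificate 13 5 low13 units13 ts13 mus13 bs13 624 by (rule unit_certificate_13)
  have "r \<in> {1, 2, 3, 4, 5, 6}" using r by auto
  hence *: "r = 1 \<and> int 5 dvd b \<and> \<not> int 5 dvd a"
    using class_check_sound[OF _ _ _ fib_13_1(1) _ fib_13_1(2) _ class_check_13_1, of x a b]
      class_check_sound[OF _ _ _ fib_13_2(1) _ fib_13_2(2) _ class_check_13_2, of x a b]
      class_check_sound[OF _ _ _ fib_13_3(1) _ fib_13_3(2) _ class_check_13_3, of x a b]
      class_check_sound[OF _ _ _ fib_13_4(1) _ fib_13_4(2) _ class_check_13_4, of x a b]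
      class_check_sound[OF _ _ _ fib_13_5(1) _ fib_13_5(2) _ class_check_13_5, of x a b]
      class_check_sound[OF _ _ _ fib_13_6(1) _ fib_13_6(2) _ class_check_13_6, of x a b] eq
    by auto

  have "b = 0"
  proof (rule class_one[OF _ _ fib_13_1(2), where x = x and a = a and ?k0.0 = 11 and e = 0])
    show "ZS x 1 = fund_unit * ZS a b ^ 13" using eq * by simp
    show "int 5 dvd a ^ 624 - 1" by (rule fermat_small[of 4]) (use * in \<open>simp_all add: upto_rec1\<close>)
    show "list_all (\<lambda>mu. dot mu (onel low13) mod int 5 = 0 \<and> dot mu [1,-6,0,-35,0,-56,0,-36,0,-10,0,-1,0] mod int 5 = 0) mus13"
      by code_simp
  qed (use * in auto)
  thus ?thesis using * by blast
qed

section \<open>The theorem\<close>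

text \<open>The sign condition on \<open>a * zre\<close> strengthens the induction: it makes every
  term nonnegative when multiplying by (a + sqrt 2)^2, so the coefficient of sqrt 2 at least
  doubles.\<close>

lemma zim_odd_power:
  "zim (ZS a 1 ^ (2 * k + 1)) \<ge> 1 \<and> a * zre (ZS a 1 ^ (2 * k + 1)) \<ge> 0 \<and>
   (k > 0 \<longrightarrow> zim (ZS a 1 ^ (2 * k + 1)) \<ge> 2)"
proof (induction k)
  case (Suc k)
  define w where "w = ZS a 1 ^ (2 * k + 1)"
  have w: "zim w \<ge> 1" "a * zre w \<ge> 0" using Suc by (simp_all add: w_def)
  have "ZS a 1 ^ (2 * Suc k + 1) = ZS a 1 * (ZS a 1 * w)" by (simp add: w_def)
  hence im: "zim (ZS a 1 ^ (2 * Suc k + 1)) = a * a * zim w + 2 * zim w + 2 * (a * zre w)"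
    and re: "a * zre (ZS a 1 ^ (2 * Suc k + 1)) = a * a * (a * zre w) + 2 * (a * zre w) + 4 * (a * a * zim w)"
    by (simp_all add: algebra_simps)
  have "a * a * zim w \<ge> 0" "a * a * (a * zre w) \<ge> 0" using w by (simp_all add: mult_nonneg_nonneg)
  hence "zim (ZS a 1 ^ (2 * Suc k + 1)) \<ge> 2" "a * zre (ZS a 1 ^ (2 * Suc k + 1)) \<ge> 0"
    unfolding im re using w by linarith+
  thus ?case by simp
qed simp

lemma dvd_zim_power: "b dvd zim (ZS a b ^ n)"
  by (induction n) auto

text \<open>This rules out r = 0: b divides the coefficient of sqrt 2, so b = 1 or b = -1, and up to
  conjugation the coefficient is at least 2.\<close>

lemma zim_power_ne_1:
  assumes "odd p" "p > 1"
  shows "zim (ZS a b ^ p) \<noteq> 1"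
proof
  assume 1: "zim (ZS a b ^ p) = 1"
  obtain k where k: "p = 2 * k + 1" using assms(1) by (rule oddE)
  have ge: "zim (ZS a 1 ^ p) \<ge> 2" using zim_odd_power[of a k] assms(2) by (simp add: k)
  have "b dvd 1" using dvd_zim_power[of b a p] 1 by simp
  hence "b = 1 \<or> b = -1" by auto
  thus False
  proof
    assume "b = 1"
    thus False using ge 1 by simp
  next
    assume "b = -1"
    hence "ZS a b = zconj (ZS a 1)" by (simp add: zconj_def)
    hence "zim (ZS a b ^ p) = - zim (ZS a 1 ^ p)" by (simp only: zconj_power[symmetric]) simp
    thus False using ge 1 by simp
  qed
qed

theorem theorem1p2:
  fixes p :: nat and x y :: int
  assumes "prime p" and "3 \<le> p" and "p \<le> 13"
    and "x ^ 2 - 2 = y ^ p"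
  shows "y = -1"
proof -
  have "p = 3 \<or> p = 4 \<or> p = 5 \<or> p = 6 \<or> p = 7 \<or> p = 8 \<or> p = 9 \<or> p = 10 \<or> p = 11 \<or> p = 12 \<or> p = 13"
    using assms(2,3) by presburger
  hence p: "p \<in> {3, 5, 7, 11, 13}" using assms(1) by (auto simp: prime_nat_numeral_eq)
  hence odd: "odd p" and p1: "p > 1" by auto
  obtain r a b x' where r: "r \<le> (p - 1) div 2" and x': "x' = x \<or> x' = - x"
    and eq: "ZS x' 1 = fund_unit ^ r * ZS a b ^ p"
    using square_minus_two_eq_power[OF odd p1 assms(4)] .
  have "r > 0"
  proof (rule ccontr)
    assume "\<not> r > 0"
    hence "ZS x' 1 = ZS a b ^ p" using eq by simp
    hence "zim (ZS a b ^ p) = 1" by (metis zsqrt2.sel(2))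
    thus False using zim_power_ne_1[OF odd p1] by blast
  qed
  hence "r = 1 \<and> b = 0"
    using p eq r class_solution_3[of x' r a b] class_solution_5[of x' r a b] class_solution_7[of x' r a b]
      class_solution_11[of x' r a b] class_solution_13[of x' r a b] by blast
  \<comment> \<open>With b = 0 both coefficients of the product equal a^p, so x' equals the
    coefficient 1 of sqrt 2.\<close>
  hence "ZS x' 1 = fund_unit * ZS (a ^ p) 0" using eq by (simp add: ZS_power)
  hence "x' = a ^ p" "a ^ p = 1" by (simp_all add: times_zsqrt2_def)
  hence "x\<^sup>2 = 1" using x' by auto
  hence yp: "y ^ p = -1" using assms(4) by simp
  hence "\<bar>y\<bar> ^ p = 1" by (simp flip: power_abs)
  hence "\<bar>y\<bar> = 1" using p1 power_eq_imp_eq_base[of "\<bar>y\<bar>" p 1] by simp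
  moreover have "y \<noteq> 1" using yp by auto
  ultimately show ?thesis by linarith
qed

end
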